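(* The Weighted Balanced Connected Subgraph problem (WBCS) on bicolored vertex-weighted trees with $n$ vertices can be solved in $\min\{O(nW^2),\,O(n^{1.585}W)\}$ time, where $W$ is the total weight of the vertices of the tree.
   Context: All graphs are finite, simple and undirected. A graph is bicolored if every vertex is colored blue or red (adjacent vertices may have the same color); $B$ and $R$ denote the sets of blue and red vertices. The Weighted Balanced Connected Subgraph problem (WBCS): the input is a bicolored vertex-weighted graph $G=(B\cup R,E,w)$ with $w:B\cup R\to\mathbb{N}$ (positive integers); the output is a connected induced subgraph $H$ of $G$ with $\sum_{v\in V(H)\cap B}w(v)=\sum_{v\in V(H)\cap R}w(v)$ whose total weight $\sum_{v\in V(H)}w(v)$ is maximum. The empty subgraph (of weight $0$) counts as feasible. Running times are in the standard unit-cost RAM model. *)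

theory Defs
  imports Complex_Main "Graph_Theory.Digraph_Component"
begin

section \<open>Weighted balanced connected subgraphs\<close>

text \<open>
  A finite simple undirected graph is a \<^locale>\<open>pair_graph\<close>: a finite, loop-free and
  symmetric set of arcs, in which an edge between \<open>u\<close> and \<open>v\<close> is the pair of arcs \<open>(u, v)\<close>,
  \<open>(v, u)\<close>.

  The library predicate \<^const>\<open>tree\<close> cannot be used for such graphs, because the closed walk
  \<open>u, v, u\<close> along a single edge is a \<^const>\<open>pre_digraph.cycle\<close>. The cycles of the
  undirected graph are the ones of length at least 3.

  \<^const>\<open>Digraph_Component.connected\<close> includes that there is at least one vertex.
\<close>

definition undirected_tree :: "'a pair_pre_digraph \<Rightarrow> bool" where
  "undirected_tree G \<longleftrightarrow> pair_graph G \<and> Digraph_Component.connected (with_proj G) \<and>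
    \<not> (\<exists>p. pre_digraph.cycle (with_proj G) p \<and> length p \<ge> 3)"

datatype color = Blue | Red

definition color_weight ::
    "'a pair_pre_digraph \<Rightarrow> ('a \<Rightarrow> color) \<Rightarrow> ('a \<Rightarrow> nat) \<Rightarrow> color \<Rightarrow> nat" where
  "color_weight G col w c = (\<Sum>v\<in>{v \<in> pverts G. col v = c}. w v)"

definition total_weight :: "'a pair_pre_digraph \<Rightarrow> ('a \<Rightarrow> nat) \<Rightarrow> nat" where
  "total_weight G w = (\<Sum>v\<in>pverts G. w v)"

definition wbcs_feasible ::
    "'a pair_pre_digraph \<Rightarrow> ('a \<Rightarrow> color) \<Rightarrow> ('a \<Rightarrow> nat) \<Rightarrow> 'a pair_pre_digraph \<Rightarrow> bool" where
  "wbcs_feasible G col w H \<longleftrightarrow>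
    induced_subgraph (with_proj H) (with_proj G) \<and>
    (pverts H = {} \<or> Digraph_Component.connected (with_proj H)) \<and>
    color_weight H col w Blue = color_weight H col w Red"

definition wbcs_solution ::
    "'a pair_pre_digraph \<Rightarrow> ('a \<Rightarrow> color) \<Rightarrow> ('a \<Rightarrow> nat) \<Rightarrow> 'a pair_pre_digraph \<Rightarrow> bool" where
  "wbcs_solution G col w H \<longleftrightarrow> wbcs_feasible G col w H \<and>
    (\<forall>H'. wbcs_feasible G col w H' \<longrightarrow> total_weight H' w \<le> total_weight H w)"

section \<open>Unit-cost random access machines\<close>

text \<open>
  The machine of Cook and Reckhow (Time bounded random access machines, 1973): registers
  \<open>X 0, X 1, \<dots>\<close> holding integers and initially 0, a read-only input sequence and a write-only
  output sequence. Arithmetic is restricted to addition and subtraction, since multiplication at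
  unit cost on integers of unbounded size would be unreasonably powerful.

  \<open>SetConst i a\<close> is \<open>X i := a\<close>, \<open>Add i j k\<close> is \<open>X i := X j + X k\<close>,
  \<open>Sub i j k\<close> is \<open>X i := X j - X k\<close>, \<open>Load i j\<close> is \<open>X i := X (X j)\<close>,
  \<open>Store i j\<close> is \<open>X (X i) := X j\<close>, and \<open>JumpPos j m\<close> continues at instruction
  \<open>m\<close> (counted from 0) if \<open>X j > 0\<close>.
\<close>

datatype instr =
    SetConst nat int
  | Add nat nat nat
  | Sub nat nat nat
  | Load nat nat
  | Store nat nat
  | JumpPos nat nat
  | Read nat
  | Print nat

record ram_config =
  pc :: nat
  reg :: "nat \<Rightarrow> int"
  inp :: "int list"
  out :: "int list"

text \<open>
  The result \<^const>\<open>None\<close> is a fault: an indirect access with a negative address, or reading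
  past the end of the input.
\<close>

fun exec_instr :: "instr \<Rightarrow> ram_config \<Rightarrow> ram_config option" where
  "exec_instr (SetConst i a) c = Some (c\<lparr>pc := Suc (pc c), reg := (reg c)(i := a)\<rparr>)"
| "exec_instr (Add i j k) c = Some (c\<lparr>pc := Suc (pc c), reg := (reg c)(i := reg c j + reg c k)\<rparr>)"
| "exec_instr (Sub i j k) c = Some (c\<lparr>pc := Suc (pc c), reg := (reg c)(i := reg c j - reg c k)\<rparr>)"
| "exec_instr (Load i j) c =
    (if reg c j < 0 then None
     else Some (c\<lparr>pc := Suc (pc c), reg := (reg c)(i := reg c (nat (reg c j)))\<rparr>))"
| "exec_instr (Store i j) c =
    (if reg c i < 0 then None
     else Some (c\<lparr>pc := Suc (pc c), reg := (reg c)(nat (reg c i) := reg c j)\<rparr>))"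
| "exec_instr (JumpPos j m) c = Some (c\<lparr>pc := (if reg c j > 0 then m else Suc (pc c))\<rparr>)"
| "exec_instr (Read i) c =
    (case inp c of
       [] \<Rightarrow> None
     | x # xs \<Rightarrow> Some (c\<lparr>pc := Suc (pc c), reg := (reg c)(i := x), inp := xs\<rparr>))"
| "exec_instr (Print i) c = Some (c\<lparr>pc := Suc (pc c), out := out c @ [reg c i]\<rparr>)"

text \<open>
  \<open>ram_run P c t c'\<close>: started in \<open>c\<close>, the program \<open>P\<close> halts in \<open>c'\<close> after
  exactly \<open>t\<close> instructions. It halts by leaving the program text; a fault is not halting.
\<close>

inductive ram_run :: "instr list \<Rightarrow> ram_config \<Rightarrow> nat \<Rightarrow> ram_config \<Rightarrow> bool" for P where
  halt: "pc c \<ge> length P \<Longrightarrow> ram_run P c 0 c"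
| step: "pc c < length P \<Longrightarrow> exec_instr (P ! pc c) c = Some c' \<Longrightarrow> ram_run P c' t c'' \<Longrightarrow>
    ram_run P c (Suc t) c''"

definition ram_init :: "int list \<Rightarrow> ram_config" where
  "ram_init xs = \<lparr>pc = 0, reg = (\<lambda>_. 0), inp = xs, out = []\<rparr>"

definition ram_computes :: "instr list \<Rightarrow> int list \<Rightarrow> nat \<Rightarrow> int list \<Rightarrow> bool" where
  "ram_computes P xs t ys \<longleftrightarrow> (\<exists>c. ram_run P (ram_init xs) t c \<and> out c = ys)"

section \<open>Input and output format\<close>

text \<open>
  The vertices are \<open>0, \<dots>, n - 1\<close>. The input consists of \<open>n\<close>, then color and weight of
  every vertex, then the two endpoints of every edge, where each edge occurs once, in an arbitrary
  orientation and at an arbitrary position. A subgraph is output as a repetition-free list of its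
  vertices in any order, which determines it because it is induced.
\<close>

definition edge_list :: "'a pair_pre_digraph \<Rightarrow> ('a \<times> 'a) list \<Rightarrow> bool" where
  "edge_list G es \<longleftrightarrow>
    distinct es \<and> parcs G = set es \<union> (set es)\<inverse> \<and> set es \<inter> (set es)\<inverse> = {}"

fun color_code :: "color \<Rightarrow> int" where
  "color_code Blue = 0"
| "color_code Red = 1"

definition wbcs_input ::
    "nat \<Rightarrow> (nat \<Rightarrow> color) \<Rightarrow> (nat \<Rightarrow> nat) \<Rightarrow> (nat \<times> nat) list \<Rightarrow> int list" where
  "wbcs_input n col w es =
    int n # concat (map (\<lambda>v. [color_code (col v), int (w v)]) [0..<n])
          @ concat (map (\<lambda>(u, v). [int u, int v]) es)"

definition encodes_subgraph :: "int list \<Rightarrow> nat pair_pre_digraph \<Rightarrow> bool" where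
  "encodes_subgraph ys H \<longleftrightarrow> distinct ys \<and> set ys = int ` pverts H"

end

theory Submission
  imports Defs
begin

text \<open>
  Root the tree and list it in preorder, with a child of largest subtree last. A connected subgraph
  is a set containing with every vertex its parent, up to a topmost vertex, so it is built by
  passing through the preorder and either taking a vertex or skipping its whole subtree: the best
  weights for all differences between blue and red weight, over the sets inside the positions from
  \<open>j\<close> up to an end \<open>q\<close>, follow in \<open>O(W)\<close> steps from those for
  \<open>j + 1\<close> and for the position after the subtree at \<open>j\<close>.

  The end \<open>q\<close> has to be the end of the subtree of the topmost vertex. Along a path from a
  vertex through last children this end does not change, so one pass serves all topmost vertices on
  such a path and costs \<open>O(W)\<close> times the size of the subtree at its upper end. A
  vertex lies below at most \<open>1 + log n\<close> upper ends, since a child that is not last has at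
  most half of the size of its parent. The total time \<open>O(n W log n)\<close> is below both
  bounds, because \<open>n \<le> W\<close>. Everything else, such as rooting the tree, takes
  \<open>O(n\<^sup>2)\<close> steps, which is again \<open>O(n W)\<close>.
\<close>

section \<open>A structured language for the random access machine\<close>

text \<open>Combining the finished tables of two siblings would take a max-plus convolution of two
  tables of length \<open>O(W)\<close>. The preorder avoids this: a pass extends its tables by one
  vertex at a time, and sibling subtrees are joined by letting the pass continue from one into the
  next. The price is that a row depends on the end of the pass, so rows are recomputed for every
  chain. The machine shapes the rest. It has no multiplication and no procedure calls, so row
  addresses are tabulated, the tree is processed by loops over orders and linked lists instead of
  recursion, and vertices are taken by decreasing size through \<open>n\<close> scans. No decisions
  are stored: an optimal set is recovered by running one pass again and comparing entries of its
  rows.\<close>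

text \<open>
  A store consists of arrays of natural numbers; array \<open>0\<close> holds the scalar variables. Element
  \<open>i\<close> of array \<open>a < 15\<close> lives in register \<open>16 * i + a\<close>, and the registers
  \<open>16 * t + 15\<close> hold the intermediate results of expression evaluation. Subtraction is truncated,
  so no address is ever negative.
\<close>

datatype aexp = Lit nat | Var nat | Arr nat aexp | Plus aexp aexp | Minus aexp aexp

datatype com =
    Skip
  | Assign nat aexp
  | Put nat aexp aexp
  | Input nat
  | Output aexp
  | Seq com com  (infixr \<open>;;\<close> 60)
  | Cond aexp com com
  | While aexp com

record store =
  mem :: "nat \<Rightarrow> nat \<Rightarrow> nat"
  ins :: "nat list"
  outs :: "nat list"

definition upd :: "nat \<Rightarrow> nat \<Rightarrow> nat \<Rightarrow> store \<Rightarrow> store" where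
  "upd a i v s = s\<lparr>mem := (mem s)(a := (mem s a)(i := v))\<rparr>"

lemma upd_simps [simp]:
  "mem (upd a i v s) b = (if b = a then (mem s a)(i := v) else mem s b)"
  "ins (upd a i v s) = ins s"
  "outs (upd a i v s) = outs s"
  by (auto simp: upd_def)

fun aval :: "aexp \<Rightarrow> (nat \<Rightarrow> nat \<Rightarrow> nat) \<Rightarrow> nat" where
  "aval (Lit k) m = k"
| "aval (Var x) m = m 0 x"
| "aval (Arr a e) m = m a (aval e m)"
| "aval (Plus e f) m = aval e m + aval f m"
| "aval (Minus e f) m = aval e m - aval f m"

text \<open>Both the length of the code of an expression and a bound on its running time, because
  this code has no backward jumps.\<close>

fun alen :: "aexp \<Rightarrow> nat" where
  "alen (Lit k) = 1"
| "alen (Var x) = 2"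
| "alen (Arr a e) = alen e + 7"
| "alen (Plus e f) = alen e + alen f + 1"
| "alen (Minus e f) = alen e + alen f + 3"

text \<open>The time is an upper bound on the steps of the compiled code, not the exact number: both
  rules for \<open>Cond\<close> charge 3, the overhead of the branch that has to jump over the other
  one.\<close>

inductive exec :: "com \<Rightarrow> store \<Rightarrow> nat \<Rightarrow> store \<Rightarrow> bool" where
  exec_Skip: "exec Skip s 0 s"
| exec_Assign: "exec (Assign x e) s (alen e + 2) (upd 0 x (aval e (mem s)) s)"
| exec_Put: "exec (Put a e f) s (alen e + alen f + 7) (upd a (aval e (mem s)) (aval f (mem s)) s)"
| exec_Input: "ins s = k # ks \<Longrightarrow> exec (Input x) s 1 ((upd 0 x k s)\<lparr>ins := ks\<rparr>)"
| exec_Output: "exec (Output e) s (alen e + 1) (s\<lparr>outs := outs s @ [aval e (mem s)]\<rparr>)"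
| exec_Seq: "exec c s k s' \<Longrightarrow> exec d s' l s'' \<Longrightarrow> exec (c ;; d) s (k + l) s''"
| exec_CondT: "aval e (mem s) > 0 \<Longrightarrow> exec c s k s' \<Longrightarrow> exec (Cond e c d) s (alen e + 3 + k) s'"
| exec_CondF: "aval e (mem s) = 0 \<Longrightarrow> exec d s k s' \<Longrightarrow> exec (Cond e c d) s (alen e + 3 + k) s'"
| exec_WhileF: "aval e (mem s) = 0 \<Longrightarrow> exec (While e c) s (alen e + 3) s"
| exec_WhileT: "aval e (mem s) > 0 \<Longrightarrow> exec c s k s' \<Longrightarrow> exec (While e c) s' l s'' \<Longrightarrow>
    exec (While e c) s (alen e + 3 + k + l) s''"

subsection \<open>Compilation\<close>

abbreviation tmp :: "nat \<Rightarrow> nat" where "tmp t \<equiv> 16 * t + 15"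

text \<open>Multiplication by 16 is four doublings, as the machine only adds and subtracts.\<close>

fun address :: "nat \<Rightarrow> nat \<Rightarrow> nat \<Rightarrow> instr list" where
  "address a t u =
    [Add (tmp t) (tmp t) (tmp t), Add (tmp t) (tmp t) (tmp t), Add (tmp t) (tmp t) (tmp t),
     Add (tmp t) (tmp t) (tmp t), SetConst (tmp u) (int a), Add (tmp t) (tmp t) (tmp u)]"

text \<open>Jump targets are absolute, so the position \<open>p\<close> of the code is a parameter.
  The temporaries from \<open>t\<close> upwards serve as evaluation stack, with the result left in
  \<open>tmp t\<close>.\<close>

fun acomp :: "nat \<Rightarrow> aexp \<Rightarrow> nat \<Rightarrow> instr list" where
  "acomp p (Lit k) t = [SetConst (tmp t) (int k)]"
| "acomp p (Var x) t = [SetConst (tmp t) 0, Add (tmp t) (16 * x) (tmp t)]"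
| "acomp p (Arr a e) t = acomp p e t @ address a t (Suc t) @ [Load (tmp t) (tmp t)]"
| "acomp p (Plus e f) t =
    acomp p e t @ acomp (p + alen e) f (Suc t) @ [Add (tmp t) (tmp t) (tmp (Suc t))]"
| "acomp p (Minus e f) t = acomp p e t @ acomp (p + alen e) f (Suc t) @
    [Sub (tmp t) (tmp t) (tmp (Suc t)), JumpPos (tmp t) (p + alen e + alen f + 3),
     SetConst (tmp t) 0]"

fun clen :: "com \<Rightarrow> nat" where
  "clen Skip = 0"
| "clen (Assign x e) = alen e + 2"
| "clen (Put a e f) = alen e + alen f + 7"
| "clen (Input x) = 1"
| "clen (Output e) = alen e + 1"
| "clen (c ;; d) = clen c + clen d"
| "clen (Cond e c d) = alen e + clen c + clen d + 3"
| "clen (While e c) = alen e + clen c + 5"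

text \<open>An unconditional jump is a \<open>SetConst\<close> with a positive value followed by
  \<open>JumpPos\<close>. A jump is taken on a positive test, hence the else branch is placed
  first.\<close>

fun ccomp :: "nat \<Rightarrow> com \<Rightarrow> instr list" where
  "ccomp p Skip = []"
| "ccomp p (Assign x e) = acomp p e 0 @
    [SetConst (tmp 1) 0, Add (16 * x) (tmp 0) (tmp 1)]"
| "ccomp p (Put a e f) = acomp p e 0 @ acomp (p + alen e) f 1 @ address a 0 2 @
    [Store (tmp 0) (tmp 1)]"
| "ccomp p (Input x) = [Read (16 * x)]"
| "ccomp p (Output e) = acomp p e 0 @ [Print (tmp 0)]"
| "ccomp p (c ;; d) = ccomp p c @ ccomp (p + clen c) d"
| "ccomp p (Cond e c d) = acomp p e 0 @ [JumpPos (tmp 0) (p + alen e + clen d + 3)] @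
    ccomp (p + alen e + 1) d @
    [SetConst (tmp 0) 1, JumpPos (tmp 0) (p + alen e + clen d + clen c + 3)] @
    ccomp (p + alen e + clen d + 3) c"
| "ccomp p (While e c) = acomp p e 0 @
    [JumpPos (tmp 0) (p + alen e + 3), SetConst (tmp 0) 1,
     JumpPos (tmp 0) (p + alen e + clen c + 5)] @
    ccomp (p + alen e + 3) c @ [SetConst (tmp 0) 1, JumpPos (tmp 0) p]"

fun awf :: "aexp \<Rightarrow> bool" where
  "awf (Lit k) \<longleftrightarrow> True"
| "awf (Var x) \<longleftrightarrow> True"
| "awf (Arr a e) \<longleftrightarrow> a < 15 \<and> awf e"
| "awf (Plus e f) \<longleftrightarrow> awf e \<and> awf f"
| "awf (Minus e f) \<longleftrightarrow> awf e \<and> awf f"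

fun cwf :: "com \<Rightarrow> bool" where
  "cwf Skip \<longleftrightarrow> True"
| "cwf (Assign x e) \<longleftrightarrow> awf e"
| "cwf (Put a e f) \<longleftrightarrow> a < 15 \<and> awf e \<and> awf f"
| "cwf (Input x) \<longleftrightarrow> True"
| "cwf (Output e) \<longleftrightarrow> awf e"
| "cwf (c ;; d) \<longleftrightarrow> cwf c \<and> cwf d"
| "cwf (Cond e c d) \<longleftrightarrow> awf e \<and> cwf c \<and> cwf d"
| "cwf (While e c) \<longleftrightarrow> awf e \<and> cwf c"

lemma length_acomp [simp]: "length (acomp p e t) = alen e"
  by (induction e arbitrary: p t) auto

lemma length_ccomp [simp]: "length (ccomp p c) = clen c"
  by (induction c arbitrary: p) auto

definition code_at :: "instr list \<Rightarrow> nat \<Rightarrow> instr list \<Rightarrow> bool" where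
  "code_at P p is \<longleftrightarrow> p + length is \<le> length P \<and> (\<forall>k<length is. P ! (p + k) = is ! k)"

lemma code_at_Nil [simp]: "code_at P p [] \<longleftrightarrow> p \<le> length P"
  by (simp add: code_at_def)

lemma code_at_append [simp]:
  "code_at P p (is @ js) \<longleftrightarrow> code_at P p is \<and> code_at P (p + length is) js"
proof
  assume *: "code_at P p (is @ js)"
  have "P ! (p + k) = is ! k" if "k < length is" for k
    using * that by (auto simp: code_at_def nth_append)
  moreover have "P ! (p + length is + k) = js ! k" if "k < length js" for k
  proof -
    from * that have "P ! (p + (length is + k)) = (is @ js) ! (length is + k)"
      unfolding code_at_def by (metis length_append nat_add_left_cancel_less)
    then show ?thesis by (simp add: add.assoc)
  qed
  ultimately show "code_at P p is \<and> code_at P (p + length is) js"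
    using * by (auto simp: code_at_def)
next
  assume *: "code_at P p is \<and> code_at P (p + length is) js"
  have "P ! (p + k) = (is @ js) ! k" if k: "k < length is + length js" for k
  proof (cases "k < length is")
    case False
    then have "P ! (p + length is + (k - length is)) = js ! (k - length is)"
      using * k unfolding code_at_def
      by (metis add_diff_inverse_nat nat_add_left_cancel_less)
    with False show ?thesis by (simp add: nth_append)
  qed (use * in \<open>auto simp: code_at_def nth_append\<close>)
  then show "code_at P p (is @ js)"
    using * by (auto simp: code_at_def)
qed

lemma code_at_Cons [simp]:
  "code_at P p (i # is) \<longleftrightarrow> p < length P \<and> P ! p = i \<and> code_at P (Suc p) is"
  using code_at_append [of P p "[i]" "is"] by (auto simp: code_at_def)

text \<open>\<open>ram_run\<close> only describes runs that halt. A partial run is therefore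
  expressed through the halting runs that it prefixes, which makes it composable.\<close>

definition steps :: "instr list \<Rightarrow> ram_config \<Rightarrow> nat \<Rightarrow> ram_config \<Rightarrow> bool" where
  "steps P c k c' \<longleftrightarrow> (\<forall>t d. ram_run P c' t d \<longrightarrow> ram_run P c (k + t) d)"

lemma steps_refl: "steps P c 0 c"
  by (simp add: steps_def)

lemma steps_trans: "steps P c k c' \<Longrightarrow> steps P c' l c'' \<Longrightarrow> steps P c (k + l) c''"
  by (simp add: steps_def add.assoc)

lemma steps_instr:
  "pc c < length P \<Longrightarrow> exec_instr (P ! pc c) c = Some c' \<Longrightarrow> steps P c' k c'' \<Longrightarrow>
    steps P c (Suc k) c''"
  by (auto simp: steps_def intro: ram_run.step)

fun exec_list :: "instr list \<Rightarrow> ram_config \<Rightarrow> ram_config option" where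
  "exec_list [] c = Some c"
| "exec_list (i # is) c = (case exec_instr i c of None \<Rightarrow> None | Some c' \<Rightarrow> exec_list is c')"

fun straight :: "instr \<Rightarrow> bool" where
  "straight (JumpPos j m) = False"
| "straight _ = True"

lemma pc_straight: "exec_instr i c = Some c' \<Longrightarrow> straight i \<Longrightarrow> pc c' = Suc (pc c)"
  by (cases i) (auto split: if_splits list.splits)

lemma steps_straight:
  "code_at P (pc c) is \<Longrightarrow> list_all straight is \<Longrightarrow> exec_list is c = Some c' \<Longrightarrow>
    steps P c (length is) c'"
proof (induction "is" arbitrary: c)
  case Nil
  then show ?case by (simp add: steps_refl)
next
  case (Cons i "is")
  then obtain d where "exec_instr i c = Some d" "exec_list is d = Some c'"
    by (auto split: option.splits)
  with Cons show ?case
    by (auto intro!: steps_instr simp: pc_straight)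
qed

section \<open>Simulation of stores by registers\<close>

definition rel_mem :: "(nat \<Rightarrow> nat \<Rightarrow> nat) \<Rightarrow> (nat \<Rightarrow> int) \<Rightarrow> bool" where
  "rel_mem m r \<longleftrightarrow> (\<forall>a<15. \<forall>i. r (16 * i + a) = int (m a i))"

lemma tmp_noteq: "a < 15 \<Longrightarrow> 16 * i + a \<noteq> tmp t"
  by presburger

lemma rel_mem_cong:
  assumes "rel_mem m r" "\<And>x. (\<And>t. x \<noteq> tmp t) \<Longrightarrow> r' x = r x"
  shows "rel_mem m r'"
  using assms tmp_noteq unfolding rel_mem_def by metis

lemma acomp_correctI:
  assumes "steps P c k (c\<lparr>pc := q, reg := r\<rparr>)" "k \<le> l" "q = pc c + l" "r (tmp t) = v"
    "\<And>x. (\<forall>u\<ge>t. x \<noteq> tmp u) \<Longrightarrow> r x = reg c x"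
  shows "\<exists>k r. k \<le> l \<and> steps P c k (c\<lparr>pc := pc c + l, reg := r\<rparr>) \<and>
    r (tmp t) = v \<and> (\<forall>x. (\<forall>u\<ge>t. x \<noteq> tmp u) \<longrightarrow> r x = reg c x)"
  using assms by blast

text \<open>Everything below stack level \<open>t\<close> survives, which keeps the first operand
  intact while the second is evaluated at level \<open>Suc t\<close>. The step count is only
  bounded, since the truncation in \<open>Minus\<close> takes two or three instructions.\<close>

lemma acomp_correct:
  assumes "code_at P (pc c) (acomp (pc c) e t)" "rel_mem m (reg c)" "awf e"
  shows "\<exists>k r. k \<le> alen e \<and> steps P c k (c\<lparr>pc := pc c + alen e, reg := r\<rparr>) \<and>
    r (tmp t) = int (aval e m) \<and> (\<forall>x. (\<forall>u\<ge>t. x \<noteq> tmp u) \<longrightarrow> r x = reg c x)"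
  using assms
proof (induction e arbitrary: c t)
  case (Lit k)
  have "steps P c 1 (c\<lparr>pc := pc c + 1, reg := (reg c)(tmp t := int k)\<rparr>)"
    using steps_straight [of P c "acomp (pc c) (Lit k) t"] Lit by simp
  then show ?case by (rule acomp_correctI) auto
next
  case (Var x)
  have "reg c (16 * x + 0) = int (m 0 x)"
    using Var.prems(2) unfolding rel_mem_def by (metis zero_less_numeral)
  moreover have "16 * x \<noteq> tmp t" by presburger
  ultimately have "steps P c 2 (c\<lparr>pc := pc c + 2, reg := (reg c)(tmp t := int (m 0 x))\<rparr>)"
    using steps_straight [of P c "acomp (pc c) (Var x) t"] Var by (simp add: numeral_2_eq_2)
  then show ?case by (rule acomp_correctI) auto
next
  case (Arr a e)
  obtain k r where 1: "k \<le> alen e" "steps P c k (c\<lparr>pc := pc c + alen e, reg := r\<rparr>)"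
      "r (tmp t) = int (aval e m)" "\<forall>x. (\<forall>u\<ge>t. x \<noteq> tmp u) \<longrightarrow> r x = reg c x"
    using Arr.IH [of c t] Arr.prems by auto
  define r' where "r' = r(tmp (Suc t) := int a, tmp t := int (m a (aval e m)))"
  have r: "r (16 * i + a) = int (m a i)" for i
    using 1(4) Arr.prems(2,3) tmp_noteq [of a i] unfolding rel_mem_def by auto
  have [simp]: "nat (16 * int i + int a) = 16 * i + a" for i
    by (simp add: nat_plus_as_int)
  have [simp]: "16 * i + a \<noteq> tmp t" "16 * i + a \<noteq> 31 + 16 * t" for i t
    using Arr.prems(3) by (auto, presburger+)
  \<comment> \<open>The sum of sixteen copies, bracketed as the four doublings of
    \<open>address\<close> produce it.\<close>
  have *: "int (aval e m) + int (aval e m) + (int (aval e m) + int (aval e m)) +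
      (int (aval e m) + int (aval e m) + (int (aval e m) + int (aval e m))) +
      (int (aval e m) + int (aval e m) + (int (aval e m) + int (aval e m)) +
      (int (aval e m) + int (aval e m) + (int (aval e m) + int (aval e m)))) = 16 * int (aval e m)"
    by simp
  let ?is = "address a t (Suc t) @ [Load (tmp t) (tmp t)]"
  have "exec_list ?is (c\<lparr>pc := pc c + alen e, reg := r\<rparr>) =
      Some (c\<lparr>pc := pc c + alen e + 7, reg := r'\<rparr>)"
    using 1(3) by (simp add: * r r'_def fun_upd_twist)
  then have "steps P (c\<lparr>pc := pc c + alen e, reg := r\<rparr>) (length ?is)
      (c\<lparr>pc := pc c + alen e + 7, reg := r'\<rparr>)"
    using Arr.prems(1) by (intro steps_straight) auto
  note st = steps_trans [OF 1(2) this]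
  have eq: "r' x = reg c x" if "\<forall>u\<ge>t. x \<noteq> tmp u" for x
  proof -
    have "x \<noteq> tmp t" "x \<noteq> tmp (Suc t)" using that le_SucI by blast+
    then show ?thesis using 1(4) that by (simp add: r'_def)
  qed
  from st show ?case
    by (rule acomp_correctI) (use 1 eq in \<open>auto simp: r'_def\<close>)
next
  case (Plus e f)
  obtain k r where 1: "k \<le> alen e" "steps P c k (c\<lparr>pc := pc c + alen e, reg := r\<rparr>)"
      "r (tmp t) = int (aval e m)" "\<forall>x. (\<forall>u\<ge>t. x \<noteq> tmp u) \<longrightarrow> r x = reg c x"
    using Plus.IH(1) [of c t] Plus.prems by auto
  have "rel_mem m r" using rel_mem_cong [OF Plus.prems(2)] 1(4) by metis
  then obtain l r' where 2: "l \<le> alen f"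
      "steps P (c\<lparr>pc := pc c + alen e, reg := r\<rparr>) l
        (c\<lparr>pc := pc c + alen e + alen f, reg := r'\<rparr>)"
      "r' (tmp (Suc t)) = int (aval f m)" "\<forall>x. (\<forall>u\<ge>Suc t. x \<noteq> tmp u) \<longrightarrow> r' x = r x"
    using Plus.IH(2) [of "c\<lparr>pc := pc c + alen e, reg := r\<rparr>" "Suc t"] Plus.prems by auto
  have "r' (tmp t) = int (aval e m)" using 1(3) 2(4) by auto
  then have "steps P (c\<lparr>pc := pc c + alen e + alen f, reg := r'\<rparr>) 1
      (c\<lparr>pc := pc c + alen e + alen f + 1, reg := r'(tmp t := int (aval e m) + int (aval f m))\<rparr>)"
    using steps_straight [of P "c\<lparr>pc := pc c + alen e + alen f, reg := r'\<rparr>"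
        "[Add (tmp t) (tmp t) (tmp (Suc t))]"] Plus.prems 2(3) by (simp add: add.assoc)
  from steps_trans [OF steps_trans [OF 1(2) 2(2)] this] show ?case
    by (rule acomp_correctI) (use 1 2 in auto)
next
  case (Minus e f)
  obtain k r where 1: "k \<le> alen e" "steps P c k (c\<lparr>pc := pc c + alen e, reg := r\<rparr>)"
      "r (tmp t) = int (aval e m)" "\<forall>x. (\<forall>u\<ge>t. x \<noteq> tmp u) \<longrightarrow> r x = reg c x"
    using Minus.IH(1) [of c t] Minus.prems by auto
  have "rel_mem m r" using rel_mem_cong [OF Minus.prems(2)] 1(4) by metis
  then obtain l r' where 2: "l \<le> alen f"
      "steps P (c\<lparr>pc := pc c + alen e, reg := r\<rparr>) l
        (c\<lparr>pc := pc c + alen e + alen f, reg := r'\<rparr>)"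
      "r' (tmp (Suc t)) = int (aval f m)" "\<forall>x. (\<forall>u\<ge>Suc t. x \<noteq> tmp u) \<longrightarrow> r' x = r x"
    using Minus.IH(2) [of "c\<lparr>pc := pc c + alen e, reg := r\<rparr>" "Suc t"] Minus.prems by auto
  let ?c = "c\<lparr>pc := pc c + alen e + alen f, reg := r'\<rparr>"
  let ?r = "r'(tmp t := int (aval e m - aval f m))"
  have rt: "r' (tmp t) = int (aval e m)" using 1(3) 2(4) by auto
  have "\<exists>j\<le>3. steps P ?c j (c\<lparr>pc := pc c + alen e + alen f + 3, reg := ?r\<rparr>)"
  proof (cases "aval e m > aval f m")
    case True
    have "steps P ?c (Suc (Suc 0)) (c\<lparr>pc := pc c + alen e + alen f + 3, reg := ?r\<rparr>)"
      using Minus.prems rt 2(3) True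
      by (intro steps_instr [where c' = "c\<lparr>pc := pc c + alen e + alen f + 1, reg := ?r\<rparr>"]
          steps_instr [OF _ _ steps_refl]) (auto simp: add.assoc of_nat_diff)
    then show ?thesis by (intro exI [of _ "Suc (Suc 0)"]) auto
  next
    case False
    let ?r1 = "r'(tmp t := int (aval e m) - int (aval f m))"
    have "steps P ?c (Suc (Suc (Suc 0))) (c\<lparr>pc := pc c + alen e + alen f + 3, reg := ?r\<rparr>)"
      using Minus.prems rt 2(3) False
      by (intro steps_instr [where c' = "c\<lparr>pc := pc c + alen e + alen f + 1, reg := ?r1\<rparr>"]
          steps_instr [where c' = "c\<lparr>pc := pc c + alen e + alen f + 2, reg := ?r1\<rparr>"]
          steps_instr [OF _ _ steps_refl]) (auto simp: add.assoc)
    then show ?thesis by (intro exI [of _ "Suc (Suc (Suc 0))"]) auto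
  qed
  then obtain j where 3: "j \<le> 3"
    "steps P ?c j (c\<lparr>pc := pc c + alen e + alen f + 3, reg := ?r\<rparr>)" by blast
  from steps_trans [OF steps_trans [OF 1(2) 2(2)] 3(2)] show ?case
    by (rule acomp_correctI) (use 1 2 3(1) in auto)
qed

definition rel :: "store \<Rightarrow> ram_config \<Rightarrow> bool" where
  "rel s c \<longleftrightarrow> rel_mem (mem s) (reg c) \<and> inp c = map int (ins s) \<and> out c = map int (outs s)"

lemma rel_mem_upd:
  assumes "rel_mem m r" "a < 15"
  shows "rel_mem (m(a := (m a)(i := v))) (r(16 * i + a := int v))"
proof -
  have "16 * j + b = 16 * i + a \<longleftrightarrow> j = i \<and> b = a" if "b < 15" for b j :: nat
  proof -
    \<comment> \<open>Division and remainder by 16 recover element and array from the number of a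
      register.\<close>
    have "(16 * k + d) div 16 = k" "(16 * k + d) mod 16 = d" if "d < 15" for k d :: nat
      using that by simp_all
    then show ?thesis using assms(2) that by metis
  qed
  moreover have "r (16 * j + b) = int (m b j)" if "b < 15" for b j
    using assms(1) that unfolding rel_mem_def by blast
  ultimately show ?thesis unfolding rel_mem_def by (simp add: fun_upd_def)
qed

lemma rel_mem_tmp: "rel_mem m r \<Longrightarrow> rel_mem m (r(tmp t := v))"
  by (rule rel_mem_cong) auto

lemma acomp_rel:
  assumes "code_at P (pc c) (acomp (pc c) e t)" "rel s c" "awf e"
  shows "\<exists>k c'. k \<le> alen e \<and> steps P c k c' \<and> pc c' = pc c + alen e \<and> rel s c' \<and>
    reg c' (tmp t) = int (aval e (mem s)) \<and> (\<forall>u<t. reg c' (tmp u) = reg c (tmp u))"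
proof -
  obtain k r where kr: "k \<le> alen e" "steps P c k (c\<lparr>pc := pc c + alen e, reg := r\<rparr>)"
      "r (tmp t) = int (aval e (mem s))" "\<forall>x. (\<forall>u\<ge>t. x \<noteq> tmp u) \<longrightarrow> r x = reg c x"
    using acomp_correct [OF assms(1) _ assms(3)] assms(2) unfolding rel_def by blast
  have "rel s (c\<lparr>pc := pc c + alen e, reg := r\<rparr>)"
    using assms(2) kr(4) rel_mem_cong [of "mem s" "reg c" r] unfolding rel_def by auto
  with kr show ?thesis
    by (intro exI [of _ k] exI [of _ "c\<lparr>pc := pc c + alen e, reg := r\<rparr>"]) auto
qed

lemma rel_upd:
  assumes "rel s c" "a < 15" "rel_mem (mem s) r" "x = 16 * a' + a"
  shows "rel (upd a a' v s) (c\<lparr>pc := p, reg := r(x := int v)\<rparr>)"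
  using assms rel_mem_upd [of "mem s" r a a' v] by (simp add: rel_def upd_def)

lemma ccomp_correct:
  assumes "exec cm s k s'" "code_at P (pc c) (ccomp (pc c) cm)" "rel s c" "cwf cm"
  shows "\<exists>l c'. l \<le> k \<and> steps P c l c' \<and> pc c' = pc c + clen cm \<and> rel s' c'"
  using assms
proof (induction arbitrary: c rule: exec.induct)
  case (exec_Skip s)
  then show ?case by (intro exI [of _ 0] exI [of _ c]) (auto intro: steps_refl)
next
  case (exec_Assign x e s)
  then obtain k c1 where 1: "k \<le> alen e" "steps P c k c1" "pc c1 = pc c + alen e" "rel s c1"
      "reg c1 (tmp 0) = int (aval e (mem s))"
    using acomp_rel [of P c e 0 s] by auto
  let ?c2 = "c1\<lparr>pc := pc c1 + 2, reg := (reg c1)(tmp 1 := 0, 16 * x := int (aval e (mem s)))\<rparr>"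
  have "exec_list [SetConst (tmp 1) 0, Add (16 * x) (tmp 0) (tmp 1)] c1 = Some ?c2"
    using 1(5) by simp
  then have "steps P c1 (length [SetConst (tmp 1) 0, Add (16 * x) (tmp 0) (tmp 1)]) ?c2"
    using exec_Assign.prems(1) 1(3) by (intro steps_straight) auto
  note st = steps_trans [OF 1(2) this]
  have "rel (upd 0 x (aval e (mem s)) s) ?c2"
    using 1(4) by (intro rel_upd rel_mem_tmp) (auto simp: rel_def)
  with st show ?case
    using 1(1,3) by (intro exI [of _ "k + 2"] exI [of _ ?c2]) auto
next
  case (exec_Put a e f s)
  then obtain k c1 where 1: "k \<le> alen e" "steps P c k c1" "pc c1 = pc c + alen e" "rel s c1"
      "reg c1 (tmp 0) = int (aval e (mem s))"
    using acomp_rel [of P c e 0 s] by auto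
  then obtain l c2 where 2: "l \<le> alen f" "steps P c1 l c2" "pc c2 = pc c + alen e + alen f"
      "rel s c2" "reg c2 (tmp 1) = int (aval f (mem s))" "reg c2 (tmp 0) = int (aval e (mem s))"
    using acomp_rel [of P c1 f 1 s] exec_Put.prems by auto
  let ?i = "aval e (mem s)"
  let ?is = "address a 0 2 @ [Store (tmp 0) (tmp 1)]"
  let ?c3 = "c2\<lparr>pc := pc c2 + 7, reg := (reg c2)(tmp 2 := int a, tmp 0 := int (16 * ?i + a),
    16 * ?i + a := int (aval f (mem s)))\<rparr>"
  have nat: "nat (16 * int ?i + int a) = 16 * ?i + a" by (simp add: nat_plus_as_int)
  have sum: "int ?i + int ?i + (int ?i + int ?i) + (int ?i + int ?i + (int ?i + int ?i)) +
      (int ?i + int ?i + (int ?i + int ?i) + (int ?i + int ?i + (int ?i + int ?i))) =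
      16 * int ?i" by simp
  have "exec_list ?is c2 = Some ?c3"
    using 2(5,6) by (simp add: nat sum fun_upd_twist)
  then have "steps P c2 (length ?is) ?c3"
    using exec_Put.prems(1) 2(3) by (intro steps_straight) auto
  note st = steps_trans [OF steps_trans [OF 1(2) 2(2)] this]
  have "rel (upd a ?i (aval f (mem s)) s) ?c3"
    using 2(4) exec_Put.prems(3) by (intro rel_upd rel_mem_tmp) (auto simp: rel_def)
  with st show ?case
    using 1(1) 2(1,3)
    by (intro exI [of _ "k + l + length ?is"] exI [of _ ?c3]) auto
next
  case (exec_Input s v vs x)
  let ?c = "c\<lparr>pc := pc c + 1, reg := (reg c)(16 * x := int v), inp := map int vs\<rparr>"
  have "steps P c 1 ?c"
    using exec_Input steps_straight [of P c "[Read (16 * x)]" ?c] by (simp add: rel_def)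
  moreover have "rel ((upd 0 x v s)\<lparr>ins := vs\<rparr>) ?c"
    using rel_upd [of s c 0 "reg c" "16 * x" x v "pc c + 1"] exec_Input by (auto simp: rel_def)
  ultimately show ?case by (intro exI [of _ 1] exI [of _ ?c]) auto
next
  case (exec_Output e s)
  then obtain k c1 where 1: "k \<le> alen e" "steps P c k c1" "pc c1 = pc c + alen e" "rel s c1"
      "reg c1 (tmp 0) = int (aval e (mem s))"
    using acomp_rel [of P c e 0 s] by auto
  let ?c2 = "c1\<lparr>pc := pc c1 + 1, out := out c1 @ [reg c1 (tmp 0)]\<rparr>"
  have "steps P c1 1 ?c2"
    using exec_Output 1(3) steps_straight [of P c1 "[Print (tmp 0)]" ?c2] by simp
  note st = steps_trans [OF 1(2) this]
  have "rel (s\<lparr>outs := outs s @ [aval e (mem s)]\<rparr>) ?c2"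
    using 1(4,5) by (auto simp: rel_def)
  with st show ?case
    using 1(1,3) by (intro exI [of _ "k + 1"] exI [of _ ?c2]) auto
next
  case (exec_Seq cm1 s k s' cm2 l s'')
  then obtain k' c1 where 1: "k' \<le> k" "steps P c k' c1" "pc c1 = pc c + clen cm1" "rel s' c1"
    by (auto dest!: exec_Seq.IH(1))
  with exec_Seq obtain l' c2 where 2: "l' \<le> l" "steps P c1 l' c2"
      "pc c2 = pc c1 + clen cm2" "rel s'' c2"
    using exec_Seq.IH(2) [of c1] by auto
  show ?case
    using steps_trans [OF 1(2) 2(2)] 1 2
    by (intro exI [of _ "k' + l'"] exI [of _ c2]) auto
next
  case (exec_CondT e s cm1 k s' cm2)
  then obtain j c1 where 1: "j \<le> alen e" "steps P c j c1" "pc c1 = pc c + alen e" "rel s c1"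
      "reg c1 (tmp 0) = int (aval e (mem s))"
    using acomp_rel [of P c e 0 s] by auto
  let ?c2 = "c1\<lparr>pc := pc c + alen e + clen cm2 + 3\<rparr>"
  have 2: "steps P c1 (Suc 0) ?c2"
    using exec_CondT.prems exec_CondT.hyps 1(3,5)
    by (intro steps_instr [OF _ _ steps_refl]) auto
  have "rel s ?c2" using 1(4) by (simp add: rel_def)
  then obtain l c3 where 3: "l \<le> k" "steps P ?c2 l c3" "pc c3 = pc ?c2 + clen cm1" "rel s' c3"
    using exec_CondT.IH [of ?c2] exec_CondT.prems by (auto simp: ac_simps numeral_3_eq_3)
  show ?case
    using steps_trans [OF steps_trans [OF 1(2) 2] 3(2)] 1(1) 3
    by (intro exI [of _ "j + Suc 0 + l"] exI [of _ c3]) auto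
next
  case (exec_CondF e s cm2 k s' cm1)
  then obtain j c1 where 1: "j \<le> alen e" "steps P c j c1" "pc c1 = pc c + alen e" "rel s c1"
      "reg c1 (tmp 0) = int (aval e (mem s))"
    using acomp_rel [of P c e 0 s] by auto
  let ?c2 = "c1\<lparr>pc := pc c + alen e + 1\<rparr>"
  have 2: "steps P c1 (Suc 0) ?c2"
    using exec_CondF.prems exec_CondF.hyps 1(3,5)
    by (intro steps_instr [OF _ _ steps_refl]) auto
  have "rel s ?c2" using 1(4) by (simp add: rel_def)
  then obtain l c3 where 3: "l \<le> k" "steps P ?c2 l c3" "pc c3 = pc ?c2 + clen cm2" "rel s' c3"
    using exec_CondF.IH [of ?c2] exec_CondF.prems by (auto simp: ac_simps)
  let ?c4 = "c3\<lparr>pc := pc c + alen e + clen cm2 + clen cm1 + 3, reg := (reg c3)(tmp 0 := 1)\<rparr>"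
  have 4: "steps P c3 (Suc (Suc 0)) ?c4"
    using exec_CondF.prems 3(3)
    by (intro steps_instr [where c' = "c3\<lparr>pc := Suc (pc c3), reg := (reg c3)(tmp 0 := 1)\<rparr>"]
        steps_instr [OF _ _ steps_refl]) (auto simp: ac_simps)
  have "rel s' ?c4" using 3(4) rel_mem_tmp [where t = 0 and v = 1] by (simp add: rel_def)
  then show ?case
    using steps_trans [OF steps_trans [OF steps_trans [OF 1(2) 2] 3(2)] 4] 1(1) 3
    by (intro exI [of _ "j + Suc 0 + l + Suc (Suc 0)"] exI [of _ ?c4]) auto
next
  case (exec_WhileF e s cm)
  then obtain j c1 where 1: "j \<le> alen e" "steps P c j c1" "pc c1 = pc c + alen e" "rel s c1"
      "reg c1 (tmp 0) = int (aval e (mem s))"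
    using acomp_rel [of P c e 0 s] by auto
  let ?c4 = "c1\<lparr>pc := pc c + alen e + clen cm + 5, reg := (reg c1)(tmp 0 := 1)\<rparr>"
  have 2: "steps P c1 (Suc (Suc (Suc 0))) ?c4"
    using exec_WhileF.prems exec_WhileF.hyps 1(3,5)
    by (intro steps_instr [where c' = "c1\<lparr>pc := Suc (pc c1)\<rparr>"]
        steps_instr [where c' = "c1\<lparr>pc := Suc (Suc (pc c1)), reg := (reg c1)(tmp 0 := 1)\<rparr>"]
        steps_instr [OF _ _ steps_refl]) (auto simp: ac_simps)
  have "rel s ?c4" using 1(4) rel_mem_tmp [where t = 0 and v = 1] by (simp add: rel_def)
  then show ?case
    using steps_trans [OF 1(2) 2] 1(1)
    by (intro exI [of _ "j + Suc (Suc (Suc 0))"] exI [of _ ?c4]) auto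
next
  case (exec_WhileT e s cm k s' l s'')
  then obtain j c1 where 1: "j \<le> alen e" "steps P c j c1" "pc c1 = pc c + alen e" "rel s c1"
      "reg c1 (tmp 0) = int (aval e (mem s))"
    using acomp_rel [of P c e 0 s] by auto
  let ?c2 = "c1\<lparr>pc := pc c + alen e + 3\<rparr>"
  have 2: "steps P c1 (Suc 0) ?c2"
    using exec_WhileT.prems exec_WhileT.hyps 1(3,5)
    by (intro steps_instr [OF _ _ steps_refl]) auto
  have "rel s ?c2" using 1(4) by (simp add: rel_def)
  then obtain l' c3 where 3: "l' \<le> k" "steps P ?c2 l' c3" "pc c3 = pc ?c2 + clen cm" "rel s' c3"
    using exec_WhileT.IH(1) [of ?c2] exec_WhileT.prems by (auto simp: ac_simps numeral_3_eq_3)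
  let ?c4 = "c3\<lparr>pc := pc c, reg := (reg c3)(tmp 0 := 1)\<rparr>"
  have 4: "steps P c3 (Suc (Suc 0)) ?c4"
    using exec_WhileT.prems 3(3)
    by (intro steps_instr [where c' = "c3\<lparr>pc := Suc (pc c3), reg := (reg c3)(tmp 0 := 1)\<rparr>"]
        steps_instr [OF _ _ steps_refl]) (auto simp: ac_simps numeral_3_eq_3)
  have "rel s' ?c4" using 3(4) rel_mem_tmp [where t = 0 and v = 1] by (simp add: rel_def)
  then obtain m c5 where 5: "m \<le> l" "steps P ?c4 m c5" "pc c5 = pc c + clen (While e cm)"
      "rel s'' c5"
    using exec_WhileT.IH(2) [of ?c4] exec_WhileT.prems by auto
  show ?case
    using steps_trans [OF steps_trans [OF steps_trans [OF steps_trans [OF 1(2) 2] 3(2)] 4] 5(2)]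
      1(1) 3(1) 5
    by (intro exI [of _ "j + Suc 0 + l' + Suc (Suc 0) + m"] exI [of _ c5]) auto
qed

theorem ccomp_computes:
  assumes "exec cm \<lparr>mem = (\<lambda>_ _. 0), ins = xs, outs = []\<rparr> k s" "cwf cm"
  shows "\<exists>t\<le>k. ram_computes (ccomp 0 cm) (map int xs) t (map int (outs s))"
proof -
  have "code_at (ccomp 0 cm) 0 (ccomp 0 cm)" by (simp add: code_at_def)
  then obtain l c' where "l \<le> k" "steps (ccomp 0 cm) (ram_init (map int xs)) l c'"
      "pc c' = clen cm" "rel s c'"
    using ccomp_correct [OF assms(1), of "ccomp 0 cm" "ram_init (map int xs)"] assms(2)
    by (auto simp: ram_init_def rel_def rel_mem_def)
  then show ?thesis
    using ram_run.halt [of "ccomp 0 cm" c']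
    by (auto simp: ram_computes_def steps_def rel_def intro!: exI [of _ l] exI [of _ c']
        dest: spec [of _ 0])
qed

subsection \<open>Total correctness with time budgets\<close>

text \<open>The postcondition receives the unspent part of the budget \<open>T\<close>. So the rule
  for \<open>;;\<close> becomes an equation, and time is accounted for by subtraction during
  simplification.\<close>

definition wp :: "com \<Rightarrow> (nat \<Rightarrow> store \<Rightarrow> bool) \<Rightarrow> nat \<Rightarrow> store \<Rightarrow> bool" where
  "wp c Q T s \<longleftrightarrow> (\<exists>k s'. exec c s k s' \<and> k \<le> T \<and> Q (T - k) s')"

inductive_cases exec_SkipE: "exec Skip s k s'"
inductive_cases exec_AssignE: "exec (Assign x e) s k s'"
inductive_cases exec_PutE: "exec (Put a e f) s k s'"
inductive_cases exec_InputE: "exec (Input x) s k s'"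
inductive_cases exec_OutputE: "exec (Output e) s k s'"
inductive_cases exec_SeqE: "exec (c ;; d) s k s'"
inductive_cases exec_CondE: "exec (Cond e c d) s k s'"

lemma exec_simps:
  "exec Skip s k s' \<longleftrightarrow> k = 0 \<and> s' = s"
  "exec (Assign x e) s k s' \<longleftrightarrow> k = alen e + 2 \<and> s' = upd 0 x (aval e (mem s)) s"
  "exec (Put a e f) s k s' \<longleftrightarrow> k = alen e + alen f + 7 \<and>
    s' = upd a (aval e (mem s)) (aval f (mem s)) s"
  "ins s = v # vs \<Longrightarrow> exec (Input x) s k s' \<longleftrightarrow> k = 1 \<and> s' = (upd 0 x v s)\<lparr>ins := vs\<rparr>"
  "exec (Output e) s k s' \<longleftrightarrow> k = alen e + 1 \<and> s' = s\<lparr>outs := outs s @ [aval e (mem s)]\<rparr>"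
  by (auto simp del: One_nat_def add_Suc_right add_2_eq_Suc'
      intro: exec.intros elim: exec_SkipE exec_AssignE exec_PutE exec_InputE exec_OutputE)

lemma wp_simps [simp]:
  "wp Skip Q T s \<longleftrightarrow> Q T s"
  "wp (Assign x e) Q T s \<longleftrightarrow>
    alen e + 2 \<le> T \<and> Q (T - (alen e + 2)) (upd 0 x (aval e (mem s)) s)"
  "wp (Put a e f) Q T s \<longleftrightarrow> alen e + alen f + 7 \<le> T \<and>
    Q (T - (alen e + alen f + 7)) (upd a (aval e (mem s)) (aval f (mem s)) s)"
  "ins s = v # vs \<Longrightarrow> wp (Input x) Q T s \<longleftrightarrow> 1 \<le> T \<and> Q (T - 1) ((upd 0 x v s)\<lparr>ins := vs\<rparr>)"
  "wp (Output e) Q T s \<longleftrightarrow>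
    alen e + 1 \<le> T \<and> Q (T - (alen e + 1)) (s\<lparr>outs := outs s @ [aval e (mem s)]\<rparr>)"
  by (auto simp: wp_def exec_simps)

lemma wp_Seq [simp]: "wp (c ;; d) Q = wp c (wp d Q)"
proof (intro ext iffI)
  fix T s
  assume "wp (c ;; d) Q T s"
  then obtain k s' l s'' where "exec c s k s'" "exec d s' l s''" "k + l \<le> T" "Q (T - (k + l)) s''"
    unfolding wp_def by (blast elim: exec_SeqE)
  then show "wp c (wp d Q) T s"
    unfolding wp_def by (intro exI [of _ k] exI [of _ s'] conjI exI [of _ l] exI [of _ s'']) auto
next
  fix T s
  assume "wp c (wp d Q) T s"
  then obtain k s' l s'' where "exec c s k s'" "exec d s' l s''" "k \<le> T" "l \<le> T - k"
      "Q (T - k - l) s''"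
    unfolding wp_def by blast
  then show "wp (c ;; d) Q T s"
    unfolding wp_def
    by (intro exI [of _ "k + l"] exI [of _ s''] conjI exec_Seq [of c s k s' d]) auto
qed

lemma wp_Cond [simp]: "wp (Cond e c d) Q T s \<longleftrightarrow> alen e + 3 \<le> T \<and>
    (if aval e (mem s) > 0 then wp c Q (T - (alen e + 3)) s else wp d Q (T - (alen e + 3)) s)"
proof
  assume "wp (Cond e c d) Q T s"
  then show "alen e + 3 \<le> T \<and>
    (if aval e (mem s) > 0 then wp c Q (T - (alen e + 3)) s else wp d Q (T - (alen e + 3)) s)"
    unfolding wp_def by (fastforce elim!: exec_CondE)
next
  assume "alen e + 3 \<le> T \<and>
    (if aval e (mem s) > 0 then wp c Q (T - (alen e + 3)) s else wp d Q (T - (alen e + 3)) s)"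
  then obtain k s' where "alen e + 3 \<le> T" "k \<le> T - (alen e + 3)" "Q (T - (alen e + 3) - k) s'"
      "if aval e (mem s) > 0 then exec c s k s' else exec d s k s'"
    unfolding wp_def by (auto split: if_splits)
  then show "wp (Cond e c d) Q T s"
    unfolding wp_def
    by (intro exI [of _ "alen e + 3 + k"] exI [of _ s'])
       (auto split: if_splits intro: exec_CondT exec_CondF)
qed

lemma wp_mono:
  assumes "wp c Q T s" "T \<le> T'"
    and "\<And>U s'. U \<le> T \<Longrightarrow> Q U s' \<Longrightarrow> Q' (T' - (T - U)) s'"
  shows "wp c Q' T' s"
proof -
  obtain k s' where k: "exec c s k s'" "k \<le> T" "Q (T - k) s'"
    using assms(1) unfolding wp_def by blast
  have "Q' (T' - k) s'" using assms(3) [of "T - k" s'] k by simp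
  with k assms(2) show ?thesis unfolding wp_def by (meson le_trans)
qed

text \<open>Applies a specification proved with its own budget \<open>T\<close> inside a larger one;
  at least the difference \<open>T' - T\<close> is left for the continuation.\<close>

lemma wp_spec:
  assumes "wp c (\<lambda>_. R) T s" "T \<le> T'" "\<And>U s'. T' - T \<le> U \<Longrightarrow> R s' \<Longrightarrow> Q U s'"
  shows "wp c Q T' s"
  using assms(1,2) by (rule wp_mono) (use assms(2,3) in auto)

text \<open>Array 0 holds the scalars, so a \<open>Put\<close> into it may change any of
  them.\<close>

fun wvars :: "com \<Rightarrow> nat set" where
  "wvars (Assign x e) = {x}"
| "wvars (Put a e f) = (if a = 0 then UNIV else {})"
| "wvars (Input x) = {x}"
| "wvars (c ;; d) = wvars c \<union> wvars d"
| "wvars (Cond e c d) = wvars c \<union> wvars d"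
| "wvars (While e c) = wvars c"
| "wvars _ = {}"

fun warrs :: "com \<Rightarrow> nat set" where
  "warrs (Put a e f) = {a}"
| "warrs (c ;; d) = warrs c \<union> warrs d"
| "warrs (Cond e c d) = warrs c \<union> warrs d"
| "warrs (While e c) = warrs c"
| "warrs _ = {}"

fun reads :: "com \<Rightarrow> bool" where
  "reads (Input x) = True"
| "reads (c ;; d) = (reads c \<or> reads d)"
| "reads (Cond e c d) = (reads c \<or> reads d)"
| "reads (While e c) = reads c"
| "reads _ = False"

fun prints :: "com \<Rightarrow> bool" where
  "prints (Output e) = True"
| "prints (c ;; d) = (prints c \<or> prints d)"
| "prints (Cond e c d) = (prints c \<or> prints d)"
| "prints (While e c) = prints c"
| "prints _ = False"

text \<open>A frame condition: with it, invariants need to mention only what the program may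
  change.\<close>

definition agree :: "com \<Rightarrow> store \<Rightarrow> store \<Rightarrow> bool" where
  "agree c s s' \<longleftrightarrow> (\<forall>x. x \<notin> wvars c \<longrightarrow> mem s' 0 x = mem s 0 x) \<and>
    (\<forall>a. a > 0 \<and> a \<notin> warrs c \<longrightarrow> mem s' a = mem s a) \<and>
    (\<not> reads c \<longrightarrow> ins s' = ins s) \<and> (\<not> prints c \<longrightarrow> outs s' = outs s)"

lemma agree_refl: "agree c s s"
  by (simp add: agree_def)

lemma agree_trans: "agree c s s' \<Longrightarrow> agree c s' s'' \<Longrightarrow> agree c s s''"
  by (auto simp: agree_def)

lemma exec_agree: "exec c s k s' \<Longrightarrow> agree c s s'"
  by (induction rule: exec.induct) (auto simp: agree_def)

lemma wp_frame: "wp c Q T s \<Longrightarrow> wp c (\<lambda>U s'. Q U s' \<and> agree c s s') T s"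
  unfolding wp_def using exec_agree by blast

text \<open>The index \<open>k\<close> of the invariant is a variant that bounds the number of
  remaining rounds, each of cost \<open>t + alen e + 3\<close>. Agreement with \<open>s0\<close> is
  carried along, so that unchanged variables do not enter the invariant.\<close>

lemma wp_While:
  assumes "I k s" "agree (While e c) s0 s"
    and step: "\<And>k s. I k s \<Longrightarrow> agree (While e c) s0 s \<Longrightarrow> aval e (mem s) > 0 \<Longrightarrow>
      wp c (\<lambda>_ s'. \<exists>k'<k. I k' s') t s"
    and T: "T = k * (t + alen e + 3) + alen e + 3"
  shows "wp (While e c) (\<lambda>_ s'. aval e (mem s') = 0 \<and> (\<exists>k'. I k' s')) T s"
  using assms(1,2) T
proof (induction k arbitrary: s T rule: less_induct)
  case (less k)
  show ?case
  proof (cases "aval e (mem s) > 0")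
    case False
    then show ?thesis
      using less.prems exec_WhileF [of e s c] unfolding wp_def
      by (intro exI [of _ "alen e + 3"] exI [of _ s]) auto
  next
    case True
    obtain j s' k' where 1: "exec c s j s'" "j \<le> t" "k' < k" "I k' s'"
      using step [OF less.prems(1,2) True] unfolding wp_def by blast
    have "agree (While e c) s s'"
      using exec_agree [OF 1(1)] by (simp add: agree_def)
    from agree_trans [OF less.prems(2) this] have "agree (While e c) s0 s'" .
    from less.IH [OF 1(3,4) this refl] obtain l s'' where 2: "exec (While e c) s' l s''"
        "l \<le> k' * (t + alen e + 3) + alen e + 3" "aval e (mem s'') = 0" "\<exists>k'. I k' s''"
      unfolding wp_def by blast
    have "Suc k' * (t + alen e + 3) \<le> k * (t + alen e + 3)"
      using 1(3) by (intro mult_le_mono1) simp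
    then have "alen e + 3 + j + l \<le> T"
      using 1(2) 2(2) less.prems(3) by simp
    then show ?thesis
      using exec_WhileT [OF True 1(1) 2(1)] 2(3,4) unfolding wp_def by blast
  qed
qed

text \<open>The bound is evaluated anew in every round; \<open>wp_For\<close> therefore asks that it
  keep its value.\<close>

definition For :: "nat \<Rightarrow> aexp \<Rightarrow> com \<Rightarrow> com" where
  "For x e c = Assign x (Lit 0) ;; While (Minus e (Var x)) (c ;; Assign x (Plus (Var x) (Lit 1)))"

lemma For_simps [simp]:
  "cwf (For x e c) \<longleftrightarrow> awf e \<and> cwf c"
  "wvars (For x e c) = insert x (wvars c)"
  "warrs (For x e c) = warrs c"
  "reads (For x e c) = reads c"
  "prints (For x e c) = prints c"
  by (auto simp: For_def)

text \<open>Costs may vary with the round, as needed for the chains of different lengths in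
  \<open>solve_prog\<close>. Besides the body a round costs \<open>alen e + 14\<close>, namely
  \<open>alen e + 8\<close> for the test and 6 for the increment, which the 20 rounds up.\<close>

lemma wp_For:
  assumes init: "I 0 (upd 0 x 0 s0)"
    and bound: "\<And>s. agree (For x e c) s0 s \<Longrightarrow> aval e (mem s) = n"
    and x: "x \<notin> wvars c"
    and step: "\<And>k s. k < n \<Longrightarrow> I k s \<Longrightarrow> mem s 0 x = k \<Longrightarrow> agree (For x e c) s0 s \<Longrightarrow>
      wp c (\<lambda>_ s'. I (Suc k) (upd 0 x (Suc k) s')) (t k) s"
    and T: "(\<Sum>k<n. t k + alen e + 20) + alen e + 20 \<le> T"
  shows "wp (For x e c) (\<lambda>_ s'. I n s' \<and> mem s' 0 x = n \<and> agree (For x e c) s0 s') T s0"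
proof -
  let ?W = "While (Minus e (Var x)) (c ;; Assign x (Plus (Var x) (Lit 1)))"
  have main: "\<exists>l s'. exec ?W s l s' \<and> l \<le> (\<Sum>k=j..<n. t k + alen e + 20) + alen e + 8 \<and>
      I n s' \<and> mem s' 0 x = n"
    if "j \<le> n" "I j s" "mem s 0 x = j" "agree (For x e c) s0 s" for j s
    using that
  proof (induction j arbitrary: s rule: inc_induct)
    case base
    then show ?case
      using bound [of s] by (intro exI [of _ "alen e + 8"] exI [of _ s])
        (use exec_WhileF [of "Minus e (Var x)" s "c ;; Assign x (Plus (Var x) (Lit 1))"] in
          \<open>auto simp: add.commute\<close>)
  next
    case (step j)
    have pos: "aval (Minus e (Var x)) (mem s) > 0" using bound [of s] step by simp
    obtain k s' where 1: "exec c s k s'" "k \<le> t j" "I (Suc j) (upd 0 x (Suc j) s')"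
      using assms(4) [of j s] step unfolding wp_def by blast
    have x': "mem s' 0 x = j"
      using exec_agree [OF 1(1)] x step.prems(2) by (simp add: agree_def)
    have ex: "exec (c ;; Assign x (Plus (Var x) (Lit 1))) s (k + 6) (upd 0 x (Suc j) s')"
      using exec_Seq [OF 1(1) exec_Assign [of x "Plus (Var x) (Lit 1)" s']] x' by simp
    have "agree (For x e c) s (upd 0 x (Suc j) s')"
      using exec_agree [OF 1(1)] by (auto simp: agree_def)
    from agree_trans [OF step.prems(3) this] have "agree (For x e c) s0 (upd 0 x (Suc j) s')" .
    from step.IH [OF 1(3) _ this] obtain l s'' where 2: "exec ?W (upd 0 x (Suc j) s') l s''"
        "l \<le> (\<Sum>k=Suc j..<n. t k + alen e + 20) + alen e + 8" "I n s''" "mem s'' 0 x = n"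
      by auto
    have "(\<Sum>k=j..<n. t k + alen e + 20) = t j + alen e + 20 + (\<Sum>k=Suc j..<n. t k + alen e + 20)"
      using step.hyps by (simp add: sum.atLeast_Suc_lessThan)
    then show ?case
      using exec_WhileT [OF pos ex 2(1)] 1(2) 2(2,3,4)
      by (intro exI [of _ "alen (Minus e (Var x)) + 3 + (k + 6) + l"] exI [of _ s'']) auto
  qed
  have "agree (For x e c) s0 (upd 0 x 0 s0)" by (simp add: agree_def)
  then obtain l s' where l: "exec ?W (upd 0 x 0 s0) l s'"
      "l \<le> (\<Sum>k<n. t k + alen e + 20) + alen e + 8" "I n s'" "mem s' 0 x = n"
    using main [of 0 "upd 0 x 0 s0"] init by (auto simp: atLeast0LessThan)
  have "exec (For x e c) s0 (3 + l) s'"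
    using exec_Seq [OF exec_Assign [of x "Lit 0" s0], of ?W l s'] l(1)
    by (simp add: For_def numeral_3_eq_3)
  then show ?thesis
    unfolding wp_def using l(2-4) T exec_agree
    by (intro exI [of _ "3 + l"] exI [of _ s']) auto
qed

section \<open>Rooted orders of trees\<close>

definition parent_arcs :: "'a \<Rightarrow> 'a set \<Rightarrow> ('a \<Rightarrow> 'a) \<Rightarrow> 'a rel" where
  "parent_arcs r V par = {(par v, v) | v. v \<in> V - {r}}"

definition parent_order :: "'a list \<Rightarrow> ('a \<Rightarrow> 'a) \<Rightarrow> bool" where
  "parent_order xs par \<longleftrightarrow> xs \<noteq> [] \<and> distinct xs \<and>
    (\<forall>k. 0 < k \<and> k < length xs \<longrightarrow> par (xs ! k) \<in> set (take k xs))"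

text \<open>Acyclicity of an undirected graph: no edge can be bypassed. An edge is two arcs, and
  both have to be deleted.\<close>

definition bridges :: "'a rel \<Rightarrow> bool" where
  "bridges E \<longleftrightarrow> (\<forall>u v. (u, v) \<in> E \<longrightarrow> (u, v) \<notin> (E - {(u, v), (v, u)})\<^sup>*)"

lemma parent_order_snoc:
  assumes "parent_order xs par" "v \<notin> set xs" "p \<in> set xs"
  shows "parent_order (xs @ [v]) (par(v := p))"
proof -
  have "xs ! k \<noteq> v" if "k < length xs" for k using assms(2) that nth_mem by blast
  then show ?thesis using assms unfolding parent_order_def
    by (auto simp: nth_append less_Suc_eq)
qed

lemma parent_order_rank:
  assumes "parent_order xs par"
  obtains rank :: "'a \<Rightarrow> nat" where "\<And>v. v \<in> set xs - {hd xs} \<Longrightarrow> par v \<in> set xs \<and> rank (par v) < rank v"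
proof
  let ?rank = "\<lambda>v. THE k. k < length xs \<and> xs ! k = v"
  have rank: "?rank (xs ! k) = k" if "k < length xs" for k
    using assms that by (intro the_equality) (auto simp: parent_order_def nth_eq_iff_index_eq)
  show "par v \<in> set xs \<and> ?rank (par v) < ?rank v" if v: "v \<in> set xs - {hd xs}" for v
  proof -
    obtain k where k: "k < length xs" "v = xs ! k" using v by (auto simp: in_set_conv_nth)
    then have "k > 0" using v assms by (cases k) (auto simp: parent_order_def hd_conv_nth)
    then have "par v \<in> set (take k xs)" using assms k by (auto simp: parent_order_def)
    then obtain j where "j < k" "par v = xs ! j" using k(1) by (auto simp: in_set_conv_nth)
    then show ?thesis using k rank by auto
  qed
qed

text \<open>\<open>rank\<close> certifies that parents lead to the root in finitely many steps;
  positions in a suitable order provide it.\<close>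

locale rooted =
  fixes V :: "'a set" and r :: 'a and par :: "'a \<Rightarrow> 'a" and rank :: "'a \<Rightarrow> nat"
  assumes root: "r \<in> V"
    and par: "\<And>v. v \<in> V \<Longrightarrow> v \<noteq> r \<Longrightarrow> par v \<in> V" 
    and rank: "\<And>v. v \<in> V \<Longrightarrow> v \<noteq> r \<Longrightarrow> rank (par v) < rank v"
begin

abbreviation F :: "'a rel" where "F \<equiv> parent_arcs r V par"

lemma F_iff: "(u, v) \<in> F \<longleftrightarrow> v \<in> V \<and> v \<noteq> r \<and> u = par v"
  by (auto simp: parent_arcs_def)

lemma F_rank: "(u, v) \<in> F \<Longrightarrow> rank u < rank v"
  using rank by (auto simp: F_iff)

lemma F_star_rank: "(u, v) \<in> F\<^sup>* \<Longrightarrow> u = v \<or> rank u < rank v"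
  by (induction rule: rtrancl_induct) (use F_rank less_trans in \<open>blast+\<close>)

lemma F_antisym: "F \<inter> F\<inverse> = {}"
  using F_rank less_asym by blast

lemma root_reaches: "v \<in> V \<Longrightarrow> (r, v) \<in> F\<^sup>*"
proof (induction "rank v" arbitrary: v rule: less_induct)
  case less
  show ?case
  proof (cases "v = r")
    case False
    then have "(r, par v) \<in> F\<^sup>*" using less par rank by blast
    moreover have "(par v, v) \<in> F" using less.prems False by (simp add: F_iff)
    ultimately show ?thesis by (rule rtrancl_into_rtrancl)
  qed simp
qed

text \<open>Any other arc would be bypassed by the walk that leads along parent arcs from one end up
  to the root and down to the other end.\<close>

lemma arcs_eq_parent_arcs:
  assumes "sym E" "E \<subseteq> V \<times> V" "F \<subseteq> E" "bridges E"
  shows "E = F \<union> F\<inverse>"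
proof
  show "F \<union> F\<inverse> \<subseteq> E" using assms(1,3) by (auto dest: symD)
  show "E \<subseteq> F \<union> F\<inverse>"
  proof (rule subrelI, rule ccontr)
    fix a b assume ab: "(a, b) \<in> E" "(a, b) \<notin> F \<union> F\<inverse>"
    have "sym ((F \<union> F\<inverse>)\<^sup>*)" by (intro sym_rtrancl) (auto simp: sym_def)
    moreover have "(r, a) \<in> (F \<union> F\<inverse>)\<^sup>*" "(r, b) \<in> (F \<union> F\<inverse>)\<^sup>*"
      using root_reaches ab(1) assms(2) rtrancl_mono [of F "F \<union> F\<inverse>"] by blast+
    ultimately have "(a, b) \<in> (F \<union> F\<inverse>)\<^sup>*" by (meson rtrancl_trans symD)
    moreover have "F \<union> F\<inverse> \<subseteq> E - {(a, b), (b, a)}"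
      using ab(2) \<open>F \<union> F\<inverse> \<subseteq> E\<close> by blast
    ultimately have "(a, b) \<in> (E - {(a, b), (b, a)})\<^sup>*" using rtrancl_mono by blast
    then show False using assms(4) ab(1) by (auto simp: bridges_def)
  qed
qed

text \<open>Every edge is counted at its child end, whichever orientation the list uses; this is a
  bijection onto the vertices other than the root.\<close>

lemma length_edge_list:
  assumes "distinct es" "F \<union> F\<inverse> = set es \<union> (set es)\<inverse>" "set es \<inter> (set es)\<inverse> = {}" "finite V"
  shows "length es = card V - 1"
proof -
  define f where "f = (\<lambda>e. if e \<in> F then snd e else fst e)"
  have f: "f e \<in> V - {r} \<and> (e = (par (f e), f e) \<or> e = (f e, par (f e)))" if "e \<in> set es" for e
  proof -
    have "e \<in> F \<union> F\<inverse>" using assms(2) that by blast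
    then show ?thesis by (cases e) (auto simp: f_def F_iff)
  qed
  have "bij_betw f (set es) (V - {r})"
    unfolding bij_betw_def
  proof
    show "inj_on f (set es)"
    proof (rule inj_onI)
      fix e e' assume "e \<in> set es" "e' \<in> set es" "f e = f e'"
      then show "e = e'" using f [of e] f [of e'] assms(3) by auto
    qed
    show "f ` set es = V - {r}"
    proof (intro set_eqI iffI)
      fix v assume v: "v \<in> V - {r}"
      then have F: "(par v, v) \<in> F" by (simp add: F_iff)
      then have "(v, par v) \<notin> F" using F_antisym by blast
      with F have "f (par v, v) = v" "f (v, par v) = v" by (auto simp: f_def)
      moreover have "(par v, v) \<in> set es \<or> (v, par v) \<in> set es" using F assms(2) by blast
      ultimately show "v \<in> f ` set es" by (metis imageI)
    qed (use f in auto)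
  qed
  then have "card (set es) = card (V - {r})" by (rule bij_betw_same_card)
  then show ?thesis using assms(1,4) root by (simp add: distinct_card)
qed

text \<open>The topmost vertex is one of minimal rank. If some other \<open>x\<close> in
  \<open>S\<close> had no parent in \<open>S\<close>, no walk inside \<open>S\<close> could leave
  the descendants of \<open>x\<close>, whose ranks are larger, so it would miss the topmost
  vertex.\<close>

lemma connected_iff_rooted:
  assumes "S \<subseteq> V" "S \<noteq> {}" "E = F \<union> F\<inverse>"
  shows "(\<forall>u\<in>S. \<forall>v\<in>S. (u, v) \<in> (E \<inter> S \<times> S)\<^sup>*) \<longleftrightarrow>
    (\<exists>t\<in>S. \<forall>x\<in>S - {t}. x \<noteq> r \<and> par x \<in> S)"
proof
  assume conn: "\<forall>u\<in>S. \<forall>v\<in>S. (u, v) \<in> (E \<inter> S \<times> S)\<^sup>*"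
  obtain t where t: "t \<in> S" "\<And>x. x \<in> S \<Longrightarrow> rank t \<le> rank x"
    using assms(2) ex_has_least_nat [of "\<lambda>x. x \<in> S" _ rank] by blast
  have "x \<noteq> r \<and> par x \<in> S" if x: "x \<in> S" "x \<noteq> t" for x
  proof (rule ccontr)
    assume *: "\<not> (x \<noteq> r \<and> par x \<in> S)"
    have "(x, y) \<in> F\<^sup>*" if "(x, y) \<in> (E \<inter> S \<times> S)\<^sup>*" for y
      using that
    proof (induction rule: rtrancl_induct)
      case (step y z)
      then consider "(y, z) \<in> F" | "(z, y) \<in> F" using assms(3) by blast
      then show ?case
      proof cases
        case 2
        \<comment> \<open>Going up from \<open>y\<close> leads to its parent, through which every
          downward walk from \<open>x\<close> to \<open>y \<noteq> x\<close> has passed.\<close>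
        then have "y \<noteq> x" using * step.hyps by (auto simp: F_iff)
        then obtain w where "(x, w) \<in> F\<^sup>*" "(w, y) \<in> F"
          using step.IH by (metis rtranclE)
        with 2 show ?thesis by (simp add: F_iff)
      qed (use step.IH in auto)
    qed simp
    then have "(x, t) \<in> F\<^sup>*" using conn x t by blast
    then show False using F_star_rank [of x t] t(2) [of x] x by auto
  qed
  then show "\<exists>t\<in>S. \<forall>x\<in>S - {t}. x \<noteq> r \<and> par x \<in> S" using t(1) by blast
next
  assume "\<exists>t\<in>S. \<forall>x\<in>S - {t}. x \<noteq> r \<and> par x \<in> S"
  then obtain t where t: "t \<in> S" "\<And>x. x \<in> S \<Longrightarrow> x \<noteq> t \<Longrightarrow> x \<noteq> r \<and> par x \<in> S" by blast
  have reach: "(t, x) \<in> (E \<inter> S \<times> S)\<^sup>*" if "x \<in> S" for x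
    using that
  proof (induction "rank x" arbitrary: x rule: less_induct)
    case less
    show ?case
    proof (cases "x = t")
      case False
      then have p: "x \<noteq> r" "par x \<in> S" using t(2) less.prems by auto
      then have "(t, par x) \<in> (E \<inter> S \<times> S)\<^sup>*"
        using less rank assms(1) by blast
      moreover have "(par x, x) \<in> E \<inter> S \<times> S"
        using p less.prems assms(1,3) by (auto simp: F_iff)
      ultimately show ?thesis by (rule rtrancl_into_rtrancl)
    qed simp
  qed
  have "sym ((E \<inter> S \<times> S)\<^sup>*)" using assms(3) by (intro sym_rtrancl) (auto simp: sym_def)
  then show "\<forall>u\<in>S. \<forall>v\<in>S. (u, v) \<in> (E \<inter> S \<times> S)\<^sup>*"
    using reach by (meson rtrancl_trans symD)
qed

end

lemma crossing_arc:
  assumes "(u, v) \<in> E\<^sup>*" "u \<in> S" "v \<notin> S"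
  shows "\<exists>a b. (a, b) \<in> E \<and> a \<in> S \<and> b \<notin> S"
  using assms by (induction rule: rtrancl_induct) blast+

text \<open>The order grows along an arc that leaves the set reached so far. It serves to count the
  edges of a tree; the order that the program computes is a different one.\<close>

lemma parent_order_exists:
  assumes "finite V" "r \<in> V" "E \<subseteq> V \<times> V" "\<And>v. v \<in> V \<Longrightarrow> (r, v) \<in> E\<^sup>*"
  shows "\<exists>xs par. parent_order xs par \<and> hd xs = r \<and> set xs = V \<and> parent_arcs r V par \<subseteq> E"
proof -
  have "\<exists>xs par. parent_order xs par \<and> hd xs = r \<and> set xs \<subseteq> V \<and> length xs = Suc k \<and>
    parent_arcs r (set xs) par \<subseteq> E" if "k < card V" for k
    using that
  proof (induction k)
    case 0
    show ?case using assms(2)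
      by (intro exI [of _ "[r]"]) (auto simp: parent_order_def parent_arcs_def)
  next
    case (Suc k)
    then obtain xs par where xs: "parent_order xs par" "hd xs = r" "set xs \<subseteq> V"
      "length xs = Suc k" "parent_arcs r (set xs) par \<subseteq> E" by auto
    have "card (set xs) < card V"
      using xs Suc.prems by (simp add: parent_order_def distinct_card)
    then obtain v where "v \<in> V" "v \<notin> set xs"
      using xs(3) by (metis less_irrefl subsetI subset_antisym)
    moreover have "r \<in> set xs" using xs(1,2) by (auto simp: parent_order_def)
    ultimately obtain a b where ab: "(a, b) \<in> E" "a \<in> set xs" "b \<notin> set xs"
      using crossing_arc assms(4) by metis
    have "hd (xs @ [b]) = r" using xs by (auto simp: parent_order_def)
    moreover have "parent_arcs r (set (xs @ [b])) (par(b := a)) \<subseteq> E"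
      using xs(5) ab by (auto simp: parent_arcs_def)
    ultimately show ?case
      using parent_order_snoc [OF xs(1) ab(3,2)] xs(3,4) ab(1) assms(3)
      by (intro exI [of _ "xs @ [b]"] exI [of _ "par(b := a)"] conjI) (auto simp del: fun_upd_apply)
  qed
  from this [of "card V - 1"] obtain xs par where xs: "parent_order xs par" "hd xs = r"
      "set xs \<subseteq> V" "length xs = card V" "parent_arcs r (set xs) par \<subseteq> E"
    using assms(1,2) card_gt_0_iff [of V] by fastforce
  then have "set xs = V"
    using assms(1) by (metis card_subset_eq distinct_card parent_order_def)
  with xs show ?thesis by blast
qed

section \<open>Undirected trees and their connected induced subgraphs\<close>

text \<open>On symmetric arcs the symmetric closure in the definition of connectedness changes
  nothing, and the relative closure \<open>rtrancl_on\<close> is the ordinary one since no arc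
  leaves the vertex set.\<close>

lemma connected_with_proj_iff:
  assumes "parcs H \<subseteq> pverts H \<times> pverts H" "sym (parcs H)"
  shows "Digraph_Component.connected (with_proj H) \<longleftrightarrow>
    pverts H \<noteq> {} \<and> (\<forall>u\<in>pverts H. \<forall>v\<in>pverts H. (u, v) \<in> (parcs H)\<^sup>*)"
proof -
  have arcs: "arcs_ends (with_proj (mk_symmetric (with_proj H))) = parcs H"
    using assms(2) by (auto simp: mk_symmetric_def dest: symD)
  have verts: "verts (with_proj (mk_symmetric (with_proj H))) = pverts H"
    by (simp add: mk_symmetric_def)
  have "(u, v) \<in> rtrancl_on (pverts H) (parcs H) \<longleftrightarrow> (u, v) \<in> (parcs H)\<^sup>*"
    if "u \<in> pverts H" "v \<in> pverts H" for u v
  proof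
    show "(u, v) \<in> (parcs H)\<^sup>* \<Longrightarrow> (u, v) \<in> rtrancl_on (pverts H) (parcs H)"
      using that assms(1) by (intro rtrancl_consistent_rtrancl_on) auto
  qed (rule rtrancl_on_rtranclI)
  then show ?thesis
    unfolding Digraph_Component.connected_def strongly_connected_def reachable_def arcs verts
    by blast
qed

text \<open>A walk that bypasses an edge contains a simple path, which the edge closes to a
  cycle.\<close>

lemma undirected_tree_bridges:
  assumes "undirected_tree G"
  shows "bridges (parcs G)"
  unfolding bridges_def
proof (intro allI impI notI)
  fix u v
  let ?E = "parcs G - {(u, v), (v, u)}"
  assume uv: "(u, v) \<in> parcs G" and star: "(u, v) \<in> ?E\<^sup>*"
  interpret pair_graph G using assms by (simp add: undirected_tree_def)
  have sym: "sym (parcs G)" using pair_sym_arcs by (simp add: symmetric_def)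
  have ne: "u \<noteq> v" using pair_no_loops [OF uv] by simp
  let ?H = "\<lparr>pverts = pverts G, parcs = ?E\<rparr>"
  interpret H: pair_wf_digraph ?H
    by unfold_locales (auto intro: in_arcsD1 in_arcsD2)
  have "sym (?E\<^sup>*)" using sym by (intro sym_rtrancl) (auto simp: sym_def)
  then have "(v, u) \<in> ?E\<^sup>*" using star by (rule symD)
  then have "(v, u) \<in> rtrancl_on (pverts G) ?E"
    using uv in_arcsD1 in_arcsD2
    by (intro rtrancl_consistent_rtrancl_on) auto
  then have "reachable (with_proj ?H) v u" by (simp add: reachable_def)
  then obtain p where p: "H.apath v p u" using H.reachable_apath by blast
  have "cycle ((u, v) # p)"
    unfolding cycle_def
  proof (intro exI [of _ u] conjI)
    show "awalk u ((u, v) # p) u"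
      using p uv in_arcsD1 by (auto simp: awalk_def H.apath_def H.awalk_def)
    show "distinct (tl (pawalk_verts u ((u, v) # p)))"
      using p by (simp add: H.apath_def)
  qed simp
  \<comment> \<open>A path of a single arc from \<open>v\<close> to \<open>u\<close> would be
    \<open>(v, u)\<close>, which has been deleted; so \<open>p\<close> has at least two
    arcs.\<close>
  moreover have "length ((u, v) # p) \<ge> 3"
  proof -
    have "p \<noteq> []" using p ne by (auto simp: H.apath_def H.awalk_def)
    moreover have "p \<noteq> [e]" for e
      using p by (cases e) (auto simp: H.apath_def H.awalk_def)
    ultimately show ?thesis by (cases p; cases "tl p") auto
  qed
  ultimately show False using assms by (auto simp: undirected_tree_def)
qed

lemma undirected_tree_arcs:
  assumes "undirected_tree G"
  shows "finite (pverts G)" "parcs G \<subseteq> pverts G \<times> pverts G" "sym (parcs G)"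
    "\<And>u v. u \<in> pverts G \<Longrightarrow> v \<in> pverts G \<Longrightarrow> (u, v) \<in> (parcs G)\<^sup>*" "pverts G \<noteq> {}"
proof -
  interpret pair_graph G using assms by (simp add: undirected_tree_def)
  show *: "finite (pverts G)" "parcs G \<subseteq> pverts G \<times> pverts G" "sym (parcs G)"
    using pair_finite_verts pair_sym_arcs in_arcsD1 in_arcsD2 by (auto simp: symmetric_def)
  have "Digraph_Component.connected (with_proj G)" using assms by (simp add: undirected_tree_def)
  then show "\<And>u v. u \<in> pverts G \<Longrightarrow> v \<in> pverts G \<Longrightarrow> (u, v) \<in> (parcs G)\<^sup>*" "pverts G \<noteq> {}"
    using connected_with_proj_iff [OF *(2,3)] by auto
qed

text \<open>The input does not state the number of edges, so \<open>read_prog\<close> relies on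
  there being \<open>n - 1\<close> of them.\<close>

lemma undirected_tree_length_edge_list:
  assumes "undirected_tree G" "edge_list G es"
  shows "length es = card (pverts G) - 1"
proof -
  note G = undirected_tree_arcs [OF assms(1)]
  obtain r where r: "r \<in> pverts G" using G(5) by blast
  obtain xs par where xs: "parent_order xs par" "hd xs = r" "set xs = pverts G"
      "parent_arcs r (pverts G) par \<subseteq> parcs G"
    using parent_order_exists [OF G(1) r G(2)] G(4) r by metis
  obtain rank :: "'a \<Rightarrow> nat" where
    "\<And>v. v \<in> set xs - {hd xs} \<Longrightarrow> par v \<in> set xs \<and> rank (par v) < rank v"
    using parent_order_rank [OF xs(1)] by blast
  then interpret rooted "pverts G" r par rank
    using r xs by unfold_locales auto
  show ?thesis
    using arcs_eq_parent_arcs [OF G(3,2) xs(4) undirected_tree_bridges [OF assms(1)]]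
      assms(2) G(1) by (intro length_edge_list) (auto simp: edge_list_def)
qed

section \<open>Preorders\<close>

text \<open>
  In a preorder \<open>xs\<close> of a rooted tree every vertex \<open>x\<close> is followed by the block of its
  proper descendants; \<open>skip x\<close> is the entry after this block, or the end marker \<open>e\<close>.
\<close>

definition preordered :: "'a list \<Rightarrow> ('a \<Rightarrow> 'a) \<Rightarrow> ('a \<Rightarrow> 'a) \<Rightarrow> 'a \<Rightarrow> bool" where
  "preordered xs par skip e \<longleftrightarrow> (\<forall>as x bs. xs = as @ x # bs \<longrightarrow>
    (as \<noteq> [] \<longrightarrow> par x \<in> set as) \<and>
    (\<exists>ds cs. bs = ds @ cs \<and> skip x = hd (cs @ [e]) \<and>
      (\<forall>d\<in>set ds. par d \<in> set (x # ds)) \<and> (\<forall>c\<in>set cs. par c \<notin> set (x # ds))))"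

lemma preorderedD:
  assumes "preordered xs par skip e" "xs = as @ x # bs"
  shows "as \<noteq> [] \<Longrightarrow> par x \<in> set as"
    and "\<exists>ds cs. bs = ds @ cs \<and> skip x = hd (cs @ [e]) \<and>
      (\<forall>d\<in>set ds. par d \<in> set (x # ds)) \<and> (\<forall>c\<in>set cs. par c \<notin> set (x # ds))"
proof -
  have "(as \<noteq> [] \<longrightarrow> par x \<in> set as) \<and>
    (\<exists>ds cs. bs = ds @ cs \<and> skip x = hd (cs @ [e]) \<and>
      (\<forall>d\<in>set ds. par d \<in> set (x # ds)) \<and> (\<forall>c\<in>set cs. par c \<notin> set (x # ds)))"
    using assms(1) [unfolded preordered_def, THEN spec, THEN spec, THEN spec, THEN mp, OF assms(2)] .
  then show "as \<noteq> [] \<Longrightarrow> par x \<in> set as"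
    and "\<exists>ds cs. bs = ds @ cs \<and> skip x = hd (cs @ [e]) \<and>
      (\<forall>d\<in>set ds. par d \<in> set (x # ds)) \<and> (\<forall>c\<in>set cs. par c \<notin> set (x # ds))"
    by auto
qed

lemma preordered_singleton: "skip r = e \<Longrightarrow> preordered [r] par skip e"
  by (auto simp: preordered_def Cons_eq_append_conv)

text \<open>The new leaf enters exactly the blocks of \<open>p\<close> and its ancestors, and these
  grow without changing the entry that follows them. So only \<open>skip v\<close> has to be set, to
  the old successor of \<open>p\<close>. The condition on the head excludes \<open>v\<close> as the
  value of \<open>par\<close> at the root, which \<open>preordered\<close> leaves open.\<close>

lemma preordered_insert:
  assumes pre: "preordered (xs @ p # ys) par skip e" and dist: "distinct (xs @ p # ys)"
    and v: "v \<notin> set (xs @ p # ys)" "par v = p" "v \<noteq> par (hd (xs @ [p]))"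
  shows "preordered (xs @ p # v # ys) par (skip(v := hd (ys @ [e]))) e"
  unfolding preordered_def
proof (intro allI impI)
  note parent = preorderedD(1) [OF pre] and block = preorderedD(2) [OF pre]
  have v_leaf: "par c \<noteq> v" if mem: "c \<in> set (xs @ p # ys)" for c
  proof -
    obtain us ws where c: "xs @ p # ys = us @ c # ws" using split_list [OF mem] by blast
    show ?thesis
    proof (cases us)
      case Nil
      then have "c = hd (xs @ [p])" using c by (cases xs) auto
      then show ?thesis using v(3) by auto
    next
      case (Cons u us')
      then have "par c \<in> set us" using parent [OF c] by simp
      then have "par c \<in> set (xs @ p # ys)" unfolding c by simp
      then show ?thesis using v(1) by auto
    qed
  qed
  fix as x bs assume eq: "xs @ p # v # ys = as @ x # bs"
  let ?skip = "skip(v := hd (ys @ [e]))"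
  let ?C = "\<lambda>bs. \<exists>ds cs. bs = ds @ cs \<and> ?skip x = hd (cs @ [e]) \<and>
      (\<forall>d\<in>set ds. par d \<in> set (x # ds)) \<and> (\<forall>c\<in>set cs. par c \<notin> set (x # ds))"
  consider (xs) us where "xs = as @ x # us" "bs = us @ p # v # ys"
    | (p) "as = xs" "x = p" "bs = v # ys"
    | (v) "as = xs @ [p]" "x = v" "bs = ys"
    | (ys) us where "as = xs @ p # v # us" "ys = us @ x # bs"
    using eq by (auto simp: append_eq_append_conv2 Cons_eq_append_conv append_eq_Cons_conv)
  then show "(as \<noteq> [] \<longrightarrow> par x \<in> set as) \<and> ?C bs"
  proof cases
    case xs
    obtain ds cs where d: "us @ p # ys = ds @ cs" "skip x = hd (cs @ [e])"
        "\<forall>d\<in>set ds. par d \<in> set (x # ds)" "\<forall>c\<in>set cs. par c \<notin> set (x # ds)"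
      using block [of as x "us @ p # ys"] xs(1) by auto
    have "x \<noteq> v" "p \<noteq> x" using v(1) dist xs(1) by auto
    from d(1) consider (cs) zs where "us = ds @ zs" "cs = zs @ p # ys"
      | (ds) zs where "ds = us @ p # zs" "ys = zs @ cs"
      by (auto simp: append_eq_append_conv2 Cons_eq_append_conv append_eq_Cons_conv)
    then have "?C bs"
    proof cases
      case cs
      have "p \<notin> set (x # ds)" using dist xs(1) cs(1) by auto
      moreover have "hd (cs @ [e]) = hd (zs @ [p])" using cs(2) by (cases zs) auto
      ultimately show ?thesis using d cs xs(2) v(2) \<open>x \<noteq> v\<close>
        by (intro exI [of _ ds] exI [of _ "zs @ p # v # ys"]) (cases zs; auto)
    next
      case ds
      have "\<forall>c\<in>set cs. par c \<noteq> v" using v_leaf ds(2) by simp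
      then have "\<forall>c\<in>set cs. par c \<notin> set (x # us @ p # v # zs)"
        using d(4) ds(1) by auto
      moreover have "\<forall>d\<in>set (us @ p # v # zs). par d \<in> set (x # us @ p # v # zs)"
        using d(3) ds(1) v(2) by auto
      ultimately show ?thesis using d(2) ds(2) xs(2) \<open>x \<noteq> v\<close>
        by (intro exI [of _ "us @ p # v # zs"] exI [of _ cs]) simp
    qed
    then show ?thesis using parent [of as x "us @ p # ys"] xs(1) by auto
  next
    case p
    obtain ds cs where "ys = ds @ cs" "skip p = hd (cs @ [e])"
        "\<forall>d\<in>set ds. par d \<in> set (p # ds)" "\<forall>c\<in>set cs. par c \<notin> set (p # ds)"
      using block [of xs p ys] by auto
    moreover have "par c \<noteq> v" if "c \<in> set ys" for c using v_leaf that by simp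
    ultimately have "?C bs" using p v(1,2)
      by (intro exI [of _ "v # ds"] exI [of _ cs]) auto
    then show ?thesis using parent [of xs p ys] p by auto
  next
    case v': v
    have "par c \<noteq> v" if "c \<in> set ys" for c using v_leaf that by simp
    then have "?C bs" using v' by (intro exI [of _ "[]"] exI [of _ ys]) auto
    then show ?thesis using v' v(2) by auto
  next
    case ys
    then have "x \<noteq> v" using v(1) by auto
    from ys have eq': "xs @ p # ys = (xs @ p # us) @ x # bs" by simp
    from block [OF eq'] have C: "?C bs" using \<open>x \<noteq> v\<close> by simp
    have "par x \<in> set (xs @ p # us)" by (rule parent [OF eq']) simp
    then have "par x \<in> set as" unfolding ys(1) by auto
    with C show ?thesis by blast
  qed
qed

text \<open>The parent of the first entry of a nonempty block stands at or before \<open>p\<close>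
  by the order and at or after \<open>p\<close> by the block, so it is \<open>p\<close>. Hence a
  still childless \<open>p\<close> has the same \<open>skip\<close> as a child inserted
  next.\<close>

lemma preordered_skip:
  assumes "preordered (xs @ p # ys) par skip e" "distinct (xs @ p # ys)"
    "\<And>x. x \<in> set ys \<Longrightarrow> par x \<noteq> p"
  shows "skip p = hd (ys @ [e])"
proof -
  obtain ds cs where d: "ys = ds @ cs" "skip p = hd (cs @ [e])" "\<forall>d\<in>set ds. par d \<in> set (p # ds)"
    using preorderedD(2) [OF assms(1) refl] by blast
  have "ds = []"
  proof (rule ccontr)
    assume ds: "ds \<noteq> []"
    then have "xs @ p # ys = (xs @ [p]) @ hd ds # (tl ds @ cs)" using d(1) by simp
    from preorderedD(1) [OF assms(1) this] have "par (hd ds) \<in> set (xs @ [p])" by simp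
    moreover have "par (hd ds) \<in> set (p # ds)" using d(3) ds by simp
    moreover have "par (hd ds) \<noteq> p" using assms(3) ds d(1) by simp
    ultimately show False using assms(2) d(1) by auto
  qed
  then show ?thesis using d by simp
qed

text \<open>The block of \<open>i\<close> consists of the positions from \<open>i\<close> to just
  before \<open>sk i\<close>. By \<open>inside\<close> the parents of its later members lie in it,
  by \<open>outside\<close> no position behind it has a parent in it. The root is its own
  parent.\<close>

locale preorder =
  fixes n :: nat and pp sk :: "nat \<Rightarrow> nat"
  assumes n_pos: "0 < n"
    and pp_0: "pp 0 = 0"
    and pp_less: "0 < i \<Longrightarrow> i < n \<Longrightarrow> pp i < i"
    and less_sk: "i < n \<Longrightarrow> i < sk i"
    and sk_le: "i < n \<Longrightarrow> sk i \<le> n"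
    and inside: "i < j \<Longrightarrow> j < sk i \<Longrightarrow> i < n \<Longrightarrow> i \<le> pp j"
    and outside: "i < n \<Longrightarrow> sk i \<le> j \<Longrightarrow> j < n \<Longrightarrow> i \<le> pp j \<Longrightarrow> sk i \<le> pp j"

lemma preordered_positions:
  assumes "preordered xs par skip e" "distinct xs" "xs \<noteq> []"
  shows "\<exists>pp sk. preorder (length xs) pp sk \<and>
    (\<forall>i. 0 < i \<and> i < length xs \<longrightarrow> par (xs ! i) = xs ! pp i) \<and>
    (\<forall>i<length xs. skip (xs ! i) = (xs @ [e]) ! sk i)"
proof -
  let ?n = "length xs"
  have ex1: "\<exists>j. (i = 0 \<longrightarrow> j = 0) \<and> (0 < i \<and> i < ?n \<longrightarrow> j < i \<and> par (xs ! i) = xs ! j)" for i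
  proof (cases "0 < i \<and> i < ?n")
    case True
    then have "xs = take i xs @ xs ! i # drop (Suc i) xs" by (simp add: id_take_nth_drop)
    from preorderedD(1) [OF assms(1) this]
    have "take i xs \<noteq> [] \<longrightarrow> par (xs ! i) \<in> set (take i xs)" by blast
    then show ?thesis using True assms(3) by (fastforce simp: in_set_conv_nth)
  qed auto
  then obtain pp where pp: "\<And>i. i = 0 \<Longrightarrow> pp i = 0"
      "\<And>i. 0 < i \<Longrightarrow> i < ?n \<Longrightarrow> pp i < i \<and> par (xs ! i) = xs ! pp i"
    by metis
  have in_iff: "par (xs ! j) \<in> (\<lambda>k. xs ! k) ` A \<longleftrightarrow> pp j \<in> A"
    if "0 < j" "j < ?n" "A \<subseteq> {..<?n}" for j A
  proof -
    have "pp j < ?n" using pp(2) [OF that(1,2)] that(2) by simp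
    then have "xs ! pp j = xs ! k \<longleftrightarrow> pp j = k" if "k \<in> A" for k
      using assms(2) that \<open>A \<subseteq> _\<close> nth_eq_iff_index_eq by blast
    then show ?thesis using pp(2) [OF that(1,2)] by auto
  qed
  have ex2: "\<exists>s. i < s \<and> s \<le> ?n \<and> skip (xs ! i) = (xs @ [e]) ! s \<and>
      (\<forall>j. i < j \<and> j < s \<longrightarrow> i \<le> pp j) \<and>
      (\<forall>j. s \<le> j \<and> j < ?n \<and> i \<le> pp j \<longrightarrow> s \<le> pp j)" if i: "i < ?n" for i
  proof -
    have "xs = take i xs @ xs ! i # drop (Suc i) xs" using i by (simp add: id_take_nth_drop)
    from preorderedD(2) [OF assms(1) this] obtain ds cs where d: "drop (Suc i) xs = ds @ cs" "skip (xs ! i) = hd (cs @ [e])"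
        "\<forall>d\<in>set ds. par d \<in> set (xs ! i # ds)" "\<forall>c\<in>set cs. par c \<notin> set (xs ! i # ds)"
      by blast
    define s where "s = Suc i + length ds"
    have s: "s \<le> ?n" using d(1) i by (metis add_le_mono1 diff_le_self length_append length_drop
          le_add1 le_add_diff_inverse nat_add_left_cancel_le s_def Suc_leI)
    have cs: "cs = drop s xs" using d(1) unfolding s_def
      by (metis add.commute append_eq_conv_conj drop_drop)
    have ds: "ds = map ((!) xs) [Suc i..<s]"
    proof (rule nth_equalityI)
      fix k assume k: "k < length ds"
      have "ds ! k = drop (Suc i) xs ! k" using k d(1) by (simp add: nth_append)
      then show "ds ! k = map ((!) xs) [Suc i..<s] ! k" using k i
        by (simp add: s_def del: upt_Suc)
    qed (simp add: s_def del: upt_Suc)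
    have "set ds = (!) xs ` {Suc i..<s}" by (subst ds) (simp only: set_map set_upt)
    moreover have "{i..<s} = insert i {Suc i..<s}" by (auto simp: s_def)
    ultimately have set_ds: "set (xs ! i # ds) = (!) xs ` {i..<s}" by simp
    have skip: "skip (xs ! i) = (xs @ [e]) ! s"
      using d(2) cs s by (metis add.right_neutral append_Nil2 drop_append drop_eq_Nil
          hd_drop_conv_nth length_append_singleton less_Suc_eq_le diff_is_0_eq drop0)
    have "i \<le> pp j" if j: "i < j" "j < s" for j
    proof -
      have "xs ! j \<in> set ds" using j by (subst ds) simp
      then have "par (xs ! j) \<in> (!) xs ` {i..<s}" using d(3) set_ds by blast
      then have "pp j \<in> {i..<s}"
        using in_iff [of j "{i..<s}"] j s by (auto simp: subset_eq)
      then show ?thesis by simp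
    qed
    moreover have "s \<le> pp j" if j: "s \<le> j" "j < ?n" "i \<le> pp j" for j
    proof -
      have "xs ! j \<in> set cs" using j(1,2) unfolding cs in_set_conv_nth by (intro exI [of _ "j - s"]) auto
      then have "par (xs ! j) \<notin> (!) xs ` {i..<s}" using d(4) set_ds by blast
      moreover have "0 < j" using j(1) by (simp add: s_def)
      ultimately have "pp j \<notin> {i..<s}"
        using in_iff [of j "{i..<s}"] j s by (auto simp: subset_eq)
      then show ?thesis using j(3) by simp
    qed
    ultimately show ?thesis using skip s by (intro exI [of _ s]) (auto simp: s_def)
  qed
  then obtain sk where sk: "\<And>i. i < ?n \<Longrightarrow> i < sk i \<and> sk i \<le> ?n \<and>
      skip (xs ! i) = (xs @ [e]) ! sk i \<and>
      (\<forall>j. i < j \<and> j < sk i \<longrightarrow> i \<le> pp j) \<and>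
      (\<forall>j. sk i \<le> j \<and> j < ?n \<and> i \<le> pp j \<longrightarrow> sk i \<le> pp j)"
    by metis
  have "preorder ?n pp sk" using pp sk assms(3) by unfold_locales auto
  with pp sk show ?thesis by blast
qed

section \<open>Closed sets of positions and the decomposition into chains\<close>

context preorder
begin

text \<open>A parent before \<open>j\<close> counts as chosen. This is sound since a pass jumps over
  the whole subtree of a vertex that it skips.\<close>

definition closed :: "nat \<Rightarrow> nat \<Rightarrow> nat set set" where
  "closed j q = {S. S \<subseteq> {j..<q} \<and> (\<forall>k\<in>S. pp k \<in> S \<or> pp k < j)}"

text \<open>These are the connected sets with topmost position \<open>j\<close>, as
  \<open>subtree_iff\<close> confirms.\<close>

definition subtrees :: "nat \<Rightarrow> nat set set" where
  "subtrees j = insert j ` closed (Suc j) (sk j)"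

lemma closed_empty: "closed q q = {{}}"
  by (auto simp: closed_def)

lemma closedD: "S \<in> closed j q \<Longrightarrow> S \<subseteq> {j..<q}"
  by (simp add: closed_def)

text \<open>The recurrence behind the tables. A set without \<open>j\<close> avoids the whole block
  of \<open>j\<close>, since parents lead from every member of the block back to \<open>j\<close>.
  Conversely, behind the block a parent before \<open>sk j\<close> lies before \<open>j\<close> by
  \<open>outside\<close>.\<close>

lemma closed_split:
  assumes "j < q" "sk j \<le> q" "q \<le> n"
  shows "closed j q = closed (sk j) q \<union> insert j ` closed (Suc j) q"
proof (intro set_eqI iffI)
  have j: "j < n" using assms by simp
  fix S assume S: "S \<in> closed j q"
  show "S \<in> closed (sk j) q \<union> insert j ` closed (Suc j) q"
  proof (cases "j \<in> S")
    case True
    have "S - {j} \<in> closed (Suc j) q"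
      using S by (force simp: closed_def less_Suc_eq)
    then show ?thesis using True by (metis UnI2 imageI insert_Diff)
  next
    case False
    have "sk j \<le> k" if "k \<in> S" for k
      using that
    proof (induction k rule: less_induct)
      case (less k)
      have "k \<noteq> j" using less.prems False by auto
      then have k: "j < k" "k < q" using less.prems S by (auto simp: closed_def)
      show ?case
      proof (rule ccontr)
        assume "\<not> sk j \<le> k"
        then have "j \<le> pp k" using inside k j by simp
        then have "pp k \<in> S" using less.prems S by (auto simp: closed_def)
        moreover have "pp k < k" using pp_less k assms(3) by simp
        ultimately have "sk j \<le> pp k" by (rule less.IH [rotated])
        with \<open>pp k < k\<close> \<open>\<not> sk j \<le> k\<close> show False by simp
      qed
    qed
    then have "S \<in> closed (sk j) q" using S less_sk [OF j] by (force simp: closed_def)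
    then show ?thesis by simp
  qed
next
  have j: "j < n" using assms by simp
  fix S assume "S \<in> closed (sk j) q \<union> insert j ` closed (Suc j) q"
  then consider "S \<in> closed (sk j) q" | T where "T \<in> closed (Suc j) q" "S = insert j T" by blast
  then show "S \<in> closed j q"
  proof cases
    case 1
    have "pp k \<in> S \<or> pp k < j" if "k \<in> S" for k
      using 1 that outside [OF j, of k] assms(3) by (force simp: closed_def)
    then show ?thesis using 1 less_sk [OF j] by (force simp: closed_def)
  next
    case 2
    \<comment> \<open>As the root is its own parent, \<open>j\<close> satisfies the closure
      condition for \<open>j = 0\<close> too.\<close>
    have "pp j = j \<or> pp j < j" using pp_0 pp_less [of j] j by (cases "j = 0") auto
    then show ?thesis using 2 assms(1) by (force simp: closed_def less_Suc_eq)
  qed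
qed

text \<open>The left side is the criterion of \<open>connected_iff_rooted\<close>, read on
  positions.\<close>

lemma subtree_iff:
  assumes "S \<subseteq> {0..<n}"
  shows "(\<exists>t\<in>S. \<forall>k\<in>S - {t}. k \<noteq> 0 \<and> pp k \<in> S) \<longleftrightarrow> (\<exists>t<n. S \<in> subtrees t)"
proof
  assume "\<exists>t\<in>S. \<forall>k\<in>S - {t}. k \<noteq> 0 \<and> pp k \<in> S"
  then obtain t where t: "t \<in> S" "\<And>k. k \<in> S \<Longrightarrow> k \<noteq> t \<Longrightarrow> 0 < k \<and> pp k \<in> S" by blast
  have tn: "t < n" using t(1) assms by auto
  have "t \<le> k \<and> k < sk t" if "k \<in> S" for k
    using that
  proof (induction k rule: less_induct)
    case (less k)
    show ?case
    proof (cases "k = t")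
      case True
      then show ?thesis using less_sk [OF tn] by simp
    next
      case False
      then have k: "0 < k" "pp k \<in> S" "k < n" using t(2) less.prems assms by auto
      then have "t \<le> pp k \<and> pp k < sk t" "pp k < k" using less.IH pp_less by auto
      then show ?thesis using outside [OF tn, of k] k by (meson leD le_less_trans not_le less_imp_le)
    qed
  qed
  then have "S - {t} \<in> closed (Suc t) (sk t)"
    using t(2) by (force simp: closed_def less_Suc_eq Suc_le_eq le_less)
  then have "S \<in> subtrees t" using t(1) unfolding subtrees_def by (metis imageI insert_Diff)
  then show "\<exists>t<n. S \<in> subtrees t" using tn by blast
next
  assume "\<exists>t<n. S \<in> subtrees t"
  then obtain t T where t: "t < n" "T \<in> closed (Suc t) (sk t)" "S = insert t T"
    by (auto simp: subtrees_def)
  have "k \<noteq> 0 \<and> pp k \<in> S" if "k \<in> T" for k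
  proof -
    have "t < k" "k < sk t" using t(2) that by (auto simp: closed_def)
    then have "t \<le> pp k" using inside t(1) by simp
    moreover have "pp k \<in> T \<or> pp k < Suc t" using t(2) that by (auto simp: closed_def)
    ultimately show ?thesis using \<open>t < k\<close> t(3) by auto
  qed
  then show "\<exists>t\<in>S. \<forall>k\<in>S - {t}. k \<noteq> 0 \<and> pp k \<in> S" using t(3) by blast
qed

text \<open>
  A chain is a maximal set of positions with the same \<open>sk\<close>; these are the paths of the
  decomposition, and \<open>top\<close> is their upper end.
\<close>

definition top :: "nat \<Rightarrow> bool" where
  "top t \<longleftrightarrow> t < n \<and> (t = 0 \<or> sk t \<noteq> sk (pp t))"

text \<open>Going to the parent as long as \<open>sk\<close> stays the same ends in a top.\<close>

lemma top_exists: "j < n \<Longrightarrow> \<exists>t\<le>j. top t \<and> sk t = sk j"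
proof (induction j rule: less_induct)
  case (less j)
  show ?case
  proof (cases "top j")
    case False
    then have "j > 0" "sk j = sk (pp j)" using less.prems by (auto simp: top_def)
    moreover from this obtain t where "t \<le> pp j" "top t" "sk t = sk (pp j)"
      using less.IH [of "pp j"] pp_less less.prems by (meson less_trans)
    ultimately show ?thesis using pp_less [of j] less.prems by (intro exI [of _ t]) auto
  qed auto
qed

lemma block_parent:
  assumes "t < n" "0 < u" "u < n" "u \<noteq> t"
  shows "t \<le> u \<and> u < sk t \<longleftrightarrow> t \<le> pp u \<and> pp u < sk t"
  using assms inside [of t u] outside [of t u] pp_less [of u] by (meson leD le_less_trans
      le_neq_implies_less less_imp_le not_le)

text \<open>Otherwise position \<open>sk t\<close> lies in the block of \<open>j\<close>, so its
  parent is at least \<open>j \<ge> t\<close>. By \<open>outside\<close> that parent is at least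
  \<open>sk t\<close>, but parents precede their children.\<close>

lemma nested:
  assumes "t < n" "t \<le> j" "j < sk t"
  shows "sk j \<le> sk t"
  using assms(2,3)
proof (induction j rule: less_induct)
  case (less j)
  show ?case
  proof (cases "j = t")
    case False
    have j: "t < j" "j < n" using False less.prems assms(1) sk_le [of t] by auto
    show ?thesis
    proof (rule ccontr)
      assume "\<not> sk j \<le> sk t"
      then have *: "sk t < sk j" by simp
      then have "sk t < n" using sk_le [OF j(2)] by simp
      have "j \<le> pp (sk t)" using inside [of j "sk t"] less.prems * j by simp
      then have "sk t \<le> pp (sk t)" using outside [of t "sk t"] assms(1) j \<open>sk t < n\<close> by simp
      moreover have "pp (sk t) < sk t" using pp_less [of "sk t"] \<open>sk t < n\<close> j less.prems by simp
      ultimately show False by simp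
    qed
  qed simp
qed

text \<open>Its cardinality is the number of passes that process position \<open>u\<close>.\<close>

definition tops_above :: "nat \<Rightarrow> nat set" where
  "tops_above u = {t. top t \<and> t \<le> u \<and> u < sk t}"

lemma finite_tops_above: "finite (tops_above u)"
  by (rule finite_subset [of _ "{..u}"]) (auto simp: tops_above_def)

lemma tops_above_parent:
  assumes "0 < u" "u < n"
  shows "tops_above u = (if top u then insert u (tops_above (pp u)) else tops_above (pp u))"
proof -
  have "t \<in> tops_above u \<longleftrightarrow> t \<in> tops_above (pp u)" if "t \<noteq> u" for t
    using block_parent [of t u] assms that by (auto simp: tops_above_def top_def)
  moreover have "u \<in> tops_above u \<longleftrightarrow> top u" using less_sk assms by (simp add: tops_above_def)
  moreover have "u \<notin> tops_above (pp u)"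
    using pp_less [OF assms] by (auto simp: tops_above_def)
  ultimately have "t \<in> tops_above u \<longleftrightarrow> t \<in> (if top u then insert u (tops_above (pp u))
      else tops_above (pp u))" for t
    by (cases "t = u") simp_all
  then show ?thesis by blast
qed

text \<open>The left side is a potential that does not increase from parent to child: at a top,
  \<open>sz\<close> is at least halved while one factor 2 is added. The factor 2 on the right
  accounts for the root, itself a top.\<close>

lemma card_tops_above:
  fixes sz :: "nat \<Rightarrow> nat"
  assumes "\<And>u. 0 < u \<Longrightarrow> u < n \<Longrightarrow> sz u \<le> sz (pp u)"
    and "\<And>u. 0 < u \<Longrightarrow> u < n \<Longrightarrow> top u \<Longrightarrow> 2 * sz u \<le> sz (pp u)"
    and "u < n"
  shows "sz u * 2 ^ (card (tops_above u)) \<le> 2 * sz 0"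
  using assms(3)
proof (induction u rule: less_induct)
  case (less u)
  show ?case
  proof (cases "u = 0")
    case True
    have "tops_above 0 \<subseteq> {0}" by (auto simp: tops_above_def)
    then have "card (tops_above 0) \<le> 1" using card_mono [of "{0 :: nat}"] by simp
    then have "(2 :: nat) ^ card (tops_above 0) \<le> 2 ^ 1" by (rule power_increasing) simp
    then show ?thesis using True by simp
  next
    case False
    then have u: "0 < u" "u < n" using less.prems by auto
    have IH: "sz (pp u) * 2 ^ card (tops_above (pp u)) \<le> 2 * sz 0"
      using less.IH pp_less u by (meson less_trans)
    have "u \<notin> tops_above (pp u)" using pp_less [OF u] by (auto simp: tops_above_def)
    then have "sz u * 2 ^ card (tops_above u) \<le> sz (pp u) * 2 ^ card (tops_above (pp u))"
      using assms(1,2) [OF u] finite_tops_above tops_above_parent [OF u]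
        mult_le_mono1 [of "2 * sz u" "sz (pp u)" "2 ^ card (tops_above (pp u))"]
      by (auto simp: mult.commute mult.left_commute)
    with IH show ?thesis by simp
  qed
qed

text \<open>Double counting of the pairs of a top and a position in its block; by the potential
  every position has at most \<open>1 + log 2 n\<close> tops above it.\<close>

lemma sum_chains:
  fixes sz :: "nat \<Rightarrow> nat"
  assumes "\<And>u. 0 < u \<Longrightarrow> u < n \<Longrightarrow> sz u \<le> sz (pp u)"
    and "\<And>u. 0 < u \<Longrightarrow> u < n \<Longrightarrow> top u \<Longrightarrow> 2 * sz u \<le> sz (pp u)"
    and "\<And>u. u < n \<Longrightarrow> 0 < sz u" "sz 0 \<le> n"
  shows "real (\<Sum>t | top t. sk t - t) \<le> real n * (1 + log 2 (real n))"
proof -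
  have fin: "finite {t. top t}" by (rule finite_subset [of _ "{..<n}"]) (auto simp: top_def)
  have "(\<Sum>t | top t. sk t - t) = (\<Sum>t | top t. \<Sum>u | t \<le> u \<and> u < sk t. 1)"
  proof (rule sum.cong)
    fix t show "sk t - t = (\<Sum>u | t \<le> u \<and> u < sk t. 1)"
      using card_atLeastLessThan [of t "sk t"] by (simp add: atLeastLessThan_def
          atLeast_def lessThan_def Int_def)
  qed simp
  also have "\<dots> = (\<Sum>t | top t. \<Sum>u \<in> {u \<in> {..<n}. t \<le> u \<and> u < sk t}. 1)"
    using sk_le by (intro sum.cong arg_cong [of _ _ card] refl) (force simp: top_def)+
  also have "\<dots> = (\<Sum>u<n. \<Sum>t \<in> {t \<in> {t. top t}. t \<le> u \<and> u < sk t}. 1)"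
    by (rule sum.swap_restrict) (use fin in auto)
  also have "\<dots> = (\<Sum>u<n. card (tops_above u))"
    by (simp add: tops_above_def)
  finally have "real (\<Sum>t | top t. sk t - t) = (\<Sum>u<n. real (card (tops_above u)))" by simp
  also have "\<dots> \<le> (\<Sum>u<n. 1 + log 2 (real n))"
  proof (rule sum_mono)
    fix u assume "u \<in> {..<n}"
    then have u: "u < n" by simp
    have "1 * 2 ^ card (tops_above u) \<le> sz u * 2 ^ card (tops_above u)"
      using assms(3) [OF u] by (intro mult_le_mono1) simp
    also have "\<dots> \<le> 2 * n" using card_tops_above [of sz, OF assms(1,2) u] assms(4) by simp
    finally have "real (2 ^ card (tops_above u)) \<le> real (2 * n)" by (simp only: of_nat_le_iff mult_1)
    then have "log 2 (2 ^ card (tops_above u)) \<le> log 2 (2 * real n)"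
      by (subst log_le_cancel_iff) (use n_pos in auto)
    then show "real (card (tops_above u)) \<le> 1 + log 2 (real n)"
      using n_pos by (simp add: log_mult log_nat_power)
  qed
  finally show ?thesis by simp
qed

end

section \<open>Optimal values for families of weighted sets\<close>

text \<open>A maximum shifted by one, with 0 if there is no candidate, so that it fits into a
  natural number and unions become \<open>max\<close>.\<close>

definition is_best :: "('a \<Rightarrow> int) \<Rightarrow> ('a \<Rightarrow> nat) \<Rightarrow> 'a set set \<Rightarrow> int \<Rightarrow> nat \<Rightarrow> bool" where
  "is_best \<delta> w F d r \<longleftrightarrow> (\<forall>S\<in>F. sum \<delta> S = d \<longrightarrow> sum w S < r) \<and>
    (0 < r \<longrightarrow> (\<exists>S\<in>F. sum \<delta> S = d \<and> Suc (sum w S) = r))"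

lemma is_best_unique: "is_best \<delta> w F d a \<Longrightarrow> is_best \<delta> w F d b \<Longrightarrow> a = b"
  unfolding is_best_def by (metis less_SucE less_asym less_antisym not_gr_zero lessI)

lemma is_best_Un: "is_best \<delta> w F d a \<Longrightarrow> is_best \<delta> w G d b \<Longrightarrow> is_best \<delta> w (F \<union> G) d (max a b)"
  unfolding is_best_def by (cases "a \<le> b") (auto simp: max_def intro: less_le_trans)

lemma is_best_insert:
  assumes "is_best \<delta> w F (d - \<delta> j) a" "\<And>S. S \<in> F \<Longrightarrow> finite S \<and> j \<notin> S"
  shows "is_best \<delta> w (insert j ` F) d (if 0 < a then a + w j else 0)"
  using assms unfolding is_best_def by (auto simp: algebra_simps)

lemma is_best_empty: "is_best \<delta> w {{}} d (if d = 0 then 1 else 0)"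
  by (auto simp: is_best_def)

lemma is_best_0: "(\<And>S. S \<in> F \<Longrightarrow> sum \<delta> S \<noteq> d) \<Longrightarrow> is_best \<delta> w F d 0"
  by (auto simp: is_best_def)

section \<open>Reading the input\<close>

abbreviation (input) vn :: nat where "vn \<equiv> 0"
abbreviation (input) vW :: nat where "vW \<equiv> 16"
abbreviation (input) vi :: nat where "vi \<equiv> 2"
abbreviation (input) vj :: nat where "vj \<equiv> 3"
abbreviation (input) vx :: nat where "vx \<equiv> 4"
abbreviation (input) vy :: nat where "vy \<equiv> 5"
abbreviation (input) vcnt :: nat where "vcnt \<equiv> 6"
abbreviation (input) vstride :: nat where "vstride \<equiv> 7"
abbreviation (input) vtop :: nat where "vtop \<equiv> 8"
abbreviation (input) vend :: nat where "vend \<equiv> 9"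
abbreviation (input) vbest :: nat where "vbest \<equiv> 10"
abbreviation (input) vroot :: nat where "vroot \<equiv> 11"
abbreviation (input) vk :: nat where "vk \<equiv> 12"
abbreviation (input) vt :: nat where "vt \<equiv> 13"
abbreviation (input) vu :: nat where "vu \<equiv> 14"
abbreviation (input) vd :: nat where "vd \<equiv> 15"

text \<open>Array numbers have to lie between 1 and 14, as 0 belongs to the scalars and 15 to the
  temporaries.\<close>

abbreviation (input) acol :: nat where "acol \<equiv> 14"
abbreviation (input) awt :: nat where "awt \<equiv> 2"
abbreviation (input) afrom :: nat where "afrom \<equiv> 3"
abbreviation (input) ato :: nat where "ato \<equiv> 4"
abbreviation (input) apar :: nat where "apar \<equiv> 5"
abbreviation (input) aord :: nat where "aord \<equiv> 6"
abbreviation (input) asize :: nat where "asize \<equiv> 7"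
abbreviation (input) anext :: nat where "anext \<equiv> 8"
abbreviation (input) aprev :: nat where "aprev \<equiv> 9"
abbreviation (input) askip :: nat where "askip \<equiv> 10"
abbreviation (input) abase :: nat where "abase \<equiv> 11"
abbreviation (input) arow :: nat where "arow \<equiv> 12"
abbreviation (input) avis :: nat where "avis \<equiv> 13"

lemma agreeD:
  assumes "agree c s s'"
  shows "x \<notin> wvars c \<Longrightarrow> mem s' 0 x = mem s 0 x"
    and "0 < a \<Longrightarrow> a \<notin> warrs c \<Longrightarrow> mem s' a = mem s a"
    and "\<not> reads c \<Longrightarrow> ins s' = ins s" and "\<not> prints c \<Longrightarrow> outs s' = outs s"
  using assms by (auto simp: agree_def)

definition read_prog :: com where
  "read_prog =
    Input vn ;;
    For vi (Var vn)
      (Input vx ;; Put acol (Var vi) (Var vx) ;; Input vx ;; Put awt (Var vi) (Var vx) ;;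
       Assign vW (Plus (Var vW) (Var vx))) ;;
    For vi (Minus (Var vn) (Lit 1))
      (Input vx ;; Put afrom (Var vi) (Var vx) ;; Input vx ;; Put ato (Var vi) (Var vx))"

definition holds_input ::
    "nat \<Rightarrow> (nat \<Rightarrow> nat) \<Rightarrow> (nat \<Rightarrow> nat) \<Rightarrow> (nat \<times> nat) list \<Rightarrow> store \<Rightarrow> bool" where
  "holds_input n c w es s \<longleftrightarrow> mem s 0 vn = n \<and> mem s 0 vW = sum w {..<n} \<and>
    (\<forall>v<n. mem s acol v = c v \<and> mem s awt v = w v) \<and>
    (\<forall>j<n - 1. (mem s afrom j, mem s ato j) = es ! j)"

lemma holds_input_agree:
  assumes "holds_input n c w es s" "agree p s s'" "vn \<notin> wvars p" "vW \<notin> wvars p"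
    "warrs p \<inter> {acol, awt, afrom, ato} = {}"
  shows "holds_input n c w es s'"
  using assms(1,3-5) agreeD(1,2) [OF assms(2)] by (simp add: holds_input_def)

lemma read_prog_correct:
  assumes ins: "ins s = n # concat (map (\<lambda>v. [c v, w v]) [0..<n]) @
      concat (map (\<lambda>(u, v). [u, v]) es)"
    and len: "length es = n - 1" and W: "mem s 0 vW = 0" and n: "0 < n"
  shows "wp read_prog (\<lambda>_. holds_input n c w es) (300 * n) s"
proof -
  let ?es = "concat (map (\<lambda>(u, v). [u, v]) es)"
  let ?L1 = "For vi (Var vn)
      (Input vx ;; Put acol (Var vi) (Var vx) ;; Input vx ;; Put awt (Var vi) (Var vx) ;;
       Assign vW (Plus (Var vW) (Var vx)))"
  let ?L2 = "For vi (Minus (Var vn) (Lit 1))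
      (Input vx ;; Put afrom (Var vi) (Var vx) ;; Input vx ;; Put ato (Var vi) (Var vx))"
  define I where "I = (\<lambda>k (s :: store). ins s = concat (map (\<lambda>v. [c v, w v]) [k..<n]) @ ?es \<and>
      mem s 0 vW = sum w {..<k} \<and> (\<forall>v<k. mem s acol v = c v \<and> mem s awt v = w v))"
  define J where "J = (\<lambda>k (s :: store). ins s = concat (map (\<lambda>(u, v). [u, v]) (drop k es)) \<and>
      (\<forall>j<k. (mem s afrom j, mem s ato j) = es ! j))"
  have 1: "wp ?L1 (\<lambda>_ s'. I n s' \<and> mem s' 0 vi = n \<and> agree ?L1 s s') (100 * n + 22) s"
    if "ins s = concat (map (\<lambda>v. [c v, w v]) [0..<n]) @ ?es" "mem s 0 vW = 0" "mem s 0 vn = n"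
    for s :: store
  proof (rule wp_For [where t = "\<lambda>_. 60"])
    fix k s1 assume k: "k < n" "I k s1" "mem s1 0 vi = k"
    then show "wp (Input vx ;; Put acol (Var vi) (Var vx) ;; Input vx ;; Put awt (Var vi) (Var vx) ;;
       Assign vW (Plus (Var vW) (Var vx))) (\<lambda>_ s'. I (Suc k) (upd 0 vi (Suc k) s')) 60 s1"
      by (auto simp: I_def upt_conv_Cons less_Suc_eq)
  qed (use that in \<open>auto simp: I_def dest: agreeD(1) [where x = vn]\<close>)
  have 2: "wp ?L2 (\<lambda>_ s'. J (n - 1) s' \<and> mem s' 0 vi = n - 1 \<and> agree ?L2 s s')
      (100 * n + 50) s" if "ins s = ?es" "mem s 0 vn = n" for s :: store
  proof (rule wp_For [where t = "\<lambda>_. 60"])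
    fix k s1 assume k: "k < n - 1" "J k s1" "mem s1 0 vi = k"
    then have "drop k es = es ! k # drop (Suc k) es" using len by (simp add: Cons_nth_drop_Suc)
    with k show "wp (Input vx ;; Put afrom (Var vi) (Var vx) ;; Input vx ;; Put ato (Var vi) (Var vx))
        (\<lambda>_ s'. J (Suc k) (upd 0 vi (Suc k) s')) 60 s1"
      by (auto simp: J_def less_Suc_eq split: prod.splits)
  qed (use that in \<open>auto simp: J_def dest: agreeD(1) [where x = vn]\<close>)
  let ?s = "(upd 0 vn n s)\<lparr>ins := concat (map (\<lambda>v. [c v, w v]) [0..<n]) @ ?es\<rparr>"
  have "wp ?L1 (wp ?L2 (\<lambda>_. holds_input n c w es)) (300 * n - 1) ?s"
  proof (rule wp_spec [OF 1])
    fix U s' assume U: "300 * n - 1 - (100 * n + 22) \<le> U"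
      and s': "I n s' \<and> mem s' 0 vi = n \<and> agree ?L1 ?s s'"
    have n': "mem s' 0 vn = n" using agreeD(1) [of ?L1 ?s s' vn] s' by simp
    show "wp ?L2 (\<lambda>_. holds_input n c w es) U s'"
    proof (rule wp_spec [OF 2])
      fix s'' assume s'': "J (n - 1) s'' \<and> mem s'' 0 vi = n - 1 \<and> agree ?L2 s' s''"
      have "mem s'' 0 vn = n" "mem s'' 0 vW = mem s' 0 vW" "mem s'' acol = mem s' acol"
        "mem s'' awt = mem s' awt"
        using agreeD(1) [of ?L2 s' s''] agreeD(2) [of ?L2 s' s''] s'' n' by simp_all
      then show "holds_input n c w es s''"
        using s' s'' by (simp add: holds_input_def I_def J_def)
    qed (use s' n' U n in \<open>auto simp: I_def\<close>)
  qed (use W n in auto)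
  then show ?thesis
    unfolding read_prog_def wp_Seq using n ins by simp
qed

section \<open>Rooting the tree\<close>

definition add_vertex :: "nat \<Rightarrow> nat \<Rightarrow> com" where
  "add_vertex p c = Put avis (Var c) (Lit 1) ;; Put apar (Var c) (Var p) ;;
    Put aord (Var vcnt) (Var c) ;; Assign vcnt (Plus (Var vcnt) (Lit 1))"

definition discover_edge :: com where
  "discover_edge =
    Assign vx (Arr afrom (Var vj)) ;; Assign vy (Arr ato (Var vj)) ;;
    Cond (Arr avis (Var vx))
      (Cond (Arr avis (Var vy)) Skip (add_vertex vx vy))
      (Cond (Arr avis (Var vy)) (add_vertex vy vx) Skip)"

text \<open>Every scan of the edge list adds a vertex unless all are found: otherwise no edge would
  leave the discovered set, against connectedness. So \<open>n\<close> scans suffice.\<close>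

definition discover_prog :: com where
  "discover_prog =
    Put avis (Lit 0) (Lit 1) ;; Assign vcnt (Lit 1) ;;
    For vi (Var vn) (For vj (Minus (Var vn) (Lit 1)) discover_edge)"

definition discovered :: "nat \<Rightarrow> (nat \<times> nat) list \<Rightarrow> nat list \<Rightarrow> store \<Rightarrow> bool" where
  "discovered n es xs s \<longleftrightarrow> parent_order xs (mem s apar) \<and> hd xs = 0 \<and> set xs \<subseteq> {..<n} \<and>
    mem s 0 vcnt = length xs \<and> (\<forall>k<length xs. mem s aord k = xs ! k) \<and>
    (\<forall>v. 0 < mem s avis v \<longleftrightarrow> v \<in> set xs) \<and> mem s apar 0 = 0 \<and>
    parent_arcs 0 (set xs) (mem s apar) \<subseteq> set es \<union> (set es)\<inverse>"

lemma discovered_cong: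
  assumes "discovered n es xs s" "mem s' apar = mem s apar" "mem s' aord = mem s aord"
    "mem s' avis = mem s avis" "mem s' 0 vcnt = mem s 0 vcnt"
  shows "discovered n es xs s'"
  using assms by (simp add: discovered_def)

lemma discovered_root: "discovered n es xs s \<Longrightarrow> 0 \<in> set xs"
  using hd_in_set [of xs] by (auto simp: discovered_def parent_order_def)

lemma add_vertex_correct:
  assumes "discovered n es xs s" "mem s 0 p \<in> set xs" "mem s 0 c \<notin> set xs" "mem s 0 c < n"
    "(mem s 0 p, mem s 0 c) \<in> set es \<union> (set es)\<inverse>" "p \<noteq> vcnt" "c \<noteq> vcnt"
  shows "wp (add_vertex p c) (\<lambda>_. discovered n es (xs @ [mem s 0 c])) 60 s"
proof -
  let ?p = "mem s 0 p" and ?c = "mem s 0 c"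
  have po: "parent_order (xs @ [?c]) ((mem s apar)(?c := ?p))"
    using assms(1-3) by (intro parent_order_snoc) (auto simp: discovered_def)
  have "0 \<in> set xs" using assms(1) by (rule discovered_root)
  then have "?c \<noteq> 0" using assms(3) by metis
  have "hd (xs @ [?c]) = 0" using assms(1) by (auto simp: discovered_def parent_order_def)
  moreover have "parent_arcs 0 (set (xs @ [?c])) ((mem s apar)(?c := ?p)) \<subseteq> set es \<union> (set es)\<inverse>"
    using assms(1,3,5) by (auto simp: parent_arcs_def discovered_def)
  ultimately show ?thesis
    using assms po \<open>?c \<noteq> 0\<close> unfolding add_vertex_def discovered_def
    by (simp add: nth_append less_Suc_eq)
qed

lemma discover_edge_correct:
  assumes "discovered n es xs s" "mem s 0 vj = j" "j < length es" "(mem s afrom j, mem s ato j) = es ! j"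
    "set es \<subseteq> {..<n} \<times> {..<n}"
  shows "wp discover_edge (\<lambda>_ s'. \<exists>ys. discovered n es (xs @ ys) s' \<and>
    (ys = [] \<longrightarrow> (fst (es ! j) \<in> set xs \<longleftrightarrow> snd (es ! j) \<in> set xs))) 150 s"
proof -
  let ?u = "fst (es ! j)" and ?v = "snd (es ! j)"
  let ?s = "upd 0 vy ?v (upd 0 vx ?u s)"
  have "(?u, ?v) \<in> set es" using assms(3) by simp
  then have uv: "(?u, ?v) \<in> set es \<union> (set es)\<inverse>" "(?v, ?u) \<in> set es \<union> (set es)\<inverse>" "?u < n" "?v < n"
    using assms(5) by auto
  have m: "mem s afrom j = ?u" "mem s ato j = ?v" using assms(4) by (metis fst_conv, metis snd_conv)
  have s: "discovered n es xs ?s" using assms(1) by (rule discovered_cong) auto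
  have vis: "0 < mem s avis v \<longleftrightarrow> v \<in> set xs" for v
    using assms(1) by (simp add: discovered_def)
  let ?Q = "\<lambda>s'. \<exists>ys. discovered n es (xs @ ys) s' \<and> (ys = [] \<longrightarrow> (?u \<in> set xs \<longleftrightarrow> ?v \<in> set xs))"
  have 1: "wp (add_vertex vx vy) (\<lambda>_. ?Q) U ?s" if "?u \<in> set xs" "?v \<notin> set xs" "60 \<le> U" for U
    by (rule wp_spec [OF add_vertex_correct [OF s, of vx vy]]) (use that uv in auto)
  have 2: "wp (add_vertex vy vx) (\<lambda>_. ?Q) U ?s" if "?v \<in> set xs" "?u \<notin> set xs" "60 \<le> U" for U
    by (rule wp_spec [OF add_vertex_correct [OF s, of vy vx]]) (use that uv in auto)
  have 3: "?Q ?s" if "?u \<in> set xs \<longleftrightarrow> ?v \<in> set xs"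
    using s that by (intro exI [of _ "[]"]) simp
  show ?thesis
    unfolding discover_edge_def using 1 2 3 assms(2)
    by (simp add: vis m)
qed

lemma discover_prog_correct:
  assumes inp: "holds_input n c w es s" and len: "length es = n - 1" and n: "0 < n"
    and es: "set es \<subseteq> {..<n} \<times> {..<n}"
    and conn: "\<And>v. v < n \<Longrightarrow> (0, v) \<in> (set es \<union> (set es)\<inverse>)\<^sup>*"
    and zero: "mem s apar = (\<lambda>_. 0)" "mem s aord = (\<lambda>_. 0)" "mem s avis = (\<lambda>_. 0)"
  shows "wp discover_prog (\<lambda>_ s'. \<exists>xs. discovered n es xs s' \<and> set xs = {..<n})
    (300 * n * n) s"
proof -
  let ?E = "set es \<union> (set es)\<inverse>"
  let ?L2 = "For vj (Minus (Var vn) (Lit 1)) discover_edge"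
  let ?L1 = "For vi (Var vn) ?L2"
  let ?s = "upd 0 vcnt 1 (upd avis 0 1 s)"
  have wv: "wvars discover_edge = {vx, vy, vcnt}" "warrs discover_edge = {avis, apar, aord}"
    by (auto simp: discover_edge_def add_vertex_def)
  \<comment> \<open>\<open>I k\<close>: after \<open>k\<close> scans at least \<open>k + 1\<close>
    vertices, or all, are found. \<open>J m j\<close>: if a scan that began with \<open>m\<close>
    vertices has added none so far, the first \<open>j\<close> edges do not leave the set.\<close>
  define I where "I = (\<lambda>k s. \<exists>xs. discovered n es xs s \<and> min n (Suc k) \<le> length xs)"
  define J where "J = (\<lambda>m j s. \<exists>xs. discovered n es xs s \<and> m \<le> length xs \<and>
    (length xs = m \<longrightarrow> (\<forall>i<j. fst (es ! i) \<in> set xs \<longleftrightarrow> snd (es ! i) \<in> set xs)))"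
  have inp1: "holds_input n c w es s'" if "agree ?L1 ?s s'" for s'
  proof -
    have "holds_input n c w es ?s" using inp by (simp add: holds_input_def)
    then show ?thesis by (rule holds_input_agree) (use that wv in auto)
  qed
  have 2: "wp ?L2 (\<lambda>_ s'. J (length xs) (n - 1) s') (200 * n) s'"
    if "discovered n es xs s'" "holds_input n c w es s'" for xs s'
  proof (rule wp_spec [OF wp_For [where t = "\<lambda>_. 150" and n = "n - 1" and I = "J (length xs)"]])
    have "discovered n es xs (upd 0 vj 0 s')" using that(1) by (rule discovered_cong) auto
    then show "J (length xs) 0 (upd 0 vj 0 s')" unfolding J_def by auto
  next
    fix s'' assume "agree ?L2 s' s''"
    then show "aval (Minus (Var vn) (Lit 1)) (mem s'') = n - 1"
      using agreeD(1) [of ?L2 s' s'' vn] that(2) wv by (simp add: holds_input_def)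
  next
    fix k s'' assume k: "k < n - 1" "J (length xs) k s''" "mem s'' 0 vj = k" "agree ?L2 s' s''"
    have inp': "holds_input n c w es s''"
      using that(2) by (rule holds_input_agree) (use k(4) wv in auto)
    obtain ys where ys: "discovered n es ys s''" "length xs \<le> length ys"
      "length ys = length xs \<Longrightarrow> \<forall>i<k. fst (es ! i) \<in> set ys \<longleftrightarrow> snd (es ! i) \<in> set ys"
      using k(2) unfolding J_def by blast
    show "wp discover_edge (\<lambda>_ s'. J (length xs) (Suc k) (upd 0 vj (Suc k) s')) 150 s''"
    proof (rule wp_spec [OF discover_edge_correct [OF ys(1) k(3)]])
      fix s3 assume "\<exists>zs. discovered n es (ys @ zs) s3 \<and>
        (zs = [] \<longrightarrow> (fst (es ! k) \<in> set ys \<longleftrightarrow> snd (es ! k) \<in> set ys))"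
      then obtain zs where zs: "discovered n es (ys @ zs) s3"
        "zs = [] \<Longrightarrow> (fst (es ! k) \<in> set ys \<longleftrightarrow> snd (es ! k) \<in> set ys)" by blast
      have "discovered n es (ys @ zs) (upd 0 vj (Suc k) s3)"
        using zs(1) by (rule discovered_cong) auto
      then show "J (length xs) (Suc k) (upd 0 vj (Suc k) s3)"
        unfolding J_def using ys(2,3) zs(2)
        by (intro exI [of _ "ys @ zs"]) (cases zs; auto simp: less_Suc_eq)
    qed (use k inp' len es in \<open>auto simp: holds_input_def\<close>)
  qed (use wv n in auto)
  have 1: "wp ?L1 (\<lambda>_ s'. I n s' \<and> mem s' 0 vi = n \<and> agree ?L1 ?s s') (250 * n * n + 30) ?s"
  proof (rule wp_For [where t = "\<lambda>_. 200 * n"])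
    have "discovered n es [0] (upd 0 vi 0 ?s)"
      using zero n by (auto simp: discovered_def parent_order_def parent_arcs_def)
    then show "I 0 (upd 0 vi 0 ?s)" unfolding I_def by force
  next
    fix s' assume "agree ?L1 ?s s'"
    from inp1 [OF this] show "aval (Var vn) (mem s') = n" by (simp add: holds_input_def)
  next
    fix k s' assume k: "k < n" "I k s'" "mem s' 0 vi = k" "agree ?L1 ?s s'"
    then obtain xs where xs: "discovered n es xs s'" "min n (Suc k) \<le> length xs"
      unfolding I_def by blast
    show "wp ?L2 (\<lambda>_ s'. I (Suc k) (upd 0 vi (Suc k) s')) (200 * n) s'"
    proof (rule wp_spec [OF 2 [OF xs(1) inp1 [OF k(4)]]])
      fix s3 assume "J (length xs) (n - 1) s3"
      then obtain ys where ys: "discovered n es ys s3" "length xs \<le> length ys"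
        "length ys = length xs \<Longrightarrow> \<forall>i<n-1. fst (es ! i) \<in> set ys \<longleftrightarrow> snd (es ! i) \<in> set ys"
        unfolding J_def by blast
      have "min n (Suc (Suc k)) \<le> length ys"
      proof (rule ccontr)
        assume *: "\<not> min n (Suc (Suc k)) \<le> length ys"
        then have "length ys = length xs" using xs(2) ys(2) by linarith
        then have closed: "\<forall>i<n-1. fst (es ! i) \<in> set ys \<longleftrightarrow> snd (es ! i) \<in> set ys"
          by (rule ys(3))
        have "card (set ys) < card {..<n}" using * card_length [of ys] by simp
        then have "set ys \<noteq> {..<n}" by (metis less_irrefl)
        moreover have "set ys \<subseteq> {..<n}" using ys(1) by (simp add: discovered_def)
        ultimately obtain v where "v < n" "v \<notin> set ys" by blast
        moreover have "0 \<in> set ys" using ys(1) by (rule discovered_root)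
        ultimately obtain a b where "(a, b) \<in> ?E" "a \<in> set ys" "b \<notin> set ys"
          using crossing_arc [OF conn [of v], of "set ys"] by blast
        moreover have "\<forall>e\<in>set es. fst e \<in> set ys \<longleftrightarrow> snd e \<in> set ys"
          using closed len by (metis in_set_conv_nth)
        ultimately show False by auto
      qed
      moreover have "discovered n es ys (upd 0 vi (Suc k) s3)"
        using ys(1) by (rule discovered_cong) auto
      ultimately show "I (Suc k) (upd 0 vi (Suc k) s3)" unfolding I_def by blast
    qed simp
  next
    have "n \<le> n * n" using n by simp
    then show "(\<Sum>k<n. 200 * n + alen (Var vn) + 20) + alen (Var vn) + 20 \<le> 250 * n * n + 30"
      by (simp add: distrib_left) (use \<open>n \<le> n * n\<close> in linarith)
  qed (use wv in auto)
  have "wp ?L1 (\<lambda>_ s'. \<exists>xs. discovered n es xs s' \<and> set xs = {..<n}) (300 * n * n - 12) ?s"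
  proof (rule wp_spec [OF 1])
    have "n \<le> n * n" using n by simp
    then show "250 * n * n + 30 \<le> 300 * n * n - 12" using n by linarith
  next
    fix s' assume "I n s' \<and> mem s' 0 vi = n \<and> agree ?L1 ?s s'"
    then obtain xs where xs: "discovered n es xs s'" "n \<le> length xs" unfolding I_def by auto
    then have "n \<le> card (set xs)" by (auto simp: discovered_def parent_order_def distinct_card)
    then have "set xs = {..<n}" using xs(1)
      by (intro card_seteq) (auto simp: discovered_def)
    with xs(1) show "\<exists>xs. discovered n es xs s' \<and> set xs = {..<n}" by blast
  qed
  moreover define T where "T = 300 * n * n"
  moreover have "12 \<le> T" using n by (simp add: T_def)
  ultimately show ?thesis
    unfolding discover_prog_def wp_Seq T_def [symmetric] by simp
qed

section \<open>Subtree sizes\<close>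

text \<open>In reverse discovery order every vertex comes before its parent, so its size is final
  when it is passed on. The root has nowhere to pass it, whence one round less than
  vertices.\<close>

definition size_prog :: com where
  "size_prog =
    For vi (Var vn) (Put asize (Var vi) (Lit 1)) ;;
    For vi (Minus (Var vn) (Lit 1))
      (Assign vx (Arr aord (Minus (Var vn) (Plus (Var vi) (Lit 1)))) ;;
       Assign vy (Arr apar (Var vx)) ;;
       Put asize (Var vy) (Plus (Arr asize (Var vy)) (Arr asize (Var vx))))"

lemma size_prog_correct:
  assumes n: "mem s 0 vn = n" "0 < n" and xs: "parent_order xs par" "hd xs = 0" "set xs = {..<n}"
    and ord: "\<And>k. k < n \<Longrightarrow> mem s aord k = xs ! k" and par: "mem s apar = par"
  shows "wp size_prog (\<lambda>_ s'. \<forall>v<n. mem s' asize v =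
    Suc (\<Sum>c | 0 < c \<and> c < n \<and> par c = v. mem s' asize c)) (400 * n) s"
proof -
  let ?B1 = "Put asize (Var vi) (Lit 1)"
  let ?B2 = "Assign vx (Arr aord (Minus (Var vn) (Plus (Var vi) (Lit 1)))) ;;
       Assign vy (Arr apar (Var vx)) ;;
       Put asize (Var vy) (Plus (Arr asize (Var vy)) (Arr asize (Var vx)))"
  let ?L1 = "For vi (Var vn) ?B1"
  let ?L2 = "For vi (Minus (Var vn) (Lit 1)) ?B2"
  have len: "length xs = n" and dist: "distinct xs"
    using xs distinct_card [of xs] by (auto simp: parent_order_def)
  define I where "I = (\<lambda>k (s :: store). \<forall>v<k. mem s asize v = 1)"
  define J where "J = (\<lambda>k (s :: store). \<forall>v<n. mem s asize v =
    Suc (\<Sum>c | c \<in> set (drop (n - k) xs) \<and> par c = v. mem s asize c))"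
  have 1: "wp ?L1 (\<lambda>_ s'. I n s' \<and> mem s' 0 vi = n \<and> agree ?L1 s s') (100 * n + 50) s"
  proof (rule wp_For [where t = "\<lambda>_. 20"])
    fix s' assume "agree ?L1 s s'"
    then show "aval (Var vn) (mem s') = n" using agreeD(1) [of ?L1 s s' vn] n by simp
  qed (auto simp: I_def less_Suc_eq)
  have 2: "wp ?L2 (\<lambda>_ s'. J (n - 1) s' \<and> mem s' 0 vi = n - 1 \<and> agree ?L2 s1 s') (150 * n + 50) s1"
    if s1: "I n s1" "mem s1 0 vn = n" "mem s1 aord = mem s aord" "mem s1 apar = par"
    for s1 :: store
  proof (rule wp_For [where t = "\<lambda>_. 80"])
    show "J 0 (upd 0 vi 0 s1)" using s1(1) len by (simp add: I_def J_def)
  next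
    fix s' assume "agree ?L2 s1 s'"
    then show "aval (Minus (Var vn) (Lit 1)) (mem s') = n - 1"
      using agreeD(1) [of ?L2 s1 s' vn] s1 by simp
  next
    fix k s' assume k: "k < n - 1" "J k s'" "mem s' 0 vi = k" "agree ?L2 s1 s'"
    let ?i = "n - Suc k"
    let ?x = "xs ! ?i"
    let ?A = "mem s' asize"
    have i: "0 < ?i" "?i < n" using k(1) by auto
    have a: "mem s' 0 vn = n" "mem s' aord ?i = ?x" "mem s' apar = par"
      using agreeD(1,2) [OF k(4)] s1 ord i by simp_all
    have dr: "drop ?i xs = ?x # drop (n - k) xs"
      using Cons_nth_drop_Suc [of ?i xs] i len k(1) by (simp add: Suc_diff_Suc)
    have p: "par ?x \<in> set (take ?i xs)" using xs(1) i len by (simp add: parent_order_def)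
    have disj: "set (take ?i xs) \<inter> set (drop ?i xs) = {}"
      using dist by (rule set_take_disj_set_drop_if_distinct) simp
    \<comment> \<open>The only size that changes is that of a vertex not yet passed on, so all
      summands keep their values.\<close>
    have px: "par ?x \<notin> set (drop ?i xs)" using p disj by blast
    have x: "?x \<notin> set (drop (n - k) xs)" using dist dr
      by (metis distinct.simps(2) distinct_drop)
    have "par ?x < n" using p xs(3) set_take_subset [of ?i xs] by blast
    let ?A' = "?A(par ?x := ?A (par ?x) + ?A ?x)"
    have "?A' v = Suc (\<Sum>c | c \<in> set (drop ?i xs) \<and> par c = v. ?A' c)" if "v < n" for v
    proof -
      have "?A' c = ?A c" if "c \<in> set (drop ?i xs)" for c using px that by auto
      then have "(\<Sum>c | c \<in> set (drop ?i xs) \<and> par c = v. ?A' c) =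
          (\<Sum>c | c \<in> set (drop ?i xs) \<and> par c = v. ?A c)" by (intro sum.cong) auto
      also have "\<dots> = (if par ?x = v then ?A ?x else 0) +
          (\<Sum>c | c \<in> set (drop (n - k) xs) \<and> par c = v. ?A c)"
      proof -
        have "{c. c \<in> set (drop ?i xs) \<and> par c = v} =
            (if par ?x = v then {?x} else {}) \<union> {c. c \<in> set (drop (n - k) xs) \<and> par c = v}"
          by (subst dr) auto
        then show ?thesis by (simp only:, subst sum.union_disjoint) (use x in auto)
      qed
      finally have eq: "(\<Sum>c | c \<in> set (drop ?i xs) \<and> par c = v. ?A' c) =
        (if par ?x = v then ?A ?x else 0) +
          (\<Sum>c | c \<in> set (drop (n - k) xs) \<and> par c = v. ?A c)" .
      have "?A v = Suc (\<Sum>c | c \<in> set (drop (n - k) xs) \<and> par c = v. ?A c)"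
        using k(2) that unfolding J_def by blast
      then show ?thesis unfolding eq by auto
    qed
    then show "wp ?B2 (\<lambda>_ s'. J (Suc k) (upd 0 vi (Suc k) s')) 80 s'"
      using k(3) a by (simp add: J_def)
  qed auto
  have "wp ?L1 (wp ?L2 (\<lambda>_ s'. \<forall>v<n. mem s' asize v =
    Suc (\<Sum>c | 0 < c \<and> c < n \<and> par c = v. mem s' asize c))) (400 * n) s"
  proof (rule wp_spec [OF 1])
    fix U s1 assume U: "400 * n - (100 * n + 50) \<le> U"
      and s1: "I n s1 \<and> mem s1 0 vi = n \<and> agree ?L1 s s1"
    have s1': "mem s1 0 vn = n" "mem s1 aord = mem s aord" "mem s1 apar = par"
      using agreeD(1,2) [of ?L1 s s1] s1 n par by simp_all
    show "wp ?L2 (\<lambda>_ s'. \<forall>v<n. mem s' asize v =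
      Suc (\<Sum>c | 0 < c \<and> c < n \<and> par c = v. mem s' asize c)) U s1"
    proof (rule wp_spec [OF 2 [OF _ s1']])
      fix s' assume "J (n - 1) s' \<and> mem s' 0 vi = n - 1 \<and> agree ?L2 s1 s'"
      then have J: "J (n - 1) s'" by blast
      have "xs = 0 # drop 1 xs" using xs(2) len n by (cases xs) auto
      then have "set (drop 1 xs) = {..<n} - {0}" using dist xs(3)
        by (metis Diff_insert_absorb distinct.simps(2) list.simps(15))
      then have eq: "{c. c \<in> set (drop (n - (n - 1)) xs) \<and> par c = v} =
          {c. 0 < c \<and> c < n \<and> par c = v}" for v
        using n by auto
      show "\<forall>v<n. mem s' asize v = Suc (\<Sum>c | 0 < c \<and> c < n \<and> par c = v. mem s' asize c)"
        using J unfolding J_def eq .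
    qed (use s1 U n in auto)
  qed (use n in auto)
  then show ?thesis by (simp add: size_prog_def)
qed

text \<open>Summed over all vertices, the recursion has every size except that of the root on both
  sides, which leaves \<open>sz 0 = n\<close>. The bound for two siblings yields the halving at
  tops.\<close>

lemma sizes_bounds:
  assumes sz': "\<forall>v<n. sz v = Suc (\<Sum>c | 0 < c \<and> c < n \<and> par c = v. sz c)"
    and par': "\<forall>v. 0 < v \<and> v < n \<longrightarrow> par v < n" and n: "0 < (n :: nat)"
  shows "sz 0 = n"
    and "0 < v \<Longrightarrow> v < n \<Longrightarrow> sz v < sz (par v)"
    and "0 < u \<Longrightarrow> u < n \<Longrightarrow> 0 < v \<Longrightarrow> v < n \<Longrightarrow> u \<noteq> v \<Longrightarrow> par u = par v \<Longrightarrow>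
      sz u + sz v \<le> sz (par v)"
proof -
  note sz = sz' [rule_format] and par = par' [rule_format, OF conjI]
  have "sum sz {..<n} = (\<Sum>v<n. Suc (\<Sum>c | 0 < c \<and> c < n \<and> par c = v. sz c))"
    by (intro sum.cong refl sz) simp
  also have "\<dots> = n + (\<Sum>v<n. \<Sum>c | 0 < c \<and> c < n \<and> par c = v. sz c)"
    by (simp add: sum_Suc)
  also have "(\<Sum>v<n. \<Sum>c | 0 < c \<and> c < n \<and> par c = v. sz c) = (\<Sum>c\<in>{0<..<n}. sz c)"
    using sum.group [of "{0<..<n}" "{..<n}" par sz] par
    by (simp add: image_subset_iff conj_ac cong: sum.cong)
  also have "sum sz {..<n} = sz 0 + (\<Sum>c\<in>{0<..<n}. sz c)"
  proof -
    have "{..<n} = insert 0 {0<..<n}" using n by auto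
    then show ?thesis by simp
  qed
  finally show "sz 0 = n" by simp
  show "sz v < sz (par v)" if "0 < v" "v < n" for v
    using sz [OF par [OF that]] member_le_sum [of v "{c. 0 < c \<and> c < n \<and> par c = par v}" sz] that
    by simp
  show "sz u + sz v \<le> sz (par v)"
    if "0 < u" "u < n" "0 < v" "v < n" "u \<noteq> v" "par u = par v"
  proof -
    have "sum sz {u, v} \<le> (\<Sum>c | 0 < c \<and> c < n \<and> par c = par v. sz c)"
      using that by (intro sum_mono2) auto
    then show ?thesis using sz [OF par [of v]] that by simp
  qed
qed

section \<open>Preorder with the largest child last\<close>

text \<open>
  Vertices are inserted into a doubly linked list in order of decreasing size, each directly
  after its parent. So the first inserted child, which ends up last, is a largest one.
\<close>

abbreviation neq :: "aexp \<Rightarrow> aexp \<Rightarrow> aexp" where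
  "neq e f \<equiv> Plus (Minus e f) (Minus f e)"

definition insert_vertex :: com where
  "insert_vertex =
    Assign vj (Arr apar (Var vx)) ;; Assign vy (Arr anext (Var vj)) ;;
    Put askip (Var vx) (Var vy) ;; Put anext (Var vx) (Var vy) ;; Put aprev (Var vy) (Var vx) ;;
    Put anext (Var vj) (Var vx) ;; Put aprev (Var vx) (Var vj)"

text \<open>Round \<open>vi\<close> inserts the vertices of size \<open>n - vi\<close>. A parent is
  strictly larger than its children and therefore already present. The number \<open>n\<close>
  serves as end marker of the list.\<close>

definition preorder_prog :: com where
  "preorder_prog =
    Put anext (Lit 0) (Var vn) ;; Put aprev (Var vn) (Lit 0) ;; Put askip (Lit 0) (Var vn) ;;
    For vi (Var vn) (For vx (Var vn)
      (Cond (Var vx)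
        (Cond (neq (Arr asize (Var vx)) (Minus (Var vn) (Var vi))) Skip insert_vertex) Skip))"

definition linked :: "(nat \<Rightarrow> nat) \<Rightarrow> (nat \<Rightarrow> nat) \<Rightarrow> nat list \<Rightarrow> bool" where
  "linked nxt prv = successively (\<lambda>x y. nxt x = y \<and> prv y = x)"

text \<open>The last conjunct prepares the halving: a vertex other than the root that does not share
  \<open>skip\<close> with its parent, and so becomes the top of a chain, has a sibling at least as
  large.\<close>

definition inserted :: "nat \<Rightarrow> (nat \<Rightarrow> nat) \<Rightarrow> (nat \<Rightarrow> nat) \<Rightarrow> nat set \<Rightarrow> store \<Rightarrow> bool" where
  "inserted n par sz X s \<longleftrightarrow> (\<exists>xs. distinct xs \<and> set xs = X \<and> xs \<noteq> [] \<and> hd xs = 0 \<and>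
    preordered xs par (mem s askip) n \<and> linked (mem s anext) (mem s aprev) (xs @ [n])) \<and>
    (\<forall>v\<in>X - {0}. mem s askip v = mem s askip (par v) \<or>
      (\<exists>u\<in>X - {0}. u \<noteq> v \<and> par u = par v \<and> sz v \<le> sz u))"

lemma inserted_cong:
  assumes "inserted n par sz X s" "mem s' askip = mem s askip" "mem s' anext = mem s anext"
    "mem s' aprev = mem s aprev"
  shows "inserted n par sz X s'"
  using assms by (simp add: inserted_def)

lemma successively_weaken:
  assumes "successively P xs"
    and "\<And>x y. x \<in> set (butlast xs) \<Longrightarrow> y \<in> set (tl xs) \<Longrightarrow> P x y \<Longrightarrow> Q x y"
  shows "successively Q xs"
  using assms
proof (induction xs rule: induct_list012)
  case (3 x y zs)
  have "successively Q (y # zs)"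
    by (rule "3.IH"(2)) (use "3.prems" in auto)
  then show ?case using "3.prems" by auto
qed auto

lemma linked_insert:
  assumes "linked nxt prv (xs @ p # q # ys)" "distinct (xs @ p # q # ys)" "v \<notin> set (xs @ p # q # ys)"
  shows "linked (nxt(v := q, p := v)) (prv(q := v, v := p)) (xs @ p # v # q # ys)"
proof -
  let ?P = "\<lambda>x y. nxt x = y \<and> prv y = x"
  let ?Q = "\<lambda>x y. (nxt(v := q, p := v)) x = y \<and> (prv(q := v, v := p)) y = x"
  have "successively ?P ((xs @ [p]) @ q # ys)" using assms(1) by (simp add: linked_def)
  then have P: "successively ?P (xs @ [p])" "successively ?P (q # ys)"
    unfolding successively_append_iff by blast+
  have 1: "successively ?Q (xs @ [p])"
    using P(1)
  proof (rule successively_weaken)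
    fix x y assume *: "x \<in> set (butlast (xs @ [p]))" "y \<in> set (tl (xs @ [p]))" "?P x y"
    have "y \<in> set (xs @ [p])" using *(2) by (cases xs) auto
    then show "?Q x y" using * assms(2,3) by auto
  qed
  have 2: "successively ?Q (q # ys)"
    using P(2)
  proof (rule successively_weaken)
    fix x y assume *: "x \<in> set (butlast (q # ys))" "y \<in> set (tl (q # ys))" "?P x y"
    have "x \<in> set (q # ys)" using *(1) by (rule in_set_butlastD)
    then show "?Q x y" using * assms(2,3) by auto
  qed
  have "successively ?Q ((xs @ [p]) @ [v] @ q # ys)"
    using 1 2 assms(2,3) unfolding successively_append_iff by auto
  then show ?thesis by (simp add: linked_def)
qed

lemma insert_vertex_correct:
  assumes ins: "inserted n par sz X s" and par: "mem s apar = par" "par 0 = 0" and v: "mem s 0 vx = v" "v < n"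
    "v \<notin> X" "par v \<in> X" and X: "X \<subseteq> {..<n}" "0 \<in> X" "\<And>u. u \<in> X - {0} \<Longrightarrow> par u \<in> X"
    and sz: "\<And>u. u \<in> X \<Longrightarrow> sz v \<le> sz u"
  shows "wp insert_vertex (\<lambda>_. inserted n par sz (insert v X)) 150 s"
proof -
  let ?p = "par v"
  obtain xs where xs: "distinct xs" "set xs = X" "xs \<noteq> []" "hd xs = 0"
      "preordered xs par (mem s askip) n" "linked (mem s anext) (mem s aprev) (xs @ [n])"
    using ins unfolding inserted_def by blast
  obtain as bs where ab: "xs = as @ ?p # bs" using v(4) xs(2) split_list by metis
  obtain q ys where q: "bs @ [n] = q # ys" by (cases bs) auto
  have n: "n \<notin> X" using X(1) by auto
  have lnk: "linked (mem s anext) (mem s aprev) (as @ ?p # q # ys)"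
    using xs(6) ab q by simp
  have "distinct (xs @ [n])" using xs(1,2) n by simp
  then have dist: "distinct (as @ ?p # q # ys)" using ab q by simp
  have set: "set (as @ ?p # q # ys) = insert n X"
  proof -
    have "set (xs @ [n]) = insert n X" using xs(2) by auto
    then show ?thesis using ab q by simp
  qed
  have nxt: "mem s anext ?p = q"
    using lnk by (simp add: linked_def successively_append_iff)
  let ?skip = "(mem s askip)(v := q)"
  have hd: "hd (as @ ?p # v # bs) = 0" using xs(4) ab by (cases as) auto
  have pre: "preordered (as @ ?p # v # bs) par ?skip n"
  proof -
    have "hd (bs @ [n]) = q" using q by simp
    moreover have "hd (as @ [?p]) = 0" using xs(4) ab by (cases as) auto
    then have "v \<noteq> par (hd (as @ [?p]))" using par(2) v(3) X(2) by metis
    moreover have "v \<notin> set (as @ ?p # bs)" using v(3) xs(2) ab by auto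
    ultimately show ?thesis
      using preordered_insert [of as ?p bs par "mem s askip" n v] xs(1,5) ab by simp
  qed
  have link: "linked ((mem s anext)(v := q, ?p := v)) ((mem s aprev)(q := v, v := ?p)) ((as @ ?p # v # bs) @ [n])"
  proof -
    have "v \<notin> set (as @ ?p # q # ys)" unfolding set using v(2,3) by simp
    from linked_insert [OF lnk dist this] show ?thesis using q by simp
  qed
  \<comment> \<open>If \<open>par v\<close> already has a child, that child is at least as large by
    the order of insertion. Otherwise the successor of the still childless parent is its
    \<open>skip\<close>, which \<open>v\<close> takes over.\<close>
  have heavy: "?skip u = ?skip (par u) \<or>
      (\<exists>u'\<in>insert v X - {0}. u' \<noteq> u \<and> par u' = par u \<and> sz u \<le> sz u')"
    if u: "u \<in> insert v X - {0}" for u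
  proof (cases "u = v")
    case True
    show ?thesis
    proof (cases "\<exists>u'\<in>X - {0}. par u' = ?p")
      case True
      then obtain u' where u': "u' \<in> X - {0}" "par u' = ?p" by blast
      moreover from this have "u' \<noteq> v" using v(3) by auto
      ultimately show ?thesis using sz [of u'] \<open>u = v\<close> by blast
    next
      case False
      have "par x \<noteq> ?p" if "x \<in> set bs" for x
      proof -
        have "x \<in> X" using that xs(2) ab by auto
        moreover have "x \<noteq> hd xs" using that xs(1) unfolding ab by (cases as) auto
        then have "x \<noteq> 0" using xs(4) by simp
        ultimately show ?thesis using False by blast
      qed
      then have "mem s askip ?p = hd (bs @ [n])"
        using preordered_skip [of as ?p bs par "mem s askip" n] xs(1,5) ab by blast
      then have "?skip (par v) = q" using q v(3,4) by auto
      then show ?thesis using \<open>u = v\<close> by simp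
    qed
  next
    case False
    then have "u \<in> X - {0}" using u by auto
    moreover from this have "par u \<noteq> v" using X(3) v(3) by auto
    ultimately show ?thesis using ins False unfolding inserted_def by auto
  qed
  have dist': "distinct (as @ ?p # v # bs)" using xs(1) ab v(3) xs(2) by auto
  have set': "set (as @ ?p # v # bs) = insert v X" using xs(2) ab by auto
  have "inserted n par sz (insert v X) s'"
    if "mem s' askip = ?skip" "mem s' anext = (mem s anext)(v := q, ?p := v)"
      "mem s' aprev = (mem s aprev)(q := v, v := ?p)" for s'
    unfolding inserted_def that
    using pre link heavy hd dist' set' by (intro conjI exI [of _ "as @ ?p # v # bs"] ballI) blast+
  then show ?thesis
    unfolding insert_vertex_def using v(1) par(1) nxt by simp
qed

lemma preorder_prog_correct:
  assumes s: "mem s 0 vn = n" "0 < n" "mem s apar = par" "mem s asize = sz" and par0: "par 0 = 0"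
    and par: "\<And>v. 0 < v \<Longrightarrow> v < n \<Longrightarrow> par v < n"
    and sz: "\<And>v. 0 < v \<Longrightarrow> v < n \<Longrightarrow> sz v < sz (par v)" "\<And>v. v < n \<Longrightarrow> 0 < sz v" "sz 0 = n"
  shows "wp preorder_prog (\<lambda>_. inserted n par sz {..<n}) (500 * n * n) s"
proof -
  let ?B = "Cond (Var vx)
        (Cond (neq (Arr asize (Var vx)) (Minus (Var vn) (Var vi))) Skip insert_vertex) Skip"
  let ?L2 = "For vx (Var vn) ?B"
  let ?L1 = "For vi (Var vn) ?L2"
  let ?s = "upd askip 0 n (upd aprev n 0 (upd anext 0 n s))"
  \<comment> \<open>The vertices present in round \<open>k\<close> once those below \<open>x\<close>
    have been examined.\<close>
  define X where "X = (\<lambda>k x. {v. v < n \<and> (v = 0 \<or> n - k < sz v \<or> (sz v = n - k \<and> v < x))})"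
  have sz_le: "sz v \<le> n" if "v < n" for v
  proof -
    obtain m where m: "m < n" "\<And>u. u < n \<Longrightarrow> sz u \<le> sz m"
      using finite_imageI [of "{..<n}" sz] Max_in [of "sz ` {..<n}"] Max_ge [of "sz ` {..<n}"] s(2)
      by (metis (no_types, lifting) finite_lessThan imageE image_eqI image_is_empty lessThan_empty_iff
          lessThan_iff less_not_refl)
    have "m = 0"
    proof (rule ccontr)
      assume "m \<noteq> 0"
      then have "sz m < sz (par m)" "par m < n" using sz(1) par m(1) by auto
      then show False using m(2) [of "par m"] by simp
    qed
    then show ?thesis using m(2) [OF that] sz(3) by simp
  qed
  have wv: "wvars insert_vertex = {vj, vy}" "warrs insert_vertex = {askip, anext, aprev}"
    by (auto simp: insert_vertex_def)
  have ag: "mem s' 0 vn = n" "mem s' apar = par" "mem s' asize = sz" if "agree ?L1 ?s s'" for s'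
    using agreeD(1,2) [OF that] s wv by simp_all
  have 2: "wp ?L2 (\<lambda>_ s'. inserted n par sz (X (Suc k) 0) s') (300 * n) s'"
    if s': "inserted n par sz (X k 0) s'" "mem s' 0 vi = k" "k < n" "mem s' 0 vn = n"
      "mem s' apar = par" "mem s' asize = sz" for k s'
  proof (rule wp_spec [OF wp_For [where t = "\<lambda>_. 220" and n = n and
        I = "\<lambda>x. inserted n par sz (X k x)" and T = "300 * n"]])
    show "inserted n par sz (X k 0) (upd 0 vx 0 s')"
      using s'(1) by (rule inserted_cong) auto
  next
    fix x s'' assume x: "x < n" "inserted n par sz (X k x) s''" "mem s'' 0 vx = x" "agree ?L2 s' s''"
    have m: "mem s'' 0 vn = n" "mem s'' apar = par" "mem s'' asize = sz" "mem s'' 0 vi = k"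
      using agreeD(1,2) [OF x(4)] s' wv by simp_all
    have up: "inserted n par sz Y (upd 0 vx (Suc x) s3)" if "inserted n par sz Y s3" for Y s3
      using that by (rule inserted_cong) auto
    show "wp ?B (\<lambda>_ s'. inserted n par sz (X k (Suc x)) (upd 0 vx (Suc x) s')) 220 s''"
    proof (cases "0 < x \<and> sz x = n - k")
      case True
      have "wp insert_vertex (\<lambda>_. inserted n par sz (insert x (X k x))) 150 s''"
      proof (rule insert_vertex_correct [OF x(2) m(2) par0 x(3,1)])
        show "x \<notin> X k x" using True by (simp add: X_def)
        show "par x \<in> X k x" using True sz(1) [of x] par [of x] x(1) by (simp add: X_def)
        show "X k x \<subseteq> {..<n}" "0 \<in> X k x" using s(2) by (auto simp: X_def)
        show "par u \<in> X k x" if "u \<in> X k x - {0}" for u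
          using that sz(1) [of u] par [of u] by (auto simp: X_def)
        show "sz x \<le> sz u" if "u \<in> X k x" for u
          using that True sz(3) by (auto simp: X_def)
      qed
      moreover have "X k (Suc x) = insert x (X k x)" using True x(1) by (auto simp: X_def)
      ultimately have "wp insert_vertex (\<lambda>_. inserted n par sz (X k (Suc x))) 150 s''" by simp
      then have "wp insert_vertex (\<lambda>_ s'. inserted n par sz (X k (Suc x)) (upd 0 vx (Suc x) s')) 150 s''"
        by (rule wp_spec) (use up in auto)
      then have *: "wp insert_vertex (\<lambda>_ s'. inserted n par sz (X k (Suc x)) (upd 0 vx (Suc x) s')) T s''"
        if "150 \<le> T" for T
        by (rule wp_spec) (use that in auto)
      show ?thesis using True x(3) m by (simp add: *)
    next
      case False
      then have "X k (Suc x) = X k x" by (auto simp: X_def less_Suc_eq)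
      then show ?thesis using False x(2,3) m up [of "X k x" s''] by auto
    qed
  next
    fix s'' assume s'': "inserted n par sz (X k n) s'' \<and> mem s'' 0 vx = n \<and> agree ?L2 s' s''"
    have "X k n = X (Suc k) 0" using s'(3) by (auto simp: X_def)
    then show "inserted n par sz (X (Suc k) 0) s''" using s'' by simp
  next
    fix s'' assume "agree ?L2 s' s''"
    then show "aval (Var vn) (mem s'') = n" using agreeD(1) [of ?L2 s' s'' vn] s' wv by simp
  qed (use s(2) wv in auto)
  have 1: "wp ?L1 (\<lambda>_ s'. inserted n par sz (X n 0) s' \<and> mem s' 0 vi = n \<and> agree ?L1 ?s s')
      (350 * n * n + 30) ?s"
  proof (rule wp_For [where t = "\<lambda>_. 300 * n" and I = "\<lambda>k. inserted n par sz (X k 0)"])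
    have "X 0 0 = {0}" using sz_le s(2) by (force simp: X_def)
    then show "inserted n par sz (X 0 0) (upd 0 vi 0 ?s)"
      unfolding inserted_def
      by (intro conjI exI [of _ "[0]"] preordered_singleton) (simp_all add: linked_def)
  next
    fix s' assume "agree ?L1 ?s s'"
    from ag(1) [OF this] show "aval (Var vn) (mem s') = n" by simp
  next
    fix k s' assume k: "k < n" "inserted n par sz (X k 0) s'" "mem s' 0 vi = k" "agree ?L1 ?s s'"
    show "wp ?L2 (\<lambda>_ s'. inserted n par sz (X (Suc k) 0) (upd 0 vi (Suc k) s')) (300 * n) s'"
      by (rule wp_spec [OF 2 [OF k(2,3,1) ag [OF k(4)]]]) (auto elim: inserted_cong)
  next
    have "n \<le> n * n" using s(2) by simp
    then show "(\<Sum>k<n. 300 * n + alen (Var vn) + 20) + alen (Var vn) + 20 \<le> 350 * n * n + 30"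
      by (simp add: distrib_left) (use \<open>n \<le> n * n\<close> in linarith)
  qed (use wv in auto)
  define T where "T = 500 * n * n"
  have nn: "0 < n * n" using s(2) by simp
  have "v \<in> X n 0 \<longleftrightarrow> v \<in> {..<n}" for v
    using sz(2) [of v] by (auto simp: X_def)
  then have "X n 0 = {..<n}" by blast
  then have fin: "inserted n par sz {..<n} s'" if "inserted n par sz (X n 0) s'" for s'
    using that by simp
  have "wp ?L1 (\<lambda>_. inserted n par sz {..<n}) (T - 30) ?s"
  proof (rule wp_spec [OF 1])
    show "350 * n * n + 30 \<le> T - 30"
      unfolding T_def using nn s(2) by (cases n) (simp_all add: algebra_simps)
  qed (use fin in blast)
  moreover have "30 \<le> T" using nn unfolding T_def by linarith
  ultimately show ?thesis
    unfolding preorder_prog_def wp_Seq T_def [symmetric] using s(1) by (simp, arith)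
qed

section \<open>Dynamic programming along the chains\<close>

text \<open>
  The row of a vertex has an entry for every difference \<open>d\<close> between blue and red weight, at
  index \<open>d + 2 * W\<close>. An entry is \<open>0\<close> if no set has this difference, and one more
  than the maximal weight of such a set otherwise. The entries with \<open>\<bar>d\<bar> > W\<close> stay
  \<open>0\<close> and make range checks unnecessary.
\<close>

definition base_prog :: com where
  "base_prog =
    Assign vstride (Plus (Plus (Plus (Var vW) (Var vW)) (Plus (Var vW) (Var vW))) (Lit 1)) ;;
    Assign vu (Lit 0) ;;
    For vi (Plus (Var vn) (Lit 1))
      (Put abase (Var vi) (Var vu) ;; Assign vu (Plus (Var vu) (Var vstride)))"

lemma base_prog_correct:
  assumes "mem s 0 vn = n" "mem s 0 vW = W" "0 < n"
  shows "wp base_prog (\<lambda>_ s'. mem s' 0 vstride = 4 * W + 1 \<and>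
    (\<forall>v\<le>n. mem s' abase v = v * (4 * W + 1))) (200 * n) s"
proof -
  let ?B = "Put abase (Var vi) (Var vu) ;; Assign vu (Plus (Var vu) (Var vstride))"
  let ?L = "For vi (Plus (Var vn) (Lit 1)) ?B"
  let ?s = "upd 0 vu 0 (upd 0 vstride (W + W + (W + W) + 1) s)"
  define I where "I = (\<lambda>k (s :: store). mem s 0 vu = k * (4 * W + 1) \<and>
    (\<forall>v<k. mem s abase v = v * (4 * W + 1)))"
  have "wp ?L (\<lambda>_ s'. I (Suc n) s' \<and> mem s' 0 vi = Suc n \<and> agree ?L ?s s') (70 * n + 100) ?s"
  proof (rule wp_For [where t = "\<lambda>_. 30"])
    fix s' assume "agree ?L ?s s'"
    then show "aval (Plus (Var vn) (Lit 1)) (mem s') = Suc n"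
      using agreeD(1) [of ?L ?s s' vn] assms by simp
  next
    fix k s' assume k: "I k s'" "mem s' 0 vi = k" "agree ?L ?s s'"
    have "mem s' 0 vstride = 4 * W + 1" using agreeD(1) [OF k(3), of vstride] by simp
    then show "wp ?B (\<lambda>_ s'. I (Suc k) (upd 0 vi (Suc k) s')) 30 s'"
      using k by (auto simp: I_def less_Suc_eq algebra_simps)
  qed (auto simp: I_def)
  then have "wp ?L (\<lambda>_ s'. mem s' 0 vstride = 4 * W + 1 \<and>
      (\<forall>v\<le>n. mem s' abase v = v * (4 * W + 1))) (200 * n - 18) ?s"
  proof (rule wp_spec)
    fix s' assume s': "I (Suc n) s' \<and> mem s' 0 vi = Suc n \<and> agree ?L ?s s'"
    then have "mem s' 0 vstride = 4 * W + 1" using agreeD(1) [of ?L ?s s' vstride] by simp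
    then show "mem s' 0 vstride = 4 * W + 1 \<and> (\<forall>v\<le>n. mem s' abase v = v * (4 * W + 1))"
      using s' by (simp add: I_def less_Suc_eq_le)
  qed (use assms(3) in linarith)
  moreover define T where "T = 200 * n"
  moreover have "100 \<le> T" using assms(3) by (simp add: T_def)
  ultimately show ?thesis
    unfolding base_prog_def wp_Seq T_def [symmetric] using assms(2) by simp
qed

text \<open>One step of the recurrence: \<open>vy\<close> is the list successor of
  \<open>vx\<close>, and its row provides the values for taking \<open>vx\<close>, while the row at
  \<open>askip\<close> provides those for skipping it. Only differences of modulus at most
  \<open>W\<close> are computed.\<close>

definition fill_prog :: com where
  "fill_prog =
    For vd (Plus (Plus (Var vW) (Var vW)) (Lit 1))
      (Assign vk (Plus (Var vd) (Var vW)) ;;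
       Cond (Arr acol (Var vx)) (Assign vt (Plus (Var vk) (Arr awt (Var vx))))
         (Assign vt (Minus (Var vk) (Arr awt (Var vx)))) ;;
       Assign vt (Arr arow (Plus (Arr abase (Var vy)) (Var vt))) ;;
       Cond (Var vt) (Assign vt (Plus (Var vt) (Arr awt (Var vx)))) Skip ;;
       Assign vu (Arr arow (Plus (Arr abase (Arr askip (Var vx))) (Var vk))) ;;
       Cond (Minus (Var vu) (Var vt)) (Assign vt (Var vu)) Skip ;;
       Put arow (Plus (Arr abase (Var vx)) (Var vk)) (Var vt))"

text \<open>The rows of a pass refer to its end \<open>vend\<close>, so only a vertex whose own
  subtree ends there is a candidate for the topmost one. Index \<open>2 * W\<close> is difference
  0.\<close>

definition update_prog :: com where
  "update_prog =
    Cond (neq (Arr askip (Var vx)) (Var vend)) Skip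
      (Assign vt (Arr arow (Plus (Arr abase (Var vx)) (Plus (Var vW) (Var vW)))) ;;
       Cond (Minus (Var vt) (Var vbest))
         (Assign vbest (Var vt) ;; Assign vroot (Var vx)) Skip)"

definition chain_body :: com where
  "chain_body = Assign vx (Arr aprev (Var vy)) ;; fill_prog ;; update_prog ;; Assign vy (Var vx)"

text \<open>The pass runs backwards along the list, from the end to the top. The row at the end
  describes the family that consists of the empty set: entry 1 at difference 0.\<close>

definition chain_prog :: com where
  "chain_prog =
    Assign vend (Arr askip (Var vtop)) ;;
    Assign vu (Arr abase (Var vend)) ;;
    For vd (Var vstride) (Put arow (Plus (Var vu) (Var vd)) (Lit 0)) ;;
    Put arow (Plus (Var vu) (Plus (Var vW) (Var vW))) (Lit 1) ;;
    Assign vy (Var vend) ;;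
    While (neq (Var vy) (Var vtop)) chain_body"

text \<open>The empty set has weight 0, encoded as \<open>vbest = 1\<close>. In the test,
  \<open>1 - vi\<close> is positive only for the root 0, which is a top although it shares
  \<open>skip\<close> with itself as its own parent.\<close>

definition solve_prog :: com where
  "solve_prog =
    Assign vbest (Lit 1) ;;
    For vi (Var vn)
      (Cond (Plus (Minus (Lit 1) (Var vi))
          (neq (Arr askip (Var vi)) (Arr askip (Arr apar (Var vi)))))
        (Assign vtop (Var vi) ;; chain_prog) Skip)"

text \<open>An entry larger than the one for skipping can only come from taking the vertex.\<close>

definition print_body :: com where
  "print_body =
    Cond (Minus (Arr arow (Plus (Arr abase (Var vx)) (Var vk)))
        (Arr arow (Plus (Arr abase (Arr askip (Var vx))) (Var vk))))
      (Output (Var vx) ;;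
       Cond (Arr acol (Var vx)) (Assign vk (Plus (Var vk) (Arr awt (Var vx))))
         (Assign vk (Minus (Var vk) (Arr awt (Var vx)))) ;;
       Assign vx (Arr anext (Var vx)))
      (Assign vx (Arr askip (Var vx)))"

text \<open>Later passes may have overwritten the rows that led to the best value, so they are
  computed once more, now from \<open>vroot\<close>, which need not be a top.\<close>

definition print_prog :: com where
  "print_prog =
    Cond (Minus (Var vbest) (Lit 1))
      (Assign vtop (Var vroot) ;; chain_prog ;;
       Assign vx (Var vtop) ;; Assign vk (Plus (Var vW) (Var vW)) ;;
       While (neq (Var vx) (Var vend)) print_body)
      Skip"

lemma wvars_progs:
  "wvars fill_prog = {vd, vk, vt, vu}" "warrs fill_prog = {arow}"
  "wvars chain_body = {vd, vk, vt, vu, vy, vx, vbest, vroot}" "warrs chain_body = {arow}"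
  "wvars chain_prog = {vend, vu, vd, vy, vx, vk, vt, vbest, vroot}" "warrs chain_prog = {arow}"
  "wvars print_body = {vk, vx}" "warrs print_body = {}"
  "\<not> prints chain_prog"
  by (auto simp: fill_prog_def chain_prog_def chain_body_def update_prog_def print_body_def)

section \<open>Tables of best weights indexed by position\<close>

locale layout = preorder n pp sk for n pp sk +
  fixes xs :: "nat list" and col w :: "nat \<Rightarrow> nat" and W :: nat
  assumes length_xs: "length xs = n" and distinct_xs: "distinct xs" and set_xs: "set xs = {..<n}"
    and hd_xs: "hd xs = 0" and W_def: "W = sum w {..<n}" and W_pos: "0 < W"
begin

definition vert :: "nat \<Rightarrow> nat" where
  "vert j = (xs @ [n]) ! j"

text \<open>The signed weight: a set is balanced iff its sum vanishes.\<close>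

definition \<delta> :: "nat \<Rightarrow> int" where
  "\<delta> j = (if col (vert j) = 0 then int (w (vert j)) else - int (w (vert j)))"

abbreviation wt :: "nat \<Rightarrow> nat" where
  "wt j \<equiv> w (vert j)"

text \<open>What stays fixed during the dynamic programming, translated from vertices to
  positions.\<close>

definition static :: "store \<Rightarrow> bool" where
  "static s \<longleftrightarrow> mem s 0 vn = n \<and> mem s 0 vW = W \<and> mem s 0 vstride = 4 * W + 1 \<and>
    (\<forall>v<n. mem s acol v = col v \<and> mem s awt v = w v) \<and>
    (\<forall>v\<le>n. mem s abase v = v * (4 * W + 1)) \<and>
    (\<forall>j<n. mem s anext (vert j) = vert (Suc j) \<and> mem s aprev (vert (Suc j)) = vert j \<and>
      mem s askip (vert j) = vert (sk j)) \<and>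
    (\<forall>j. 0 < j \<and> j < n \<longrightarrow> mem s apar (vert j) = vert (pp j))"

lemma static_agree:
  assumes "static s" "agree p s s'" "wvars p \<inter> {vn, vW, vstride} = {}"
    "warrs p \<inter> {acol, awt, abase, anext, aprev, askip, apar} = {}"
  shows "static s'"
  using assms(1,3-) agreeD(1,2) [OF assms(2)] by (simp add: static_def)

lemma vert_n: "vert n = n"
  using length_xs by (simp add: vert_def nth_append)

lemma vert_0: "vert 0 = 0"
  using hd_conv_nth [of xs] hd_xs length_xs n_pos by (auto simp: vert_def nth_append)

lemma bij_vert: "bij_betw vert {..<n} {..<n}"
proof -
  have "bij_betw (\<lambda>j. xs ! j) {..<n} {..<n}"
    using bij_betw_nth [OF distinct_xs refl refl] length_xs set_xs by simp
  then show ?thesis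
    by (rule bij_betw_cong [THEN iffD1, rotated]) (simp add: vert_def nth_append length_xs)
qed

lemma vert_less: "j < n \<Longrightarrow> vert j < n"
  using bij_vert by (auto simp: bij_betw_def)

lemma vert_le: "j \<le> n \<Longrightarrow> vert j \<le> n"
  using vert_less vert_n by (cases "j = n") (auto simp: less_imp_le)

lemma vert_eq_iff: "j \<le> n \<Longrightarrow> k \<le> n \<Longrightarrow> vert j = vert k \<longleftrightarrow> j = k"
proof -
  have "distinct (xs @ [n])" using distinct_xs set_xs by simp
  then show "j \<le> n \<Longrightarrow> k \<le> n \<Longrightarrow> vert j = vert k \<longleftrightarrow> j = k"
    by (simp add: vert_def nth_eq_iff_index_eq length_xs)
qed

lemma sum_wt: "sum wt {..<n} = W"
  using sum.reindex_bij_betw [OF bij_vert, of w] W_def by simp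

lemma sum_wt_le:
  assumes "S \<subseteq> {..<n}"
  shows "sum wt S \<le> W"
  using sum_mono2 [of "{..<n}" S wt] assms sum_wt by simp

lemma wt_le: "j < n \<Longrightarrow> wt j \<le> W"
  using sum_wt_le [of "{j}"] by simp

lemma abs_sum_\<delta>_le:
  assumes "S \<subseteq> {..<n}"
  shows "\<bar>sum \<delta> S\<bar> \<le> int W"
proof -
  have "\<bar>sum \<delta> S\<bar> \<le> (\<Sum>j\<in>S. \<bar>\<delta> j\<bar>)" by (rule sum_abs)
  also have "\<dots> = (\<Sum>j\<in>S. int (wt j))" by (rule sum.cong) (auto simp: \<delta>_def)
  also have "\<dots> = int (sum wt S)" by simp
  also have "\<dots> \<le> int W" using sum_wt_le [OF assms] by (simp only: of_nat_le_iff)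
  finally show ?thesis .
qed

definition row :: "store \<Rightarrow> nat \<Rightarrow> nat \<Rightarrow> nat" where
  "row s j i = mem s arow (vert j * (4 * W + 1) + i)"

lemma address_eq_iff:
  assumes "j \<le> n" "k \<le> n" "i \<le> 4 * W" "i' \<le> 4 * W"
  shows "vert j * (4 * W + 1) + i = vert k * (4 * W + 1) + i' \<longleftrightarrow> j = k \<and> i = i'"
proof
  assume *: "vert j * (4 * W + 1) + i = vert k * (4 * W + 1) + i'"
  have "(a * m + b) div m = a" if "b < m" for a b m :: nat using that by simp
  from this [of i "4 * W + 1" "vert j"] this [of i' "4 * W + 1" "vert k"]
  have "vert j = vert k" using * assms(3,4) by simp
  then show "j = k \<and> i = i'" using * assms vert_eq_iff by simp
qed auto

definition row_ok :: "store \<Rightarrow> nat \<Rightarrow> nat \<Rightarrow> bool" where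
  "row_ok s q j \<longleftrightarrow> (\<forall>i\<le>4 * W. is_best \<delta> wt (closed j q) (int i - 2 * int W) (row s j i))"

definition padded :: "store \<Rightarrow> bool" where
  "padded s \<longleftrightarrow> (\<forall>j\<le>n. \<forall>i\<le>4 * W. i < W \<or> 3 * W < i \<longrightarrow> row s j i = 0)"

lemma is_best_far:
  assumes "q \<le> n" "i < W \<or> 3 * W < i"
  shows "is_best \<delta> wt (closed j q) (int i - 2 * int W) 0"
proof (rule is_best_0)
  fix S assume "S \<in> closed j q"
  then have "S \<subseteq> {..<n}" using closedD [of S j q] assms(1) by auto
  then have "\<bar>sum \<delta> S\<bar> \<le> int W" by (rule abs_sum_\<delta>_le)
  then show "sum \<delta> S \<noteq> int i - 2 * int W" using assms(2) by linarith
qed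

text \<open>The index to look up when \<open>j\<close> is taken. From index \<open>W\<close> on the
  truncated subtraction is exact, as no weight exceeds \<open>W\<close>.\<close>

definition shift :: "nat \<Rightarrow> nat \<Rightarrow> nat" where
  "shift j i = (if col (vert j) = 0 then i - wt j else i + wt j)"

lemma shift_int: "j < n \<Longrightarrow> W \<le> i \<Longrightarrow> int (shift j i) = int i - \<delta> j"
  using wt_le [of j] by (simp add: shift_def \<delta>_def of_nat_diff)

lemma shift_le: "j < n \<Longrightarrow> i \<le> 3 * W \<Longrightarrow> shift j i \<le> 4 * W"
  using wt_le [of j] by (auto simp: shift_def intro: le_trans [OF diff_le_self])

definition entry :: "store \<Rightarrow> nat \<Rightarrow> nat \<Rightarrow> nat" where
  "entry s j i = max (row s (sk j) i)
    (if 0 < row s (Suc j) (shift j i) then row s (Suc j) (shift j i) + wt j else 0)"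

lemma entry_take:
  assumes "j < q" "q \<le> n" "W \<le> i" "i \<le> 3 * W" "row_ok s q (Suc j)"
  shows "is_best \<delta> wt (insert j ` closed (Suc j) q) (int i - 2 * int W)
    (if 0 < row s (Suc j) (shift j i) then row s (Suc j) (shift j i) + wt j else 0)"
proof (rule is_best_insert)
  have j: "j < n" using assms by simp
  have "is_best \<delta> wt (closed (Suc j) q) (int (shift j i) - 2 * int W) (row s (Suc j) (shift j i))"
    using assms(5) shift_le [OF j assms(4)] by (simp add: row_ok_def)
  then show "is_best \<delta> wt (closed (Suc j) q) (int i - 2 * int W - \<delta> j) (row s (Suc j) (shift j i))"
    using shift_int [OF j assms(3)] by (simp add: algebra_simps)
  show "finite S \<and> j \<notin> S" if "S \<in> closed (Suc j) q" for S
    using closedD [OF that] finite_subset [of S "{Suc j..<q}"] by auto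
qed

lemma entry_best:
  assumes "j < q" "q \<le> n" "sk j \<le> q" "W \<le> i" "i \<le> 3 * W" "row_ok s q (Suc j)" "row_ok s q (sk j)"
  shows "is_best \<delta> wt (closed j q) (int i - 2 * int W) (entry s j i)"
  unfolding entry_def closed_split [OF assms(1,3,2)]
proof (rule is_best_Un)
  show "is_best \<delta> wt (closed (sk j) q) (int i - 2 * int W) (row s (sk j) i)"
    using assms(5,7) by (simp add: row_ok_def)
qed (rule entry_take [OF assms(1,2,4-6)])

lemma fill_prog_correct:
  assumes s: "static s" "padded s" "mem s 0 vx = vert j" "mem s 0 vy = vert (Suc j)"
    and j: "j < q" "q \<le> n" "sk j \<le> q" and rows: "row_ok s q (Suc j)" "row_ok s q (sk j)"
  shows "wp fill_prog (\<lambda>_ s'. padded s' \<and> row_ok s' q j \<and>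
    (\<forall>k i. k \<le> n \<and> k \<noteq> j \<and> i \<le> 4 * W \<longrightarrow> row s' k i = row s k i)) (1000 * W) s"
proof -
  have jn: "j < n" "sk j \<noteq> j" "sk j \<le> n" using j less_sk [of j] by auto
  \<comment> \<open>The new entries can be expressed by the rows of the initial store, since row
    \<open>j\<close> is written but never read.\<close>
  define I where "I = (\<lambda>d s'. \<forall>k i. k \<le> n \<and> i \<le> 4 * W \<longrightarrow>
    row s' k i = (if k = j \<and> W \<le> i \<and> i < W + d then entry s j i else row s k i))"
  have "wp fill_prog (\<lambda>_ s'. I (2 * W + 1) s' \<and> mem s' 0 vd = 2 * W + 1 \<and> agree fill_prog s s')
      (1000 * W) s"
    unfolding fill_prog_def
  proof (rule wp_For [where t = "\<lambda>_. 250"], goal_cases)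
    case 1
    then show ?case by (auto simp: I_def row_def)
  next
    case (2 s')
    then show ?case using agreeD(1) [OF 2, of vW] s(1) by (simp add: static_def)
  next
    case 3
    then show ?case by simp
  next
    case (4 d s')
    have st: "static s'" using s(1) by (rule static_agree [OF _ 4(4)]) auto
    have v: "mem s' 0 vx = vert j" "mem s' 0 vy = vert (Suc j)"
      using agreeD(1) [OF 4(4)] s(3,4) by simp_all
    have st': "mem s' 0 vW = W" "mem s' acol (vert j) = col (vert j)" "mem s' awt (vert j) = wt j"
      "mem s' abase (vert j) = vert j * (4 * W + 1)"
      "mem s' abase (vert (Suc j)) = vert (Suc j) * (4 * W + 1)"
      "mem s' abase (vert (sk j)) = vert (sk j) * (4 * W + 1)"
      "mem s' askip (vert j) = vert (sk j)"
      using st jn vert_less [of j] vert_le [of j] vert_le [of "Suc j"] vert_le [of "sk j"]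
      by (auto simp: static_def)
    let ?i = "d + W"
    have i: "W \<le> ?i" "?i \<le> 3 * W" "?i \<le> 4 * W" using 4(1) by auto
    have r: "mem s' arow (vert (Suc j) * (4 * W + 1) + shift j ?i) = row s (Suc j) (shift j ?i)"
      "mem s' arow (vert (sk j) * (4 * W + 1) + ?i) = row s (sk j) ?i"
      using 4(2) jn i shift_le [OF jn(1) i(2)] by (auto simp: I_def row_def)
    have fin: "I (Suc d) s''"
      if "mem s'' arow = (mem s' arow)(vert j * (4 * W + 1) + ?i := entry s j ?i)" for s''
      unfolding I_def
    proof (intro allI impI)
      fix k i' assume k: "k \<le> n \<and> i' \<le> 4 * W"
      have "row s'' k i' = (if k = j \<and> i' = ?i then entry s j ?i else row s' k i')"
        using address_eq_iff [of k j i' ?i] k jn(1) i(3) by (auto simp: row_def that)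
      also have "\<dots> = (if k = j \<and> W \<le> i' \<and> i' < W + Suc d then entry s j i' else row s k i')"
        using 4(2) k by (auto simp: I_def)
      finally show "row s'' k i' = \<dots>" .
    qed
    show ?case
      using 4(3) v st' r
      by (cases "col (vert j) = 0"; cases "0 < row s (Suc j) (shift j ?i)")
        (auto simp: fin shift_def entry_def max_def)
  next
    case 5
    then show ?case using W_pos by simp
  qed
  then show ?thesis
  proof (rule wp_spec)
    fix s' assume "I (2 * W + 1) s' \<and> mem s' 0 vd = 2 * W + 1 \<and> agree fill_prog s s'"
    then have I: "\<And>k i. k \<le> n \<Longrightarrow> i \<le> 4 * W \<Longrightarrow>
        row s' k i = (if k = j \<and> W \<le> i \<and> i \<le> 3 * W then entry s j i else row s k i)"
      by (auto simp: I_def)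
    have "padded s'" using s(2) I by (simp add: padded_def)
    moreover have "row_ok s' q j"
      unfolding row_ok_def
    proof (intro allI impI)
      fix i assume i: "i \<le> 4 * W"
      show "is_best \<delta> wt (closed j q) (int i - 2 * int W) (row s' j i)"
      proof (cases "W \<le> i \<and> i \<le> 3 * W")
        case True
        then show ?thesis using entry_best [OF j(1-3) _ _ rows] I jn i by simp
      next
        case False
        then have "row s' j i = 0" using I jn i s(2) by (auto simp: padded_def)
        then show ?thesis using is_best_far [OF j(2), of i j] False by auto
      qed
    qed
    ultimately show "padded s' \<and> row_ok s' q j \<and>
      (\<forall>k i. k \<le> n \<and> k \<noteq> j \<and> i \<le> 4 * W \<longrightarrow> row s' k i = row s k i)"
      using I by simp
  qed simp
qed

lemma row_upd_scalar [simp]: "row (upd 0 x v s) = row s"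
  by (simp add: row_def fun_eq_iff)

lemma row_ok_cong:
  "row_ok s q j \<Longrightarrow> (\<And>i. i \<le> 4 * W \<Longrightarrow> row s' j i = row s j i) \<Longrightarrow> row_ok s' q j"
  by (simp add: row_ok_def)

text \<open>The comparison is strict because \<open>vbest\<close> is one more than a weight. Of a
  best set only the topmost position is remembered, which suffices to reproduce a set of that
  weight.\<close>

definition good :: "nat set \<Rightarrow> store \<Rightarrow> bool" where
  "good T s \<longleftrightarrow> 0 < mem s 0 vbest \<and>
    (\<forall>j\<in>T. \<forall>S\<in>subtrees j. sum \<delta> S = 0 \<longrightarrow> sum wt S < mem s 0 vbest) \<and>
    (1 < mem s 0 vbest \<longrightarrow> (\<exists>j<n. mem s 0 vroot = vert j \<and>
      is_best \<delta> wt (closed j (sk j)) 0 (mem s 0 vbest)))"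

lemma good_cong:
  assumes "good T s" "mem s' 0 vbest = mem s 0 vbest" "mem s' 0 vroot = mem s 0 vroot"
  shows "good T s'"
  using assms by (simp add: good_def)

text \<open>Skipping \<open>j\<close> leaves only the empty set, since the range ends with the block
  of \<open>j\<close>.\<close>

lemma closed_block: "j < n \<Longrightarrow> closed j (sk j) = insert {} (subtrees j)"
  using closed_split [of j "sk j"] less_sk [of j] sk_le [of j]
  by (simp add: closed_empty subtrees_def)

lemma good_insert:
  assumes "good T s" "j < n" "is_best \<delta> wt (closed j (sk j)) 0 r"
    and "mem s' 0 vbest = max (mem s 0 vbest) r"
    and "mem s' 0 vroot = (if mem s 0 vbest < r then vert j else mem s 0 vroot)"
  shows "good (insert j T) s'"
proof -
  have "sum wt S < r" if "S \<in> subtrees j" "sum \<delta> S = 0" for S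
    using assms(3) that closed_block [OF assms(2)] unfolding is_best_def by blast
  moreover have "sum wt S < max (mem s 0 vbest) r"
    if "k \<in> T" "S \<in> subtrees k" "sum \<delta> S = 0" for k S
    using assms(1) that unfolding good_def by (meson less_max_iff_disj)
  ultimately have "\<forall>k\<in>insert j T. \<forall>S\<in>subtrees k. sum \<delta> S = 0 \<longrightarrow> sum wt S < mem s' 0 vbest"
    unfolding assms(4) by (auto simp: less_max_iff_disj)
  moreover have "0 < mem s' 0 vbest" using assms(1,4) by (auto simp: good_def less_max_iff_disj)
  moreover have "\<exists>k<n. mem s' 0 vroot = vert k \<and>
      is_best \<delta> wt (closed k (sk k)) 0 (mem s' 0 vbest)" if "1 < mem s' 0 vbest"
  proof (cases "mem s 0 vbest < r")
    case True
    then show ?thesis using assms(2-5) by (intro exI [of _ j]) simp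
  next
    case False
    then have "mem s' 0 vbest = mem s 0 vbest" "mem s' 0 vroot = mem s 0 vroot"
      using assms(4,5) by simp_all
    then show ?thesis using assms(1) that unfolding good_def by metis
  qed
  ultimately show ?thesis by (simp add: good_def)
qed

text \<open>By \<open>nested\<close> no jump leads beyond \<open>sk t\<close>, so one end serves all
  rows. A row answers for the topmost position \<open>j\<close> if \<open>sk j = sk t\<close>,
  because then its range is the block of \<open>j\<close>.\<close>

lemma chain_prog_correct:
  assumes s: "static s" "padded s" "mem s 0 vtop = vert t" and t: "t < n" and good: "good T s"
  shows "wp chain_prog (\<lambda>_ s'. padded s' \<and> good (T \<union> {j. t \<le> j \<and> j < sk t \<and> sk j = sk t}) s' \<and>
    (\<forall>j. t \<le> j \<and> j \<le> sk t \<longrightarrow> row_ok s' (sk t) j) \<and> mem s' 0 vend = vert (sk t))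
    (3000 * W * (sk t - t)) s"
proof -
  define q where "q = sk t"
  have q: "t < q" "q \<le> n" using less_sk [OF t] sk_le [OF t] by (auto simp: q_def)
  let ?B = "4 * W + 1"
  let ?L = "For vd (Var vstride) (Put arow (Plus (Var vu) (Var vd)) (Lit 0))"
  let ?W = "While (neq (Var vy) (Var vtop)) chain_body"
  let ?s1 = "upd 0 vu (vert q * ?B) (upd 0 vend (vert q) s)"
  \<comment> \<open>\<open>j\<close> is the position whose row was filled last and \<open>m\<close>
    the number of positions left.\<close>
  define I where "I = (\<lambda>m s'. \<exists>j. t \<le> j \<and> j \<le> q \<and> m = j - t \<and> mem s' 0 vy = vert j \<and> padded s' \<and>
    (\<forall>k. j \<le> k \<and> k \<le> q \<longrightarrow> row_ok s' q k) \<and> good (T \<union> {k. j \<le> k \<and> k < q \<and> sk k = q}) s')"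
  define J where "J = (\<lambda>d s'. \<forall>k i. k \<le> n \<and> i \<le> 4 * W \<longrightarrow>
    row s' k i = (if k = q \<and> i < d then 0 else row s k i))"
  have W: "wp ?W (\<lambda>_ s'. aval (neq (Var vy) (Var vtop)) (mem s') = 0 \<and> (\<exists>k'. I k' s'))
      ((q - t) * (1300 * W + 15 + 3) + 15 + 3) s0"
    if s0: "I (q - t) s0" "static s0" "mem s0 0 vtop = vert t" "mem s0 0 vend = vert q" for s0
  proof (rule wp_While [where s0 = s0 and t = "1300 * W" and I = I and k = "q - t"])
    show "I (q - t) s0" "agree ?W s0 s0" using s0(1) by (simp_all add: agree_refl)
  next
    fix m s' assume 3: "I m s'" "agree ?W s0 s'" "aval (neq (Var vy) (Var vtop)) (mem s') > 0"
    have st: "static s'" using s0(2)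
      by (rule static_agree [OF _ 3(2)]) (auto simp: wvars_progs)
    have v: "mem s' 0 vtop = vert t" "mem s' 0 vend = vert q"
      using agreeD(1) [OF 3(2)] s0(3,4) by (simp_all add: wvars_progs)
    obtain j' where j': "t \<le> j'" "j' \<le> q" "m = j' - t" "mem s' 0 vy = vert j'" "padded s'"
      "\<And>k. j' \<le> k \<Longrightarrow> k \<le> q \<Longrightarrow> row_ok s' q k"
      "good (T \<union> {k. j' \<le> k \<and> k < q \<and> sk k = q}) s'"
      using 3(1) unfolding I_def by blast
    have "vert j' \<noteq> vert t" using 3(3) j'(4) v(1) by auto
    then have "t < j'" using j'(1) by (cases "t = j'") auto
    then obtain j where j: "j' = Suc j" "t \<le> j" by (cases j') auto
    then have jq: "j < q" "j < n" using j'(2) q by auto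
    have skj: "j < sk j" "sk j \<le> q"
    proof -
      show "j < sk j" by (rule less_sk [OF jq(2)])
      show "sk j \<le> q"
        using nested [of t j] t j(2) jq unfolding q_def by simp
    qed
    have prev: "mem s' aprev (vert (Suc j)) = vert j" using st jq by (simp add: static_def)
    let ?s2 = "upd 0 vx (vert j) s'"
    have st2: "static ?s2" using st by (simp add: static_def)
    have fill: "wp fill_prog (\<lambda>_ s''. padded s'' \<and> row_ok s'' q j \<and>
      (\<forall>k i. k \<le> n \<and> k \<noteq> j \<and> i \<le> 4 * W \<longrightarrow> row s'' k i = row ?s2 k i)) (1000 * W) ?s2"
    proof (rule fill_prog_correct [OF st2])
      show "padded ?s2" using j'(5) by (simp add: padded_def)
      show "row_ok ?s2 q (Suc j)" "row_ok ?s2 q (sk j)"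
        using j'(6) [of "Suc j"] j'(6) [of "sk j"] j(1) j'(2) skj by (auto simp: row_ok_def)
    qed (use j'(4) j(1) jq skj q in auto)
    let ?rest = "update_prog ;; Assign vy (Var vx)"
    have "wp fill_prog (wp ?rest (\<lambda>_ s'. \<exists>k'<m. I k' s')) (1300 * W - 11) ?s2"
    proof (rule wp_spec [OF wp_frame [OF fill]])
      fix U s3 assume U: "1300 * W - 11 - 1000 * W \<le> U"
        and s3: "(padded s3 \<and> row_ok s3 q j \<and>
          (\<forall>k i. k \<le> n \<and> k \<noteq> j \<and> i \<le> 4 * W \<longrightarrow> row s3 k i = row ?s2 k i)) \<and>
          agree fill_prog ?s2 s3"
      have U': "200 \<le> U" using U W_pos by linarith
      have ag: "agree fill_prog ?s2 s3" using s3 by blast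
      have st3: "static s3" using st2
        by (rule static_agree [OF _ ag]) (auto simp: wvars_progs)
      have v3: "mem s3 0 vx = vert j" "mem s3 0 vend = vert q" "mem s3 0 vbest = mem s' 0 vbest"
          "mem s3 0 vroot = mem s' 0 vroot"
        using agreeD(1) [OF ag] v by (simp_all add: wvars_progs)
      have st3': "mem s3 0 vW = W" "mem s3 askip (vert j) = vert (sk j)"
          "mem s3 abase (vert j) = vert j * (4 * W + 1)"
        using st3 jq vert_le [of j] by (simp_all add: static_def)
      have rows: "row_ok s3 q k" if "j \<le> k" "k \<le> q" for k
      proof (cases "k = j")
        case False
        then have "row_ok s' q k" using that j(1) j'(6) by simp
        then show ?thesis by (rule row_ok_cong) (use s3 False that q in simp)
      qed (use s3 in simp)
      have eq: "vert (sk j) = vert q \<longleftrightarrow> sk j = q" using skj q by (intro vert_eq_iff) auto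
      have r0: "mem s3 arow (vert j * (4 * W + 1) + (W + W)) = row s3 j (2 * W)"
        by (simp only: row_def mult_2)
      have fin: "\<exists>k'<m. I k' s4"
        if "mem s4 0 vy = vert j" "mem s4 arow = mem s3 arow"
          "good (T \<union> {k. j \<le> k \<and> k < q \<and> sk k = q}) s4" for s4
      proof -
        have "row s4 = row s3" using that(2) by (simp add: row_def fun_eq_iff)
        then have "padded s4" "\<forall>k. j \<le> k \<and> k \<le> q \<longrightarrow> row_ok s4 q k"
          using s3 rows by (auto simp: padded_def row_ok_def)
        then have "I (j - t) s4" unfolding I_def using that(1,3) j(2) jq by auto
        moreover have "j - t < m" using j'(3) j by simp
        ultimately show ?thesis by blast
      qed
      show "wp ?rest (\<lambda>_ s'. \<exists>k'<m. I k' s') U s3"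
      proof (cases "sk j = q")
        case False
        then have "{k. j \<le> k \<and> k < q \<and> sk k = q} = {k. j' \<le> k \<and> k < q \<and> sk k = q}"
          using j(1) by (auto simp: Suc_le_eq le_less)
        then have "good (T \<union> {k. j \<le> k \<and> k < q \<and> sk k = q}) s4"
          if "mem s4 0 vbest = mem s' 0 vbest" "mem s4 0 vroot = mem s' 0 vroot" for s4
          using good_cong [OF j'(7) that] by simp
        then show ?thesis
          using False eq v3 st3' U' by (auto intro!: fin simp: update_prog_def)
      next
        case True
        let ?r = "row s3 j (2 * W)"
        have best: "is_best \<delta> wt (closed j (sk j)) 0 ?r"
          using rows [of j] jq True by (auto simp: row_ok_def dest: spec [of _ "2 * W"])
        have "{k. j \<le> k \<and> k < q \<and> sk k = q} = insert j {k. j' \<le> k \<and> k < q \<and> sk k = q}"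
          using j(1) jq True by (auto simp: Suc_le_eq le_less)
        then have "good (T \<union> {k. j \<le> k \<and> k < q \<and> sk k = q}) s4"
          if "mem s4 0 vbest = max (mem s' 0 vbest) ?r"
            "mem s4 0 vroot = (if mem s' 0 vbest < ?r then vert j else mem s' 0 vroot)" for s4
          using good_insert [OF j'(7) jq(2) best that] by simp
        then show ?thesis
          using True eq v3 st3' r0 U'
          by (cases "mem s' 0 vbest < ?r") (auto intro!: fin simp: max_def update_prog_def)
      qed
    qed (use W_pos in linarith)
    moreover define U where "U = 1300 * W"
    moreover have "11 \<le> U" using W_pos by (simp add: U_def)
    ultimately show "wp chain_body (\<lambda>_ s'. \<exists>k'<m. I k' s') (1300 * W) s'"
      unfolding chain_body_def wp_Seq U_def [symmetric] using j'(4) j(1) prev by simp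
  qed simp
  have L: "wp ?L (\<lambda>_ s'. J ?B s' \<and> mem s' 0 vd = ?B \<and> agree ?L ?s1 s') (300 * W) ?s1"
  proof (rule wp_For [where t = "\<lambda>_. 13"], goal_cases)
    case 1
    then show ?case by (simp add: J_def)
  next
    case (2 s')
    then show ?case using agreeD(1) [OF 2, of vstride] s(1) by (simp add: static_def)
  next
    case 3
    then show ?case by simp
  next
    case (4 d s')
    have u: "mem s' 0 vu = vert q * ?B" using agreeD(1) [OF 4(4), of vu] by simp
    have "J (Suc d) s''" if "mem s'' arow = (mem s' arow)(vert q * ?B + d := 0)" for s''
      unfolding J_def
    proof (intro allI impI)
      fix k i assume k: "k \<le> n \<and> i \<le> 4 * W"
      have "row s'' k i = (if k = q \<and> i = d then 0 else row s' k i)"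
        using address_eq_iff [of k q i d] k q(2) 4(1) by (auto simp: row_def that)
      then show "row s'' k i = (if k = q \<and> i < Suc d then 0 else row s k i)"
        using 4(2) k by (auto simp: J_def)
    qed
    then show ?case using 4(3) u by simp
  next
    case 5
    then show ?case using W_pos by simp
  qed
  define T1 where "T1 = 3000 * W * (q - t)"
  \<comment> \<open>The block is not empty and \<open>W\<close> is positive, so the slack in one
    share of the right side pays for clearing the row at the end.\<close>
  have T1: "(q - t) * (1300 * W + 15 + 3) + 15 + 3 + (300 * W + 200) \<le> T1"
  proof -
    obtain l where l: "q - t = Suc l" using q(1) by (cases "q - t") auto
    obtain W' where W': "W = Suc W'" using W_pos by (cases W) auto
    show ?thesis unfolding T1_def l W' by (simp add: algebra_simps)
  qed
  have T1': "300 * W + 200 \<le> T1" using T1 by linarith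
  let ?Q = "\<lambda>_ s'. padded s' \<and> good (T \<union> {j. t \<le> j \<and> j < q \<and> sk j = q}) s' \<and>
    (\<forall>j. t \<le> j \<and> j \<le> q \<longrightarrow> row_ok s' q j) \<and> mem s' 0 vend = vert q"
  have "wp ?L (wp (Put arow (Plus (Var vu) (Plus (Var vW) (Var vW))) (Lit 1) ;;
    Assign vy (Var vend) ;; ?W) ?Q) (T1 - 22) ?s1"
  proof (rule wp_spec [OF L])
    fix U s2 assume U: "T1 - 22 - 300 * W \<le> U"
      and s2: "J ?B s2 \<and> mem s2 0 vd = ?B \<and> agree ?L ?s1 s2"
    have ag: "agree ?L ?s1 s2" using s2 by blast
    have st2: "static s2"
    proof -
      have "static ?s1" using s(1) by (simp add: static_def)
      then show ?thesis by (rule static_agree [OF _ ag]) auto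
    qed
    have v2: "mem s2 0 vu = vert q * ?B" "mem s2 0 vend = vert q" "mem s2 0 vtop = vert t"
        "mem s2 0 vbest = mem s 0 vbest" "mem s2 0 vroot = mem s 0 vroot" "mem s2 0 vW = W"
      using agreeD(1) [OF ag] s(1,3) by (simp_all add: static_def)
    let ?s3 = "upd 0 vy (vert q) (upd arow (vert q * ?B + (W + W)) 1 s2)"
    have st3: "static ?s3" using st2 by (simp add: static_def)
    have row3: "row ?s3 k i = (if k = q then if i = 2 * W then 1 else 0 else row s k i)"
      if "k \<le> n" "i \<le> 4 * W" for k i
    proof -
      have "row ?s3 k i = (if k = q \<and> i = W + W then 1 else row s2 k i)"
        using address_eq_iff [of k q i "W + W"] that q(2) by (auto simp: row_def)
      then show ?thesis using s2 that by (auto simp: J_def)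
    qed
    have "I (q - t) ?s3"
      unfolding I_def
    proof (intro exI [of _ q] conjI allI impI)
      show "padded ?s3" using s(2) row3 by (auto simp: padded_def)
      show "good (T \<union> {k. q \<le> k \<and> k < q \<and> sk k = q}) ?s3"
        using good v2 by (auto simp: good_def)
      show "row_ok ?s3 q k" if "q \<le> k \<and> k \<le> q" for k
      proof -
        have k: "k = q" using that by simp
        have "is_best \<delta> wt (closed q q) (int i - 2 * int W) (row ?s3 q i)" if "i \<le> 4 * W" for i
          using is_best_empty [of \<delta> wt "int i - 2 * int W"] row3 [OF q(2) that]
          by (auto simp: closed_empty split: if_splits)
        then show ?thesis by (simp add: row_ok_def k)
      qed
    qed (use q in auto)
    then have "wp ?W ?Q (U - 20) ?s3"
    proof (rule wp_spec [OF wp_frame [OF W [OF _ st3]]])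
      show "mem ?s3 0 vtop = vert t" "mem ?s3 0 vend = vert q" using v2 by simp_all
      show "(q - t) * (1300 * W + 15 + 3) + 15 + 3 \<le> U - 20" using U T1 by linarith
    next
      fix s' assume s': "(aval (neq (Var vy) (Var vtop)) (mem s') = 0 \<and> (\<exists>k'. I k' s')) \<and>
        agree ?W ?s3 s'"
      then obtain j where j: "t \<le> j" "mem s' 0 vy = vert j" "j \<le> q" "padded s'"
        "\<forall>k. j \<le> k \<and> k \<le> q \<longrightarrow> row_ok s' q k" "good (T \<union> {k. j \<le> k \<and> k < q \<and> sk k = q}) s'"
        unfolding I_def by blast
      have v: "mem s' 0 vtop = vert t" "mem s' 0 vend = vert q"
        using agreeD(1) [OF conjunct2 [OF s']] v2 by (simp_all add: wvars_progs)
      have "vert j = vert t" using s' j(2) v(1) by simp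
      then have "j = t" using vert_eq_iff [of j t] j(3) q by simp
      then show "?Q 0 s'" using j v by simp
    qed
    moreover have "20 \<le> U" using U T1 by linarith
    ultimately show "wp (Put arow (Plus (Var vu) (Plus (Var vW) (Var vW))) (Lit 1) ;;
      Assign vy (Var vend) ;; ?W) ?Q U s2"
      using v2 by simp
  qed (use T1 in linarith)
  moreover have "24 \<le> T1" using T1' by linarith
  moreover have "mem s askip (vert t) = vert q" "mem s abase (vert q) = vert q * (4 * W + 1)"
    using s(1) t q vert_le [of q] by (simp_all add: static_def q_def)
  ultimately show ?thesis
    unfolding chain_prog_def wp_Seq q_def [symmetric] T1_def [symmetric]
    using s(3) by simp
qed

text \<open>The loop of \<open>solve_prog\<close> runs over vertices, whereas passes are indexed by
  positions; the bijection \<open>vert\<close> carries one sum to the other.\<close>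

lemma sum_tops_vert:
  "(\<Sum>k<n. 100 + (if \<exists>t. top t \<and> vert t = k then f (THE t. top t \<and> vert t = k) else 0)) =
    100 * n + (\<Sum>t | top t. f t :: nat)"
proof -
  let ?f = "\<lambda>k. if \<exists>t. top t \<and> vert t = k then f (THE t. top t \<and> vert t = k) else 0"
  have the: "(THE t'. top t' \<and> vert t' = vert t) = t" if "top t" for t
    using that vert_eq_iff by (intro the_equality) (auto simp: top_def)
  have "(\<Sum>k<n. ?f k) = (\<Sum>j<n. ?f (vert j))"
    using sum.reindex_bij_betw [OF bij_vert, of ?f] by simp
  also have "\<dots> = (\<Sum>j<n. if top j then f j else 0)"
  proof (rule sum.cong)
    fix j assume "j \<in> {..<n}"
    then have "(\<exists>t. top t \<and> vert t = vert j) \<longleftrightarrow> top j"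
      using vert_eq_iff by (auto simp: top_def)
    then show "?f (vert j) = (if top j then f j else 0)" using the by simp
  qed simp
  also have "\<dots> = sum f {t. top t}"
    by (subst sum.inter_filter [symmetric]) (auto simp: top_def intro: sum.cong)
  finally show ?thesis by (simp add: sum.distrib)
qed

definition chain_time :: nat where
  "chain_time = 3000 * W * (\<Sum>t | top t. sk t - t)"

lemma solve_prog_correct:
  assumes s: "static s" "padded s"
  shows "wp solve_prog (\<lambda>_ s'. padded s' \<and> good {..<n} s') (300 * n + chain_time) s"
proof -
  let ?c = "Plus (Minus (Lit 1) (Var vi))
          (neq (Arr askip (Var vi)) (Arr askip (Arr apar (Var vi))))"
  let ?B = "Cond ?c (Assign vtop (Var vi) ;; chain_prog) Skip"
  let ?L = "For vi (Var vn) ?B"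
  let ?s = "upd 0 vbest 1 s"
  \<comment> \<open>The topmost positions settled before round \<open>k\<close>: the members of
    chains whose top vertex is below \<open>k\<close>.\<close>
  define D where "D = (\<lambda>k. {j. \<exists>t. vert t < k \<and> top t \<and> t \<le> j \<and> j < sk t \<and> sk j = sk t})"
  define I where "I = (\<lambda>k s'. padded s' \<and> good (D k) s')"
  define \<tau> where "\<tau> = (\<lambda>k. 100 + (if \<exists>t. top t \<and> vert t = k
    then (\<lambda>t. 3000 * W * (sk t - t)) (THE t. top t \<and> vert t = k) else 0))"
  have st: "static s'" if "agree ?L ?s s'" for s'
  proof -
    have "static ?s" using s(1) by (simp add: static_def)
    then show ?thesis by (rule static_agree [OF _ that]) (auto simp: wvars_progs)
  qed
  have sum: "(\<Sum>k<n. \<tau> k) = 100 * n + chain_time"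
    using sum_tops_vert [of "\<lambda>t. 3000 * W * (sk t - t)"]
    by (simp only: \<tau>_def chain_time_def sum_distrib_left)
  have "wp ?L (\<lambda>_ s'. I n s' \<and> mem s' 0 vi = n \<and> agree ?L ?s s') (300 * n + chain_time - 3) ?s"
  proof (rule wp_For [where t = \<tau>])
    have "padded (upd 0 vi 0 ?s)" using s(2) by (simp add: padded_def)
    moreover have "good (D 0) (upd 0 vi 0 ?s)" by (simp add: good_def D_def)
    ultimately show "I 0 (upd 0 vi 0 ?s)" by (simp add: I_def)
  next
    show "aval (Var vn) (mem s') = n" if "agree ?L ?s s'" for s'
      using st [OF that] by (simp add: static_def)
  next
    show "vi \<notin> wvars ?B" by (simp add: wvars_progs)
  next
    fix k s' assume k: "k < n" "I k s'" "mem s' 0 vi = k" "agree ?L ?s s'"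
    obtain j where j: "j < n" "vert j = k"
      using bij_vert k(1) by (metis bij_betw_def imageE lessThan_iff)
    note st' = st [OF k(4)]
    have D: "D (Suc k) = D k \<union> (if top j then {i. j \<le> i \<and> i < sk j \<and> sk i = sk j} else {})"
    proof -
      have "vert t = k \<longleftrightarrow> t = j" if "top t" for t
        using that j vert_eq_iff [of t j] by (auto simp: top_def)
      then show ?thesis unfolding D_def by (auto simp: less_Suc_eq)
    qed
    have cond: "aval ?c (mem s') > 0 \<longleftrightarrow> top j"
    proof (cases "j = 0")
      case True
      then show ?thesis using j k(3) vert_0 n_pos by (simp add: top_def)
    next
      case False
      then have "k \<noteq> 0" using j vert_eq_iff [of j 0] vert_0 by auto
      have p: "pp j < n" using pp_less [of j] False j by simp
      have "mem s' apar k = vert (pp j)" "mem s' askip k = vert (sk j)"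
        "mem s' askip (vert (pp j)) = vert (sk (pp j))"
        using st' False j p by (auto simp: static_def)
      moreover have "vert (sk j) = vert (sk (pp j)) \<longleftrightarrow> sk j = sk (pp j)"
        using vert_eq_iff sk_le j p by simp
      ultimately show ?thesis using False \<open>k \<noteq> 0\<close> k(3) j(1) by (auto simp: top_def)
    qed
    show "wp ?B (\<lambda>_ s'. I (Suc k) (upd 0 vi (Suc k) s')) (\<tau> k) s'"
    proof (cases "top j")
      case True
      have "(THE t. top t \<and> vert t = k) = j"
        using True j vert_eq_iff by (intro the_equality) (auto simp: top_def)
      then have \<tau>: "\<tau> k = 100 + 3000 * W * (sk j - j)" using True j by (auto simp: \<tau>_def)
      let ?s2 = "upd 0 vtop k s'"
      have "static ?s2" using st' by (simp add: static_def)
      moreover have "padded ?s2" "good (D k) ?s2"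
        using k(2) by (auto simp: I_def padded_def good_def)
      ultimately have *: "wp chain_prog (\<lambda>_ s'. I (Suc k) (upd 0 vi (Suc k) s')) T ?s2"
        if "\<tau> k - 80 \<le> T" for T
        by (intro wp_spec [OF chain_prog_correct [where t = j and T = "D k"]])
          (use j True that in \<open>auto simp: \<tau> I_def D padded_def elim: good_cong\<close>)
      show ?thesis using cond True k(3) \<tau> by (simp add: *)
    next
      case False
      then have "I (Suc k) (upd 0 vi (Suc k) s')"
        using k(2) D by (auto simp: I_def padded_def elim: good_cong)
      moreover have "100 \<le> \<tau> k" by (simp add: \<tau>_def)
      ultimately show ?thesis using cond False by simp
    qed
  next
    show "(\<Sum>k<n. \<tau> k + alen (Var vn) + 20) + alen (Var vn) + 20 \<le> 300 * n + chain_time - 3"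
      using n_pos sum by (simp add: sum.distrib)
  qed
  then have "wp ?L (\<lambda>_ s'. padded s' \<and> good {..<n} s') (300 * n + chain_time - 3) ?s"
  proof (rule wp_spec)
    fix s' assume "I n s' \<and> mem s' 0 vi = n \<and> agree ?L ?s s'"
    then have I: "padded s'" "good (D n) s'" by (auto simp: I_def)
    have "j \<in> D n" if j: "j < n" for j
    proof -
      obtain t where "t \<le> j" "top t" "sk t = sk j" using top_exists [OF j] by blast
      moreover from this have "vert t < n" using j by (intro vert_less) simp
      ultimately show ?thesis
        unfolding D_def using less_sk [OF j] by (intro CollectI exI [of _ t]) simp
    qed
    then have "{..<n} \<subseteq> D n" by auto
    with I show "padded s' \<and> good {..<n} s'" by (auto simp: good_def)
  qed simp
  moreover define T where "T = 300 * n + chain_time"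
  moreover have "3 \<le> T" using n_pos by (simp add: T_def)
  ultimately show ?thesis unfolding solve_prog_def wp_Seq by (simp add: numeral_3_eq_3)
qed

text \<open>Both sides are best for the same difference, so they coincide. This recovers the
  recurrence from \<open>row_ok\<close> without a record of how the rows arose. The padding places
  the index of a positive entry between \<open>W\<close> and \<open>3 * W\<close>.\<close>

lemma row_eq_entry:
  assumes "padded s" "j < q" "q \<le> n" "sk j \<le> q" "row_ok s q j" "row_ok s q (Suc j)" "row_ok s q (sk j)"
    and "0 < row s j k" "k \<le> 4 * W"
  shows "row s j k = entry s j k" "W \<le> k" "k \<le> 3 * W"
proof -
  show k: "W \<le> k" "k \<le> 3 * W"
    using assms(1,2,3,8,9) unfolding padded_def by (metis leI less_irrefl less_imp_le order_less_le_trans)+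
  have "is_best \<delta> wt (closed j q) (int k - 2 * int W) (row s j k)"
    using assms(5,9) by (simp add: row_ok_def)
  then show "row s j k = entry s j k"
    using entry_best [OF assms(2,3,4) k assms(6,7)] by (rule is_best_unique)
qed

lemma closed_skip: "j < q \<Longrightarrow> sk j \<le> q \<Longrightarrow> q \<le> n \<Longrightarrow> S \<in> closed (sk j) q \<Longrightarrow> S \<in> closed j q"
  using closed_split by blast

lemma closed_take: "j < q \<Longrightarrow> sk j \<le> q \<Longrightarrow> q \<le> n \<Longrightarrow> S \<in> closed (Suc j) q \<Longrightarrow> insert j S \<in> closed j q"
  using closed_split by blast

lemma print_prog_correct:
  assumes s: "static s" "padded s" "good {..<n} s"
  shows "wp print_prog (\<lambda>_ s'. \<exists>P vs. outs s' = outs s @ vs \<and> distinct vs \<and> set vs = vert ` P \<and>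
    P \<subseteq> {..<n} \<and> (P = {} \<or> (\<exists>t<n. P \<in> subtrees t)) \<and> sum \<delta> P = 0 \<and>
    (\<forall>j<n. \<forall>S\<in>subtrees j. sum \<delta> S = 0 \<longrightarrow> sum wt S \<le> sum wt P)) (5000 * W * n) s"
    (is "wp _ (\<lambda>_. ?Q) _ _")
proof (cases "1 < mem s 0 vbest")
  case False
  \<comment> \<open>No balanced connected set has positive weight, so nothing is printed.\<close>
  then have "mem s 0 vbest = 1" using s(3) by (auto simp: good_def)
  then have "?Q s"
    using s(3) by (intro exI [of _ "{}"] exI [of _ "[]"]) (auto simp: good_def)
  moreover have "0 < W * n" using W_pos n_pos by simp
  then have "9 \<le> 5000 * W * n" by (cases W; cases n) simp_all
  ultimately show ?thesis using False by (simp add: print_prog_def)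
next
  case True
  then obtain t where t: "t < n" "mem s 0 vroot = vert t"
      "is_best \<delta> wt (closed t (sk t)) 0 (mem s 0 vbest)"
    using s(3) by (auto simp: good_def)
  define best where "best = mem s 0 vbest"
  define q where "q = sk t"
  have q: "t < q" "q \<le> n" using less_sk [OF t(1)] sk_le [OF t(1)] by (auto simp: q_def)
  let ?W = "While (neq (Var vx) (Var vend)) print_body"
  have loop: "wp ?W (\<lambda>_. ?Q) (500 * n) s1"
    if s1: "static s1" "padded s1" "\<And>j. t \<le> j \<Longrightarrow> j \<le> q \<Longrightarrow> row_ok s1 q j"
      "mem s1 0 vend = vert q" "mem s1 0 vx = vert t" "mem s1 0 vk = 2 * W" "outs s1 = outs s"
    for s1
  proof -
    \<comment> \<open>\<open>P\<close> is the part chosen before \<open>j\<close>, and any closed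
      set from \<open>j\<close> on completes it. The difference that the rest has to contribute is
      encoded by \<open>vk\<close>; the current entry is the weight still to come, plus one.\<close>
    define I where "I = (\<lambda>m (s' :: store). \<exists>j P vs. t \<le> j \<and> j \<le> q \<and> m = q - j \<and> mem s' 0 vx = vert j \<and>
      P \<subseteq> {t..<j} \<and> (\<forall>S\<in>closed j q. P \<union> S \<in> closed t q) \<and> mem s' 0 vk \<le> 4 * W \<and>
      sum \<delta> P + (int (mem s' 0 vk) - 2 * int W) = 0 \<and> 0 < row s1 j (mem s' 0 vk) \<and>
      sum wt P + row s1 j (mem s' 0 vk) = best \<and>
      outs s' = outs s @ vs \<and> distinct vs \<and> set vs = vert ` P)"
    have "is_best \<delta> wt (closed t q) 0 (row s1 t (2 * W))"
      using s1(3) [of t] q by (auto simp: row_ok_def dest: spec [of _ "2 * W"])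
    then have best: "row s1 t (2 * W) = best"
      using t(3) unfolding q_def best_def by (rule is_best_unique)
    have "wp ?W (\<lambda>_ s'. aval (neq (Var vx) (Var vend)) (mem s') = 0 \<and> (\<exists>k'. I k' s'))
        ((q - t) * (200 + 15 + 3) + 15 + 3) s1"
    proof (rule wp_While [where s0 = s1 and t = 200 and I = I and k = "q - t"])
      show "I (q - t) s1"
        unfolding I_def using q s1(4-) best True
        by (intro exI [of _ t] exI [of _ "{}"] exI [of _ "[]"]) (auto simp: best_def)
      show "agree ?W s1 s1" by (rule agree_refl)
    next
      fix m s' assume 3: "I m s'" "agree ?W s1 s'" "aval (neq (Var vx) (Var vend)) (mem s') > 0"
      obtain j P vs where j: "t \<le> j" "j \<le> q" "m = q - j" "mem s' 0 vx = vert j"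
        and P: "P \<subseteq> {t..<j}" "\<And>S. S \<in> closed j q \<Longrightarrow> P \<union> S \<in> closed t q"
        and k: "mem s' 0 vk \<le> 4 * W" "sum \<delta> P + (int (mem s' 0 vk) - 2 * int W) = 0"
          "0 < row s1 j (mem s' 0 vk)" "sum wt P + row s1 j (mem s' 0 vk) = best"
        and vs: "outs s' = outs s @ vs" "distinct vs" "set vs = vert ` P"
        using 3(1) unfolding I_def by blast
      have st: "static s'" using s1(1)
        by (rule static_agree [OF _ 3(2)]) (auto simp: wvars_progs)
      have v: "mem s' 0 vend = vert q" "mem s' arow = mem s1 arow"
        using agreeD(1,2) [OF 3(2)] s1(4) by (simp_all add: wvars_progs)
      have "j \<noteq> q" using 3(3) j(4) v(1) by auto
      then have jq: "j < q" "j < n" using j(2) q by auto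
      have skj: "j < sk j" "sk j \<le> q"
        using less_sk [OF jq(2)] nested [of t j] t(1) j(1) jq unfolding q_def by simp_all
      let ?k = "mem s' 0 vk"
      note ent = row_eq_entry [OF s1(2) jq(1) q(2) skj(2) s1(3) s1(3) s1(3) k(3,1)]
      have ent: "row s1 j ?k = entry s1 j ?k" "W \<le> ?k" "?k \<le> 3 * W"
        using ent j jq skj by simp_all
      have st': "mem s' acol (vert j) = col (vert j)" "mem s' awt (vert j) = wt j"
        "mem s' abase (vert j) = vert j * (4 * W + 1)"
        "mem s' abase (vert (sk j)) = vert (sk j) * (4 * W + 1)"
        "mem s' askip (vert j) = vert (sk j)" "mem s' anext (vert j) = vert (Suc j)"
        using st jq vert_less [of j] vert_le [of j] vert_le [of "sk j"] skj q
        by (auto simp: static_def)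
      have r: "mem s1 arow (vert j * (4 * W + 1) + ?k) = row s1 j ?k"
        "mem s1 arow (vert (sk j) * (4 * W + 1) + ?k) = row s1 (sk j) ?k"
        by (simp_all add: row_def)
      show "wp print_body (\<lambda>_ s'. \<exists>k'<m. I k' s') 200 s'"
      proof (cases "row s1 (sk j) ?k < row s1 j ?k")
        case False
        \<comment> \<open>An entry is never below the one for skipping, so here skipping loses
          nothing.\<close>
        then have eq: "row s1 (sk j) ?k = row s1 j ?k" using ent(1) by (simp add: entry_def)
        have "I (q - sk j) (upd 0 vx (vert (sk j)) s')"
          unfolding I_def using j P k vs skj eq closed_skip [OF jq(1) skj(2) q(2)]
          by (intro exI [of _ "sk j"] exI [of _ P] exI [of _ vs]) auto
        moreover have "q - sk j < m" using j skj by simp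
        ultimately show ?thesis using False j(4) st' r v by (auto simp: print_body_def)
      next
        case True
        let ?k' = "shift j ?k"
        have r': "row s1 j ?k = row s1 (Suc j) ?k' + wt j" "0 < row s1 (Suc j) ?k'"
          using True ent(1) by (auto simp: entry_def max_def split: if_splits)
        have jP: "j \<notin> P" "finite P" using P(1) finite_subset by auto
        have "I (q - Suc j) s4"
          if "mem s4 0 vx = vert (Suc j)" "mem s4 0 vk = ?k'" "outs s4 = outs s' @ [vert j]" for s4
          unfolding I_def that
        proof (intro exI [of _ "Suc j"] exI [of _ "insert j P"] exI [of _ "vs @ [vert j]"] conjI)
          show "\<forall>S\<in>closed (Suc j) q. insert j P \<union> S \<in> closed t q"
            using P(2) closed_take [OF jq(1) skj(2) q(2)] by fastforce
          show "?k' \<le> 4 * W" by (rule shift_le [OF jq(2) ent(3)])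
          show "sum \<delta> (insert j P) + (int ?k' - 2 * int W) = 0"
            using shift_int [OF jq(2) ent(2)] k(2) jP by simp
          show "sum wt (insert j P) + row s1 (Suc j) ?k' = best" using k(4) r'(1) jP by simp
          have "vert j \<notin> vert ` P" using P(1) vert_eq_iff jq by fastforce
          then show "distinct (vs @ [vert j])" using vs by simp
        qed (use j jq P(1) vs r' in auto)
        moreover have "q - Suc j < m" using j jq by simp
        ultimately show ?thesis
          using True j(4) st' r v by (cases "col (vert j) = 0") (auto simp: print_body_def shift_def)
      qed
    qed simp
    then show ?thesis
    proof (rule wp_spec [OF wp_frame])
      have "q - t \<le> n" using q by simp
      then have "(q - t) * (200 + 15 + 3) \<le> n * 218" by simp
      then show "(q - t) * (200 + 15 + 3) + 15 + 3 \<le> 500 * n" using n_pos by linarith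
    next
      fix s' assume s': "(aval (neq (Var vx) (Var vend)) (mem s') = 0 \<and> (\<exists>k'. I k' s')) \<and> agree ?W s1 s'"
      then obtain j P vs where j: "t \<le> j" "j \<le> q" "mem s' 0 vx = vert j"
        and P: "P \<subseteq> {t..<j}" "\<And>S. S \<in> closed j q \<Longrightarrow> P \<union> S \<in> closed t q"
        and k: "mem s' 0 vk \<le> 4 * W" "sum \<delta> P + (int (mem s' 0 vk) - 2 * int W) = 0"
          "0 < row s1 j (mem s' 0 vk)" "sum wt P + row s1 j (mem s' 0 vk) = best"
        and vs: "outs s' = outs s @ vs" "distinct vs" "set vs = vert ` P"
        unfolding I_def by blast
      have "mem s' 0 vend = vert q" using agreeD(1) [OF conjunct2 [OF s'], of vend] s1(4)
        by (simp add: wvars_progs)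
      then have "vert j = vert q" using s' j(3) by simp
      then have jq: "j = q" using vert_eq_iff j(2) q by simp
      \<comment> \<open>At the end only the empty set is left, so a positive entry forces difference
        0 and the value 1.\<close>
      have "is_best \<delta> wt {{}} (int (mem s' 0 vk) - 2 * int W) (row s1 q (mem s' 0 vk))"
        using s1(3) [of q] q k(1) by (simp add: row_ok_def closed_empty)
      then have "int (mem s' 0 vk) - 2 * int W = 0" "row s1 q (mem s' 0 vk) = 1"
        using k(3) jq by (auto simp: is_best_def)
      then have P': "sum \<delta> P = 0" "Suc (sum wt P) = best" using k jq by auto
      have "P \<in> closed t q" using P(2) [of "{}"] jq by (simp add: closed_empty)
      then have "P \<in> insert {} (subtrees t)" using closed_block [OF t(1)] unfolding q_def by simp
      moreover have "sum wt S \<le> sum wt P" if "i < n" "S \<in> subtrees i" "sum \<delta> S = 0" for i S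
        using s(3) that P'(2) unfolding good_def best_def [symmetric]
        by (metis lessThan_iff less_Suc_eq_le)
      ultimately show "?Q s'"
        using vs P(1) P'(1) t(1) jq q by (intro exI [of _ P] exI [of _ vs]) auto
    qed
  qed
  let ?s1 = "upd 0 vtop (vert t) s"
  have chain: "wp chain_prog (\<lambda>_ s'. padded s' \<and> good ({..<n} \<union> {j. t \<le> j \<and> j < sk t \<and> sk j = sk t}) s' \<and>
    (\<forall>j. t \<le> j \<and> j \<le> sk t \<longrightarrow> row_ok s' (sk t) j) \<and> mem s' 0 vend = vert (sk t))
    (3000 * W * (sk t - t)) ?s1"
    by (rule chain_prog_correct [OF _ _ _ t(1)])
      (use s in \<open>auto simp: static_def padded_def good_def\<close>)
  have "wp chain_prog (wp (Assign vx (Var vtop) ;; Assign vk (Plus (Var vW) (Var vW)) ;; ?W) (\<lambda>_. ?Q))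
    (4500 * W * n) ?s1"
  proof (rule wp_spec [OF wp_frame [OF chain]])
    have "W * (sk t - t) \<le> W * n"
      using sk_le [OF t(1)] by (intro mult_le_mono2) linarith
    then show "3000 * W * (sk t - t) \<le> 4500 * W * n" by (simp only: mult.assoc)
  next
    fix U s2 assume U: "4500 * W * n - 3000 * W * (sk t - t) \<le> U"
      and s2: "(padded s2 \<and> good ({..<n} \<union> {j. t \<le> j \<and> j < sk t \<and> sk j = sk t}) s2 \<and>
        (\<forall>j. t \<le> j \<and> j \<le> sk t \<longrightarrow> row_ok s2 (sk t) j) \<and> mem s2 0 vend = vert (sk t)) \<and>
        agree chain_prog ?s1 s2"
    have ag: "agree chain_prog ?s1 s2" using s2 by blast
    have "static ?s1" using s(1) by (simp add: static_def)
    then have st: "static s2" by (rule static_agree [OF _ ag]) (auto simp: wvars_progs)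
    have v: "mem s2 0 vtop = vert t" "outs s2 = outs s" "mem s2 0 vW = W"
      using agreeD(1,4) [OF ag] st by (simp_all add: wvars_progs static_def)
    have "W * (sk t - t) \<le> W * n"
      using sk_le [OF t(1)] by (intro mult_le_mono2) linarith
    moreover have "n \<le> W * n" using W_pos by simp
    ultimately have U': "500 * n + 11 \<le> U" using U n_pos by (simp only: mult.assoc)
    let ?s3 = "upd 0 vk (2 * W) (upd 0 vx (vert t) s2)"
    have "wp ?W (\<lambda>_. ?Q) (500 * n) ?s3"
      by (rule loop) (use st s2 v in \<open>auto simp: static_def padded_def row_ok_def q_def\<close>)
    then have "wp ?W (\<lambda>_. ?Q) (U - 11) ?s3"
      by (rule wp_spec) (use U' in auto)
    then show "wp (Assign vx (Var vtop) ;; Assign vk (Plus (Var vW) (Var vW)) ;; ?W) (\<lambda>_. ?Q) U s2"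
      using U' v by (simp add: mult_2 [symmetric])
  qed
  moreover define T where "T = 4500 * W * n"
  moreover have "T + 13 \<le> 5000 * W * n"
  proof -
    have "0 < W * n" using W_pos n_pos by simp
    then show ?thesis unfolding T_def mult.assoc by linarith
  qed
  ultimately have *: "wp chain_prog (wp (Assign vx (Var vtop) ;; Assign vk (Plus (Var vW) (Var vW)) ;; ?W) (\<lambda>_. ?Q))
      (5000 * W * n - 13) ?s1" "13 \<le> 5000 * W * n"
    by (auto elim!: wp_mono)
  then obtain T' where T': "5000 * W * n = T' + 13" by (metis le_add_diff_inverse2)
  show ?thesis
    using * True t(2) unfolding print_prog_def wp_Seq T' by simp
qed

end

section \<open>Correctness on graphs\<close>

lemma induced_with_proj_iff:
  fixes G H :: "'a pair_pre_digraph"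
  assumes "parcs G \<subseteq> pverts G \<times> pverts G"
  shows "induced_subgraph (with_proj H) (with_proj G) \<longleftrightarrow>
    pverts H \<subseteq> pverts G \<and> parcs H = parcs G \<inter> pverts H \<times> pverts H"
proof -
  have wf: "wf_digraph (with_proj K)" if K: "parcs K \<subseteq> pverts K \<times> pverts K" for K :: "'a pair_pre_digraph"
  proof
    fix e assume "e \<in> arcs (with_proj K)"
    then have "e \<in> pverts K \<times> pverts K" using K by auto
    then show "tail (with_proj K) e \<in> verts (with_proj K)" "head (with_proj K) e \<in> verts (with_proj K)"
      by auto
  qed
  have "wf_digraph (with_proj G)" using assms by (rule wf)
  moreover have "wf_digraph (with_proj H)" if "parcs H = parcs G \<inter> pverts H \<times> pverts H"
  proof (rule wf)
    show "parcs H \<subseteq> pverts H \<times> pverts H" by (subst that) (rule Int_lower2)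
  qed
  moreover have "parcs H = {e \<in> parcs G. fst e \<in> pverts H \<and> snd e \<in> pverts H} \<longleftrightarrow>
      parcs H = parcs G \<inter> pverts H \<times> pverts H"
    by (auto simp: set_eq_iff)
  ultimately show ?thesis
    by (auto simp: induced_subgraph_def subgraph_def compatible_def)
qed

context layout
begin

lemma vert_surj: "v < n \<Longrightarrow> \<exists>j<n. v = vert j"
  using bij_betw_imp_surj_on [OF bij_vert] by (metis imageE lessThan_iff)

lemma sum_\<delta>_vert:
  assumes "P \<subseteq> {..<n}" "pverts H = vert ` P" "\<And>v. col v = 0 \<longleftrightarrow> c v = Blue"
  shows "sum \<delta> P = int (color_weight H c w Blue) - int (color_weight H c w Red)"
    and "total_weight H w = sum wt P"
proof -
  have inj: "inj_on vert P" using bij_vert assms(1) by (meson bij_betw_def inj_on_subset)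
  have fin: "finite (pverts H)" using assms(1,2) finite_subset [of P] by auto
  let ?f = "\<lambda>v. if c v = Blue then int (w v) else - int (w v)"
  have red: "\<not> c v = Blue \<longleftrightarrow> c v = Red" for v by (cases "c v") auto
  have "sum \<delta> P = sum ?f (pverts H)"
    unfolding assms(2) sum.reindex [OF inj] using assms(3) by (simp add: \<delta>_def)
  also have "\<dots> = (\<Sum>v\<in>pverts H \<inter> {v. c v = Blue}. int (w v)) +
      (\<Sum>v\<in>pverts H \<inter> - {v. c v = Blue}. - int (w v))"
    by (rule sum.If_cases [OF fin])
  also have "\<dots> = int (color_weight H c w Blue) - int (color_weight H c w Red)"
    by (simp add: color_weight_def Int_def red sum_negf)
  finally show "sum \<delta> P = int (color_weight H c w Blue) - int (color_weight H c w Red)" .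
  show "total_weight H w = sum wt P"
    unfolding total_weight_def assms(2) by (simp add: sum.reindex [OF inj])
qed

text \<open>Combines the criteria for connectedness in rooted trees and in preorders; the position
  of a vertex serves as its rank.\<close>

lemma feasible_iff:
  assumes G: "pverts G = {..<n}" "parcs G = parent_arcs 0 {..<n} par \<union> (parent_arcs 0 {..<n} par)\<inverse>"
    and parent: "\<And>j. 0 < j \<Longrightarrow> j < n \<Longrightarrow> par (vert j) = vert (pp j)"
    and c: "\<And>v. col v = 0 \<longleftrightarrow> c v = Blue"
  shows "wbcs_feasible G c w H \<longleftrightarrow> (\<exists>P. P \<subseteq> {..<n} \<and> pverts H = vert ` P \<and>
    parcs H = parcs G \<inter> pverts H \<times> pverts H \<and> (P = {} \<or> (\<exists>t<n. P \<in> subtrees t)) \<and> sum \<delta> P = 0)"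
proof -
  define pos where "pos = the_inv_into {..<n} vert"
  have inj: "inj_on vert {..<n}" using bij_vert by (simp add: bij_betw_def)
  have pos: "pos (vert j) = j" if "j < n" for j
    using that inj by (simp add: pos_def the_inv_into_f_f)
  note ex = vert_surj
  have "rooted {..<n} 0 par pos"
  proof
    fix v assume "v \<in> {..<n}" "v \<noteq> 0"
    then obtain j where j: "j < n" "v = vert j" using ex by auto
    then have "0 < j" using \<open>v \<noteq> 0\<close> vert_0 by (cases j) auto
    then show "par v \<in> {..<n}" "pos (par v) < pos v"
      using parent [of j] pp_less [of j] j pos [of j] pos [of "pp j"] vert_less [of "pp j"] by auto
  qed (use n_pos in auto)
  then interpret rooted "{..<n}" 0 par pos .
  have arcs: "parcs G \<subseteq> pverts G \<times> pverts G" using G rooted.par [OF rooted_axioms]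
    by (auto simp: parent_arcs_def)
  have conn: "pverts H = {} \<or> Digraph_Component.connected (with_proj H) \<longleftrightarrow>
      P = {} \<or> (\<exists>t<n. P \<in> subtrees t)"
    if P: "P \<subseteq> {..<n}" "pverts H = vert ` P" "parcs H = parcs G \<inter> pverts H \<times> pverts H" for P
  proof (cases "P = {}")
    case False
    have sym: "sym (parcs H)" unfolding P(3) G(2) by (auto simp: sym_def)
    have in_iff: "vert k \<in> vert ` P \<longleftrightarrow> k \<in> P" if "k < n" for k
      using that P(1) inj by (auto simp: inj_on_def)
    have step: "(vert k \<noteq> 0 \<and> par (vert k) \<in> vert ` P) \<longleftrightarrow> (k \<noteq> 0 \<and> pp k \<in> P)" if "k < n" for k
    proof (cases "k = 0")
      case False
      then have "vert k \<noteq> 0" using vert_eq_iff [of k 0] vert_0 that by auto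
      then show ?thesis using False parent [of k] in_iff [of "pp k"] pp_less [of k] that by auto
    qed (simp add: vert_0)
    have "Digraph_Component.connected (with_proj H) \<longleftrightarrow>
        (\<forall>u\<in>pverts H. \<forall>v\<in>pverts H. (u, v) \<in> (parcs H)\<^sup>*)"
      using connected_with_proj_iff [of H] sym P False by auto
    also have "\<dots> \<longleftrightarrow> (\<exists>t\<in>pverts H. \<forall>x\<in>pverts H - {t}. x \<noteq> 0 \<and> par x \<in> pverts H)"
      unfolding P(3) using P(1,2) vert_less False by (intro connected_iff_rooted [OF _ _ G(2)]) auto
    also have "\<dots> \<longleftrightarrow> (\<exists>t\<in>P. \<forall>k\<in>P - {t}. k \<noteq> 0 \<and> pp k \<in> P)"
    proof -
      have "(\<forall>x\<in>vert ` P - {vert t}. x \<noteq> 0 \<and> par x \<in> vert ` P) \<longleftrightarrow>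
          (\<forall>k\<in>P - {t}. k \<noteq> 0 \<and> pp k \<in> P)" if "t \<in> P" for t
      proof -
        have "vert ` P - {vert t} = vert ` (P - {t})"
          using inj P(1) that by (auto simp: inj_on_def)
        moreover have "(\<forall>k\<in>P - {t}. vert k \<noteq> 0 \<and> par (vert k) \<in> vert ` P) \<longleftrightarrow>
            (\<forall>k\<in>P - {t}. k \<noteq> 0 \<and> pp k \<in> P)"
          using P(1) by (intro ball_cong refl step) auto
        ultimately show ?thesis by (simp only: ball_simps)
      qed
      then show ?thesis unfolding P(2) by auto
    qed
    also have "\<dots> \<longleftrightarrow> (\<exists>t<n. P \<in> subtrees t)"
      using P(1) by (intro subtree_iff) (auto simp: atLeast0LessThan)
    finally show ?thesis using False P(2) by simp
  qed (use that in simp)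
  have balanced: "color_weight H c w Blue = color_weight H c w Red \<longleftrightarrow> sum \<delta> P = 0"
    if "P \<subseteq> {..<n}" "pverts H = vert ` P" for P
    using sum_\<delta>_vert(1) [OF that c] by simp
  have "\<exists>P\<subseteq>{..<n}. pverts H = vert ` P" if "pverts H \<subseteq> {..<n}"
    using that bij_vert by (metis bij_betw_def subset_image_iff)
  moreover have "vert ` P \<subseteq> {..<n}" if "P \<subseteq> {..<n}" for P using vert_less that by auto
  ultimately show ?thesis
    unfolding wbcs_feasible_def induced_with_proj_iff [OF arcs] G(1)
    using conn balanced by (metis (no_types, lifting))
qed

end

section \<open>The complete program\<close>

definition wbcs_prog :: com where
  "wbcs_prog = read_prog ;; discover_prog ;; size_prog ;; preorder_prog ;; base_prog ;;
    solve_prog ;; print_prog"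

lemma cwf_wbcs_prog: "cwf wbcs_prog"
  by (simp add: wbcs_prog_def read_prog_def discover_prog_def discover_edge_def add_vertex_def
      size_prog_def preorder_prog_def insert_vertex_def base_prog_def solve_prog_def
      chain_prog_def chain_body_def update_prog_def fill_prog_def print_prog_def print_body_def)

lemma footprints:
  "wvars discover_prog = {vi, vj, vx, vy, vcnt}" "warrs discover_prog = {avis, apar, aord}"
  "wvars size_prog = {vi, vx, vy}" "warrs size_prog = {asize}"
  "wvars preorder_prog = {vi, vj, vx, vy}" "warrs preorder_prog = {anext, aprev, askip}"
  "wvars base_prog = {vstride, vu, vi}" "warrs base_prog = {abase}"
  "warrs read_prog = {acol, awt, afrom, ato}"
  "wvars solve_prog = {vbest, vi, vtop} \<union> wvars chain_prog" "warrs solve_prog = {arow}"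
  "\<not> prints read_prog" "\<not> prints discover_prog" "\<not> prints size_prog" "\<not> prints preorder_prog"
  "\<not> prints base_prog" "\<not> prints solve_prog"
  by (auto simp: read_prog_def discover_prog_def discover_edge_def add_vertex_def
      size_prog_def preorder_prog_def insert_vertex_def base_prog_def solve_prog_def wvars_progs)

text \<open>Budgets are natural numbers, hence \<open>L\<close> is rounded down; the total length of
  the blocks of tops, being an integer, still does not exceed it.\<close>

lemma wbcs_prog_correct:
  assumes tree: "undirected_tree G" and V: "pverts G = {0..<n}" and w: "\<forall>v\<in>pverts G. 0 < w v"
    and es: "edge_list G es" and c: "\<And>v. cn v = 0 \<longleftrightarrow> c v = Blue"
    and W: "W = total_weight G w"
    and s0: "mem s0 = (\<lambda>_ _. 0)" "outs s0 = []" "ins s0 = n # concat (map (\<lambda>v. [cn v, w v]) [0..<n]) @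
      concat (map (\<lambda>(u, v). [u, v]) es)"
    and L: "L = nat \<lfloor>real n * (1 + log 2 (real n))\<rfloor>"
  shows "wp wbcs_prog (\<lambda>_ s'. \<exists>H. encodes_subgraph (map int (outs s')) H \<and> wbcs_solution G c w H)
    (1200 * n + 800 * n * n + 5000 * W * n + 3000 * W * L) s0"
    (is "wp _ (\<lambda>_. ?Q) ?T _")
proof -
  note G = undirected_tree_arcs [OF tree]
  have n: "0 < n" using G(5) V by simp
  have len: "length es = n - 1"
    using undirected_tree_length_edge_list [OF tree es] V by simp
  have E: "parcs G = set es \<union> (set es)\<inverse>" using es by (simp add: edge_list_def)
  have V': "pverts G = {..<n}" using V by (simp add: atLeast0LessThan)
  have es_n: "set es \<subseteq> {..<n} \<times> {..<n}" using G(2) E V' by auto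
  have W': "W = sum w {..<n}" using W V' by (simp add: total_weight_def)
  have W_pos: "0 < W" using w n V' unfolding W' by (intro sum_pos) auto
  \<comment> \<open>What reading and rooting establish and the later stages preserve up to the
    dynamic programming. The zeros in \<open>arow\<close> make the rows padded from the
    start.\<close>
  define R where "R = (\<lambda>ys s. holds_input n cn w es s \<and> discovered n es ys s \<and>
    set ys = {..<n} \<and> mem s arow = (\<lambda>_. 0) \<and> outs s = [])"
  define Z where "Z = (\<lambda>s :: store. \<forall>v<n. mem s asize v =
    Suc (\<Sum>u | 0 < u \<and> u < n \<and> mem s apar u = v. mem s asize u))"
  have R_agree: "R ys s'" if "R ys s" "agree p s s'" "wvars p \<inter> {vn, vW, vcnt} = {}"
    "warrs p \<inter> {acol, awt, afrom, ato, apar, aord, avis, arow} = {}" "\<not> prints p" for p ys s s'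
  proof -
    have "holds_input n cn w es s'"
      by (rule holds_input_agree [OF _ that(2)]) (use that in \<open>auto simp: R_def\<close>)
    moreover have "discovered n es ys s'"
      by (rule discovered_cong [of n es ys s]) (use that agreeD(1,2) [OF that(2)] in \<open>auto simp: R_def\<close>)
    ultimately show ?thesis
      using that agreeD(2,4) [OF that(2)] by (simp add: R_def)
  qed
  have par_less: "mem s apar v < n" if R: "R ys s" and v: "0 < v" "v < n" for s ys v
  proof -
    have "parent_order ys (mem s apar)" using R by (simp add: R_def discovered_def)
    then obtain rank :: "nat \<Rightarrow> nat" where
      "\<And>v. v \<in> set ys - {hd ys} \<Longrightarrow> mem s apar v \<in> set ys \<and> rank (mem s apar v) < rank v"
      using parent_order_rank by blast
    from this [of v] show ?thesis using R v by (auto simp: R_def discovered_def)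
  qed
  \<comment> \<open>The stages are composed from the last to the first, so that each one can hand
    over to the specification of all that follow.\<close>
  let ?p6 = "solve_prog ;; print_prog" and ?T6 = "300 * n + 3000 * W * L + 5000 * W * n"
  have 6: "wp ?p6 (\<lambda>_. ?Q) ?T6 s"
    if R: "R ys s" and Z: "Z s" and ins: "inserted n (mem s apar) (mem s asize) {..<n} s"
      and base: "mem s 0 vstride = 4 * W + 1" "\<forall>v\<le>n. mem s abase v = v * (4 * W + 1)" for s ys
  proof -
    note s = R [unfolded R_def]
    let ?par = "mem s apar" and ?sz = "mem s asize"
    obtain xs where xs: "distinct xs" "set xs = {..<n}" "xs \<noteq> []" "hd xs = 0"
        "preordered xs ?par (mem s askip) n" "linked (mem s anext) (mem s aprev) (xs @ [n])"
      using conjunct1 [OF ins [unfolded inserted_def]] by blast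
    have heavy: "\<forall>v\<in>{..<n} - {0}. mem s askip v = mem s askip (?par v) \<or>
        (\<exists>u\<in>{..<n} - {0}. u \<noteq> v \<and> ?par u = ?par v \<and> ?sz v \<le> ?sz u)"
      by (rule conjunct2 [OF ins [unfolded inserted_def]])
    have len_xs: "length xs = n" using xs(1,2) distinct_card [of xs] by simp
    obtain pp sk where pre: "preorder n pp sk"
        "\<And>i. 0 < i \<Longrightarrow> i < n \<Longrightarrow> ?par (xs ! i) = xs ! pp i"
        "\<And>i. i < n \<Longrightarrow> mem s askip (xs ! i) = (xs @ [n]) ! sk i"
      using preordered_positions [OF xs(5,1,3)] unfolding len_xs by blast
    interpret preorder n pp sk by (rule pre(1))
    interpret layout n pp sk xs cn w W
      by unfold_locales (use len_xs xs W' W_pos in auto)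
    have vert: "vert j = xs ! j" if "j < n" for j
      using that len_xs by (simp add: vert_def nth_append)
    have par: "?par (vert j) = vert (pp j)" if "0 < j" "j < n" for j
      using pre(2) [OF that] that pp_less [OF that] vert by simp
    have skip: "mem s askip (vert j) = vert (sk j)" if "j < n" for j
      using pre(3) [OF that] vert [OF that] by (simp add: vert_def)
    have "\<forall>v. 0 < v \<and> v < n \<longrightarrow> ?par v < n" using par_less [OF R] by blast
    note size = sizes_bounds [OF Z [unfolded Z_def] this n]
    have "real (\<Sum>t | top t. sk t - t) \<le> real n * (1 + log 2 (real n))"
    proof (rule sum_chains [of "\<lambda>j. ?sz (vert j)"])
      fix u assume u: "0 < u" "u < n"
      have v: "0 < vert u" "vert u < n"
        using vert_eq_iff [of u 0] vert_0 u vert_less by auto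
      show "?sz (vert u) \<le> ?sz (vert (pp u))"
        using size(2) [OF v] par [OF u] by simp
      \<comment> \<open>A top other than the root does not share \<open>skip\<close> with its
        parent, so it has a sibling at least as large, and both fit into the parent.\<close>
      assume "top u"
      then have "sk u \<noteq> sk (pp u)" using u by (simp add: top_def)
      then have "vert (sk u) \<noteq> vert (sk (pp u))"
        using vert_eq_iff [of "sk u" "sk (pp u)"] sk_le [of u] sk_le [of "pp u"] pp_less [OF u] u
        by simp
      then have "mem s askip (vert u) \<noteq> mem s askip (?par (vert u))"
        using skip [of u] skip [of "pp u"] par [OF u] pp_less [OF u] u by simp
      then obtain u' where "u' < n" "0 < u'" "u' \<noteq> vert u" "?par u' = ?par (vert u)"
          "?sz (vert u) \<le> ?sz u'"
        using bspec [OF heavy, of "vert u"] v by auto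
      then show "2 * ?sz (vert u) \<le> ?sz (vert (pp u))"
        using size(3) [of u' "vert u"] v par [OF u] by simp
    next
      show "0 < ?sz (vert u)" if "u < n" for u
        using Z vert_less [OF that] by (auto simp: Z_def)
      show "?sz (vert 0) \<le> n" using size(1) vert_0 by simp
    qed
    then have "(\<Sum>t | top t. sk t - t) \<le> L"
      unfolding L by (simp add: le_nat_floor)
    then have time: "chain_time \<le> 3000 * W * L"
      unfolding chain_time_def by (rule mult_le_mono2)
    have link: "mem s anext (vert j) = vert (Suc j) \<and> mem s aprev (vert (Suc j)) = vert j" if "j < n" for j
      using xs(6) that len_xs unfolding linked_def vert_def
      by (simp add: successively_conv_nth)
    have "mem s 0 vW = W" using s W' by (simp add: holds_input_def)
    then have st: "static s"
      unfolding static_def using s base link skip par by (simp add: holds_input_def)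
    have pad: "padded s" using s by (simp add: padded_def row_def)
    have "parent_order ys ?par" using s by (simp add: discovered_def)
    then obtain rank :: "nat \<Rightarrow> nat" where
      rank: "\<And>v. v \<in> set ys - {hd ys} \<Longrightarrow> ?par v \<in> set ys \<and> rank (?par v) < rank v"
      using parent_order_rank by blast
    have hd: "hd ys = 0" using s by (simp add: discovered_def)
    have "rooted {..<n} 0 ?par rank"
      by unfold_locales (use n rank s hd in auto)
    moreover have "parent_arcs 0 {..<n} ?par \<subseteq> parcs G"
    proof -
      have "discovered n es ys s" "set ys = {..<n}" using s by blast+
      then show ?thesis using E by (simp add: discovered_def)
    qed
    ultimately have arcs: "parcs G = parent_arcs 0 {..<n} ?par \<union> (parent_arcs 0 {..<n} ?par)\<inverse>"
      using rooted.arcs_eq_parent_arcs [of "{..<n}" 0 ?par rank "parcs G"] G(2,3)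
        undirected_tree_bridges [OF tree] V' by simp
    have feasible: "wbcs_feasible G c w H \<longleftrightarrow> (\<exists>P. P \<subseteq> {..<n} \<and> pverts H = vert ` P \<and>
      parcs H = parcs G \<inter> pverts H \<times> pverts H \<and> (P = {} \<or> (\<exists>t<n. P \<in> subtrees t)) \<and>
      sum \<delta> P = 0)" for H
      by (rule feasible_iff [OF V' arcs]) (use par c in auto)
    have print: "wp print_prog (\<lambda>_. ?Q) (5000 * W * n) s1"
      if s1: "static s1" "padded s1" "good {..<n} s1" "outs s1 = []" for s1 :: store
    proof (rule wp_spec [OF print_prog_correct [OF s1(1-3)]])
      fix s2 :: store assume "\<exists>P vs. outs s2 = outs s1 @ vs \<and> distinct vs \<and> set vs = vert ` P \<and>
        P \<subseteq> {..<n} \<and> (P = {} \<or> (\<exists>t<n. P \<in> subtrees t)) \<and> sum \<delta> P = 0 \<and>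
        (\<forall>j<n. \<forall>S\<in>subtrees j. sum \<delta> S = 0 \<longrightarrow> sum wt S \<le> sum wt P)"
      then obtain P vs where P: "outs s2 = outs s1 @ vs" "distinct vs" "set vs = vert ` P" "P \<subseteq> {..<n}"
          "P = {} \<or> (\<exists>t<n. P \<in> subtrees t)" "sum \<delta> P = 0"
          "\<forall>j<n. \<forall>S\<in>subtrees j. sum \<delta> S = 0 \<longrightarrow> sum wt S \<le> sum wt P"
        by blast
      define H where "H = \<lparr>pverts = vert ` P, parcs = parcs G \<inter> vert ` P \<times> vert ` P\<rparr>"
      have "wbcs_feasible G c w H"
        unfolding feasible using P(4-6) by (intro exI [of _ P]) (simp add: H_def)
      moreover have "total_weight H' w \<le> total_weight H w" if H': "wbcs_feasible G c w H'" for H'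
      proof -
        obtain P' where P': "P' \<subseteq> {..<n}" "pverts H' = vert ` P'"
            "P' = {} \<or> (\<exists>t<n. P' \<in> subtrees t)" "sum \<delta> P' = 0"
          using H' unfolding feasible by blast
        have "sum wt P' \<le> sum wt P" using P'(3,4) P(7) by auto
        then show ?thesis
          using sum_\<delta>_vert(2) [OF P'(1,2) c] sum_\<delta>_vert(2) [OF P(4) _ c, of H] by (simp add: H_def)
      qed
      ultimately have "wbcs_solution G c w H" by (simp add: wbcs_solution_def)
      moreover have "encodes_subgraph (map int (outs s2)) H"
        using P(1-3) s1(4) by (simp add: encodes_subgraph_def H_def distinct_map)
      ultimately show "?Q s2" by blast
    qed simp
    show ?thesis
      unfolding wp_Seq
    proof (rule wp_spec [OF wp_frame [OF solve_prog_correct [OF st pad]]])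
      show "300 * n + chain_time \<le> 300 * n + 3000 * W * L + 5000 * W * n" using time by simp
    next
      fix U and s1 :: store assume U: "300 * n + 3000 * W * L + 5000 * W * n - (300 * n + chain_time) \<le> U"
        and s1: "(padded s1 \<and> good {..<n} s1) \<and> agree solve_prog s s1"
      have ag: "agree solve_prog s s1" using s1 by blast
      have "static s1" using st
        by (rule static_agree [OF _ ag]) (auto simp: footprints wvars_progs)
      moreover have "outs s1 = []" using agreeD(4) [OF ag] s footprints by simp
      ultimately have "wp print_prog (\<lambda>_. ?Q) (5000 * W * n) s1" using s1 by (intro print) auto
      then show "wp print_prog (\<lambda>_. ?Q) U s1" by (rule wp_spec) (use U time in auto)
    qed
  qed
  let ?p5 = "base_prog ;; ?p6" and ?T5 = "200 * n + ?T6"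
  have 5: "wp ?p5 (\<lambda>_. ?Q) ?T5 s"
    if s: "R ys s" "Z s" "inserted n (mem s apar) (mem s asize) {..<n} s" for s ys
    unfolding wp_Seq [of base_prog]
  proof (rule wp_spec [OF wp_frame [OF base_prog_correct]])
    show "mem s 0 vn = n" "mem s 0 vW = W" using s(1) by (simp_all add: R_def holds_input_def W')
    fix U and s1 :: store assume U: "?T5 - 200 * n \<le> U"
      and s1: "(mem s1 0 vstride = 4 * W + 1 \<and> (\<forall>v\<le>n. mem s1 abase v = v * (4 * W + 1))) \<and>
        agree base_prog s s1"
    have ag: "agree base_prog s s1" using s1 by blast
    note eq = agreeD(2) [OF ag]
    have "wp ?p6 (\<lambda>_. ?Q) ?T6 s1"
    proof (rule 6)
      show "R ys s1" using s(1) by (rule R_agree [OF _ ag]) (auto simp: footprints)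
      show "inserted n (mem s1 apar) (mem s1 asize) {..<n} s1"
        using s(3) by (auto simp: eq footprints elim!: inserted_cong)
    qed (use s s1 in \<open>auto simp: eq footprints Z_def\<close>)
    then show "wp ?p6 (\<lambda>_. ?Q) U s1" by (rule wp_spec) (use U in auto)
  qed (use n in auto)
  let ?p4 = "preorder_prog ;; ?p5" and ?T4 = "500 * n * n + ?T5"
  have 4: "wp ?p4 (\<lambda>_. ?Q) ?T4 s" if s: "R ys s" "Z s" for s ys
  proof -
    have "\<forall>v. 0 < v \<and> v < n \<longrightarrow> mem s apar v < n" using par_less [OF s(1)] by blast
    note size = sizes_bounds [OF s(2) [unfolded Z_def] this n]
    show ?thesis
      unfolding wp_Seq [of preorder_prog]
    proof (rule wp_spec [OF wp_frame [OF preorder_prog_correct [OF _ n refl refl]]])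
      show "mem s 0 vn = n" "mem s apar 0 = 0"
        using s(1) by (simp_all add: R_def holds_input_def discovered_def)
      show "0 < mem s asize v" if "v < n" for v using s(2) that by (auto simp: Z_def)
    next
      fix U and s1 :: store assume U: "?T4 - 500 * n * n \<le> U"
        and s1: "inserted n (mem s apar) (mem s asize) {..<n} s1 \<and> agree preorder_prog s s1"
      have ag: "agree preorder_prog s s1" using s1 by blast
      note eq = agreeD(2) [OF ag]
      have "wp ?p5 (\<lambda>_. ?Q) ?T5 s1"
      proof (rule 5)
        show "R ys s1" using s(1) by (rule R_agree [OF _ ag]) (auto simp: footprints)
      qed (use s s1 in \<open>auto simp: eq footprints Z_def\<close>)
      then show "wp ?p5 (\<lambda>_. ?Q) U s1" by (rule wp_spec) (use U in auto)
    qed (use size par_less [OF s(1)] in auto)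
  qed
  let ?p3 = "size_prog ;; ?p4" and ?T3 = "400 * n + ?T4"
  have 3: "wp ?p3 (\<lambda>_. ?Q) ?T3 s" if s: "R ys s" for s ys
    unfolding wp_Seq [of size_prog]
  proof (rule wp_spec [OF wp_frame [OF size_prog_correct [OF _ n _ _ _ _ refl]]])
    show "mem s 0 vn = n" using s by (simp add: R_def holds_input_def)
    show ys: "parent_order ys (mem s apar)" "hd ys = 0" "set ys = {..<n}"
      using s by (simp_all add: R_def discovered_def)
    then have "length ys = n"
      using distinct_card [of ys] by (auto simp: parent_order_def)
    then show "mem s aord k = ys ! k" if "k < n" for k
      using s that by (simp add: R_def discovered_def)
  next
    fix U and s1 :: store assume U: "?T3 - 400 * n \<le> U"
      and s1: "(\<forall>v<n. mem s1 asize v =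
        Suc (\<Sum>u | 0 < u \<and> u < n \<and> mem s apar u = v. mem s1 asize u)) \<and> agree size_prog s s1"
    have ag: "agree size_prog s s1" using s1 by blast
    have "R ys s1" using s by (rule R_agree [OF _ ag]) (auto simp: footprints)
    moreover have "Z s1" using s1 by (simp add: Z_def agreeD(2) [OF ag] footprints)
    ultimately have "wp ?p4 (\<lambda>_. ?Q) ?T4 s1" by (rule 4)
    then show "wp ?p4 (\<lambda>_. ?Q) U s1" by (rule wp_spec) (use U in auto)
  qed simp
  let ?p2 = "discover_prog ;; ?p3" and ?T2 = "300 * n * n + ?T3"
  have 2: "wp ?p2 (\<lambda>_. ?Q) ?T2 s"
    if s: "holds_input n cn w es s" "mem s apar = (\<lambda>_. 0)" "mem s aord = (\<lambda>_. 0)"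
      "mem s avis = (\<lambda>_. 0)" "mem s arow = (\<lambda>_. 0)" "outs s = []" for s
    unfolding wp_Seq [of discover_prog]
  proof (rule wp_spec [OF wp_frame [OF discover_prog_correct [OF s(1) len n es_n _ s(2-4)]]])
    show "(0, v) \<in> (set es \<union> (set es)\<inverse>)\<^sup>*" if "v < n" for v
      using G(4) [of 0 v] that n V' E by simp
  next
    fix U and s1 :: store assume U: "?T2 - 300 * n * n \<le> U"
      and s1: "(\<exists>ys. discovered n es ys s1 \<and> set ys = {..<n}) \<and> agree discover_prog s s1"
    then obtain ys where ys: "discovered n es ys s1" "set ys = {..<n}" by blast
    have ag: "agree discover_prog s s1" using s1 by blast
    have "holds_input n cn w es s1"
      using s(1) by (rule holds_input_agree [OF _ ag]) (auto simp: footprints)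
    then have "R ys s1" using s ys agreeD(2,4) [OF ag] by (simp add: R_def footprints)
    then have "wp ?p3 (\<lambda>_. ?Q) ?T3 s1" by (rule 3)
    then show "wp ?p3 (\<lambda>_. ?Q) U s1" by (rule wp_spec) (use U in auto)
  qed simp
  show ?thesis
    unfolding wbcs_prog_def wp_Seq [of read_prog]
  proof (rule wp_spec [OF wp_frame [OF read_prog_correct [OF s0(3) len _ n]]])
    show "mem s0 0 vW = 0" using s0(1) by simp
  next
    fix U and s1 :: store assume U: "?T - 300 * n \<le> U"
      and s1: "holds_input n cn w es s1 \<and> agree read_prog s0 s1"
    have ag: "agree read_prog s0 s1" using s1 by blast
    have "wp ?p2 (\<lambda>_. ?Q) ?T2 s1"
      by (rule 2) (use s1 s0 in \<open>auto simp: agreeD(2,4) [OF ag] footprints\<close>)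
    then show "wp ?p2 (\<lambda>_. ?Q) U s1" by (rule wp_spec) (use U in auto)
  qed simp
qed

section \<open>Running time\<close>

text \<open>From \<open>ln y \<le> y - 1\<close> for \<open>y = x powr 0.585\<close> and
  \<open>ln 2 \<ge> 1 / 2\<close>. The 4 exceeds \<open>1 / 0.2925\<close>, where
  \<open>0.2925 = 0.585 / 2\<close>; the exponent is \<open>1.585 - 1\<close>.\<close>

lemma log_powr_bound:
  assumes "1 \<le> (x :: real)"
  shows "1 + log 2 x \<le> 4 * x powr 0.585"
proof -
  have "0.585 * ln x = ln (x powr 0.585)" using assms by (simp add: ln_powr)
  also have "\<dots> \<le> x powr 0.585 - 1" using assms by (intro ln_le_minus_one) simp
  finally have 1: "0.585 * ln x \<le> x powr 0.585 - 1" .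
  have "ln (1 / 2 :: real) \<le> 1 / 2 - 1" by (intro ln_le_minus_one) simp
  then have "1 / 2 \<le> ln (2 :: real)" by (simp add: ln_div)
  then have "log 2 x * (1 / 2) \<le> log 2 x * ln 2"
    using assms by (intro mult_left_mono) auto
  also have "\<dots> = ln x" by (simp add: log_def)
  finally have "0.2925 * log 2 x \<le> x powr 0.585 - 1" using 1 by simp
  moreover have "1 \<le> x powr 0.585" using assms by (intro ge_one_powr_ge_zero) auto
  ultimately show ?thesis by simp
qed

lemma log_le_self:
  assumes "0 < n"
  shows "1 + log 2 (real n) \<le> real n"
proof -
  have "n \<le> 2 ^ (n - 1)" using assms by (cases n) (simp_all add: Suc_leI)
  then have "real n \<le> 2 ^ (n - 1)" by (metis of_nat_le_iff of_nat_numeral of_nat_power)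
  then have "log 2 (real n) \<le> log 2 (2 ^ (n - 1))" using assms by (intro log_mono) auto
  then show ?thesis using assms by (simp add: log_nat_power of_nat_diff)
qed

lemma wbcs_prog_computes:
  assumes asm: "undirected_tree G \<and> pverts G = {0..<n} \<and> (\<forall>v\<in>pverts G. w v > 0) \<and>
    W = total_weight G w \<and> edge_list G es"
  shows "\<exists>t ys H. ram_computes (ccomp 0 wbcs_prog) (wbcs_input n col w es) t ys \<and>
    encodes_subgraph ys H \<and> wbcs_solution G col w H \<and>
    real t \<le> min (10000 * (real n * real W ^ 2)) (40000 * (real n powr 1.585 * real W))"
proof -
  define cn where "cn = (\<lambda>v. if col v = Blue then 0 else 1 :: nat)"
  define L where "L = nat \<lfloor>real n * (1 + log 2 (real n))\<rfloor>"
  define xs where "xs = n # concat (map (\<lambda>v. [cn v, w v]) [0..<n]) @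
    concat (map (\<lambda>(u, v). [u, v]) es)"
  let ?s0 = "\<lparr>mem = \<lambda>_ _. 0, ins = xs, outs = []\<rparr>"
  let ?T = "1200 * n + 800 * n * n + 5000 * W * n + 3000 * W * L"
  have "wp wbcs_prog (\<lambda>_ s'. \<exists>H. encodes_subgraph (map int (outs s')) H \<and> wbcs_solution G col w H)
      ?T ?s0"
    by (rule wbcs_prog_correct) (use asm in \<open>auto simp: cn_def L_def xs_def\<close>)
  then obtain k s' H where s': "exec wbcs_prog ?s0 k s'" "k \<le> ?T"
      "encodes_subgraph (map int (outs s')) H" "wbcs_solution G col w H"
    unfolding wp_def by blast
  obtain t where t: "t \<le> k" "ram_computes (ccomp 0 wbcs_prog) (map int xs) t (map int (outs s'))"
    using ccomp_computes [OF s'(1) cwf_wbcs_prog] by blast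
  have "int (cn v) = color_code (col v)" for v by (cases "col v") (auto simp: cn_def)
  then have xs: "map int xs = wbcs_input n col w es"
    by (simp add: xs_def wbcs_input_def map_concat comp_def case_prod_unfold)
  have n: "1 \<le> n" using asm undirected_tree_arcs(5) [of G] by (cases n) auto
  \<comment> \<open>Positive weights give \<open>n \<le> W\<close>, which lets the stages of
    quadratic time fit into the bound.\<close>
  have "(\<Sum>v<n. 1) \<le> sum w {..<n}" using asm by (intro sum_mono) (simp add: Suc_leI)
  then have nW: "n \<le> W" using asm by (simp add: total_weight_def atLeast0LessThan)
  let ?l = "1 + log 2 (real n)"
  have l: "1 \<le> ?l" using n by simp
  have "real L \<le> real n * ?l" unfolding L_def using n l by (simp add: of_nat_nat)
  have "real t \<le> real ?T" using t(1) s'(2) by (simp only: of_nat_le_iff)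
  \<comment> \<open>The constant is \<open>1200 + 800 + 5000 + 3000\<close>, since each summand of
    the budget is at most its coefficient times \<open>W n (1 + log n)\<close>.\<close>
  also have "\<dots> \<le> 10000 * (real W * real n * ?l)"
  proof -
    have "real n * real n \<le> real W * real n" using nW by (intro mult_right_mono) auto
    moreover have "real n \<le> real W * real n" using n nW by (simp add: mult_le_cancel_right1)
    moreover have "real W * real n \<le> real W * real n * ?l"
      using mult_left_mono [OF l, of "real W * real n"] by simp
    moreover have "real W * real L \<le> real W * (real n * ?l)"
      using \<open>real L \<le> _\<close> by (intro mult_left_mono) auto
    ultimately show ?thesis by (simp add: mult.assoc)
  qed
  finally have T: "real t \<le> 10000 * (real W * real n * ?l)" .
  have "real W * real n * ?l \<le> real W * real n * real W"
    using log_le_self [of n] n nW by (intro mult_left_mono) auto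
  then have 1: "real t \<le> 10000 * (real n * real W ^ 2)"
    using T by (simp add: power2_eq_square mult.commute mult.left_commute)
  have "real W * real n * ?l \<le> real W * real n * (4 * real n powr 0.585)"
    using log_powr_bound [of "real n"] n by (intro mult_left_mono) auto
  moreover have "real n powr 1.585 = real n * real n powr 0.585"
    using n powr_add [of "real n" 1 "0.585"] by simp
  ultimately have 2: "real t \<le> 40000 * (real n powr 1.585 * real W)"
    using T by (simp add: mult.commute mult.left_commute)
  show ?thesis
    using t(2) [unfolded xs] s'(3,4) min.boundedI [OF 1 2] by blast
qed

theorem theorem3:
  shows "\<exists>(P :: instr list) (C1 :: real) (C2 :: real).
    \<forall>(n :: nat) (G :: nat pair_pre_digraph) (col :: nat \<Rightarrow> color) (w :: nat \<Rightarrow> nat)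
      (es :: (nat \<times> nat) list) (W :: nat).
      undirected_tree G \<and> pverts G = {0..<n} \<and> (\<forall>v\<in>pverts G. w v > 0) \<and>
      W = total_weight G w \<and> edge_list G es \<longrightarrow>
      (\<exists>t ys H. ram_computes P (wbcs_input n col w es) t ys \<and>
        encodes_subgraph ys H \<and> wbcs_solution G col w H \<and>
        real t \<le> min (C1 * (real n * real W ^ 2)) (C2 * (real n powr 1.585 * real W)))"
  using wbcs_prog_computes by blast

end
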